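(* Let $N\ge2$, $\mathcal{L}=\partial_x^N+u_{N-2}(x)\partial_x^{N-2}+\cdots+u_0(x)$, and let $\kappa_N=(-1)^{N/2+1}$ if $N$ is even and $\kappa_N\in\{1,-1\}$ (fixed) if $N$ is odd. Let $H_k^j(x,y)$ be the Hadamard's coefficients of $\partial_tv=\kappa_N\mathcal{L}v$ and let $\omega_n(x,y)$ be the coefficients of $\mathfrak{R}(\mathcal{L})=\Psi(x,z)\Psi^*(y,z)=\left(\sum_{n\ge0}\omega_n(x,y)z^{-n}\right)e^{(x-y)z}$. Then for all $k\in\mathbb{N}$ and $j\in\{0,\dots,N-2\}$, $$H_k^{j}(x,y)=(-\kappa_N N)^k\sum_{n=1}^{k(N-1)-j}\omega_n(x,y)\;\mathrm{res}_{\partial_x}\left[\partial_x^{-n}\left(\frac{1}{x-y}\partial_x^{N-1}\right)^k\partial_x^{-j-1}\right].$$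
   Context: The coefficients $u_j$ are smooth functions of $x$. Airy-type function: $A_N(z)=A_N(z;\kappa_N)=\frac{1}{2\pi}\int_{-\infty}^{\infty}e^{iz\xi+\kappa_N(i\xi)^N}d\xi$; for $N$ odd this is understood as $\frac{1}{2\pi i}\int_{c-i\infty}^{c+i\infty}e^{z\xi+\kappa_N\xi^N}d\xi$ with any $c>0$ if $\kappa_N=(-1)^{(N+1)/2}$ and any $c<0$ if $\kappa_N=(-1)^{(N-1)/2}$. It is entire and satisfies $A_N^{(N-1)}(z)=-\frac{\kappa_N}{N}zA_N(z)$. Heat kernel and Hadamard's coefficients: the heat kernel of $\partial_tv=\kappa_N\mathcal{L}v$ is the formal expansion ($t>0$) $$\mathcal{H}(x,y,t)=\frac{1}{\sqrt[N]{t}}A_N\left(\frac{x-y}{\sqrt[N]{t}}\right)+\sum_{j=0}^{N-2}\frac{1}{\sqrt[N]{t^{j+1}}}A_N^{(j)}\left(\frac{x-y}{\sqrt[N]{t}}\right)\sum_{k=1}^{\infty}H_k^j(x,y)t^k,$$ where the $H_k^j$ are uniquely determined by: (a) for fixed $y$, $\mathcal{H}(x,y,t)$ formally solves $\partial_tv=\kappa_N\mathcal{L}v$ (i.e. after substitution and elimination of $A_N^{(N-1)}$ and higher derivatives by the Airy equation, the coefficients of each $t^{-(j+1)/N}A_N^{(j)}\left(\frac{x-y}{\sqrt[N]{t}}\right)t^k$, $0\le j\le N-2$, on both sides coincide); (b) the $H_k^j(x,y)$ are smooth in a neighborhood of the diagonal $y=x$. Formal pseudo-differential operators are series $\sum_{i\le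 m}r_i(x)\partial_x^i$, multiplied via $\partial_x^k\cdot r(x)=\sum_{i\ge0}\binom{k}{i}r^{(i)}(x)\partial_x^{k-i}$, $k\in\mathbb{Z}$; $\mathrm{res}_{\partial_x}\sum_ir_i\partial_x^i=r_{-1}$. In the displayed formula $y$ is a parameter independent of $x$, and $1/(x-y)$ is a function of $x$ defined for $x\ne y$. The adjoint $^*$ is the antiautomorphism with $\partial_x^*=-\partial_x$ fixing functions. Write $\mathcal{L}=S\partial_x^NS^{-1}$ with $S=\sum_{k\ge0}\psi_k(x)\partial_x^{-k}$, $\psi_0=1$ ($S$ is unique up to right multiplication by a constant-coefficient operator $1+\sum_{j\ge1}c_j\partial_x^{-j}$). With $\partial_x^je^{xz}=z^je^{xz}$ for all $j\in\mathbb{Z}$ (and similarly for $e^{-xz}$), put $\Psi(x,z)=Se^{xz}=\left(\sum_k\psi_k(x)z^{-k}\right)e^{xz}$ and $\Psi^*(x,z)=(S^* )^{-1}e^{-xz}=\left(\sum_k\psi_k^*(x)z^{-k}\right)e^{-xz}$. The product $\Psi(x,z)\Psi^*(y,z)$, hence each $\omega_n(x,y)$, depends only on $\mathcal{L}$. *)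

theory Defs
  imports
    "HOL-Analysis.Analysis"
    "HOL-Library.Groups_Big_Fun"
    "HOL-Computational_Algebra.Formal_Power_Series"
begin

section \<open>Smooth functions\<close>

primrec higher_differentiable_on ::
    "'a::real_normed_vector set \<Rightarrow> ('a \<Rightarrow> 'b::real_normed_vector) \<Rightarrow> nat \<Rightarrow> bool" where
  "higher_differentiable_on A f 0 \<longleftrightarrow> continuous_on A f"
| "higher_differentiable_on A f (Suc n) \<longleftrightarrow>
     (\<forall>x\<in>A. f differentiable (at x)) \<and>
     (\<forall>v. higher_differentiable_on A (\<lambda>x. frechet_derivative f (at x) v) n)"

text \<open>Used for open \<open>A\<close> only (an interval of the line, or a subset of the plane).\<close>

definition smooth_on :: "'a::real_normed_vector set \<Rightarrow> ('a \<Rightarrow> 'b::real_normed_vector) \<Rightarrow> bool" where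
  "smooth_on A f \<longleftrightarrow> (\<forall>n. higher_differentiable_on A f n)"

definition vderiv :: "(real \<Rightarrow> complex) \<Rightarrow> real \<Rightarrow> complex" where
  "vderiv f = (\<lambda>x. vector_derivative f (at x))"


section \<open>Formal pseudo-differential operators\<close>

text \<open>
  \<open>P\<close> stands for the series \<open>\<Sum>i. P i \<partial>\<^sup>i\<close>. The coefficients are total functions, of which only the
  values on the domain under consideration matter.
\<close>

type_synonym pdo = "int \<Rightarrow> real \<Rightarrow> complex"

definition is_pdo_on :: "real set \<Rightarrow> pdo \<Rightarrow> bool" where
  "is_pdo_on A P \<longleftrightarrow> (\<exists>m. \<forall>i>m. P i = (\<lambda>_. 0)) \<and> (\<forall>i. smooth_on A (P i))"

definition pdo_eq_on :: "real set \<Rightarrow> pdo \<Rightarrow> pdo \<Rightarrow> bool" where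
  "pdo_eq_on A P Q \<longleftrightarrow> (\<forall>n. \<forall>x\<in>A. P n x = Q n x)"

definition pdo_fun :: "(real \<Rightarrow> complex) \<Rightarrow> pdo" where
  "pdo_fun f = (\<lambda>i. if i = 0 then f else (\<lambda>_. 0))"

definition pdo_D :: "int \<Rightarrow> pdo" where
  "pdo_D k = (\<lambda>i _. if i = k then 1 else 0)"

text \<open>
  The rule \<open>\<partial>\<^sup>i \<cdot> r = \<Sum>l. (i choose l) r\<^sup>(\<^sup>l\<^sup>) \<partial>\<^sup>i\<^sup>-\<^sup>l\<close> gives
  \<open>P i \<partial>\<^sup>i \<cdot> Q j \<partial>\<^sup>j = \<Sum>l. (i choose l) (P i) (Q j)\<^sup>(\<^sup>l\<^sup>) \<partial>\<^sup>i\<^sup>+\<^sup>j\<^sup>-\<^sup>l\<close>;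
  the coefficient of \<open>\<partial>\<^sup>n\<close> collects the terms with \<open>j = n - i + l\<close>. If \<open>P\<close> and \<open>Q\<close> are bounded
  above, only finitely many pairs \<open>(i, l)\<close> contribute to it.
\<close>

definition pdo_mult :: "pdo \<Rightarrow> pdo \<Rightarrow> pdo" where
  "pdo_mult P Q = (\<lambda>n x. Sum_any (\<lambda>(i::int, l::nat).
     P i x * (of_int i gchoose l) * (vderiv ^^ l) (Q (n - i + int l)) x))"

primrec pdo_power :: "pdo \<Rightarrow> nat \<Rightarrow> pdo" where
  "pdo_power P 0 = pdo_D 0"
| "pdo_power P (Suc k) = pdo_mult P (pdo_power P k)"

definition pdo_res :: "pdo \<Rightarrow> real \<Rightarrow> complex" where
  "pdo_res P = P (-1)"

text \<open>\<open>(\<Sum>i. P i \<partial>\<^sup>i)\<^sup>* = \<Sum>i. (-\<partial>)\<^sup>i \<cdot> P i\<close>\<close>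

definition pdo_adjoint :: "pdo \<Rightarrow> pdo" where
  "pdo_adjoint P = (\<lambda>n x. Sum_any (\<lambda>i::int.
     (-1) powi i * pdo_mult (pdo_D i) (pdo_fun (P i)) n x))"

definition pdo_inverse_on :: "real set \<Rightarrow> pdo \<Rightarrow> pdo \<Rightarrow> bool" where
  "pdo_inverse_on A P Q \<longleftrightarrow> is_pdo_on A Q \<and>
     pdo_eq_on A (pdo_mult P Q) (pdo_D 0) \<and> pdo_eq_on A (pdo_mult Q P) (pdo_D 0)"


section \<open>The operator, its dressing operator and its wave functions\<close>

definition lax_op :: "nat \<Rightarrow> (nat \<Rightarrow> real \<Rightarrow> complex) \<Rightarrow> pdo" where
  "lax_op N u = (\<lambda>i. if i = int N then (\<lambda>_. 1)
                      else if 0 \<le> i \<and> i \<le> int N - 2 then u (nat i)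
                      else (\<lambda>_. 0))"

definition dressing_operator ::
    "nat \<Rightarrow> (nat \<Rightarrow> real \<Rightarrow> complex) \<Rightarrow> real set \<Rightarrow> pdo \<Rightarrow> bool" where
  "dressing_operator N u A S \<longleftrightarrow>
     is_pdo_on A S \<and> (\<forall>i>0. S i = (\<lambda>_. 0)) \<and> (\<forall>x\<in>A. S 0 x = 1) \<and>
     (\<exists>S'. pdo_inverse_on A S S' \<and>
           pdo_eq_on A (lax_op N u) (pdo_mult S (pdo_mult (pdo_D (int N)) S')))"

text \<open>
  The factors in front of \<open>exp (x z)\<close> in \<open>\<Psi> = S exp (x z)\<close> and of \<open>exp (- x z)\<close> in
  \<open>\<Psi>\<^sup>* = T exp (- x z)\<close>, \<open>T = (S\<^sup>*)\<^sup>-\<^sup>1\<close>, as power series in \<open>1/z\<close>; both operators have order 0.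
  The sign in the second one comes from \<open>\<partial>\<^sup>j exp (- x z) = (- z)\<^sup>j exp (- x z)\<close>.
\<close>

definition wave_fps :: "pdo \<Rightarrow> real \<Rightarrow> complex fps" where
  "wave_fps S x = Abs_fps (\<lambda>k. S (- int k) x)"

definition adjoint_wave_fps :: "pdo \<Rightarrow> real \<Rightarrow> complex fps" where
  "adjoint_wave_fps T x = Abs_fps (\<lambda>k. (-1) ^ k * T (- int k) x)"

definition omega :: "pdo \<Rightarrow> pdo \<Rightarrow> nat \<Rightarrow> real \<Rightarrow> real \<Rightarrow> complex" where
  "omega S T n x y = fps_nth (wave_fps S x * adjoint_wave_fps T y) n"


section \<open>Formal heat expansions\<close>

text \<open>
  Put \<open>E\<^sub>j = t\<^bsup>-(j+1)/N\<^esup> A\<^sub>N\<^sup>(\<^sup>j\<^sup>)((x - y) / t\<^bsup>1/N\<^esup>)\<close>. A formal expansion \<open>F\<close> stands for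
  \<open>\<Sum>j\<le>N-2. \<Sum>k. F j k x y E\<^sub>j t\<^sup>k\<close>; after the elimination of the higher derivatives of the Airy-type
  function \<open>A\<^sub>N\<close> the \<open>E\<^sub>j t\<^sup>k\<close> with \<open>j \<le> N - 2\<close> are independent symbols, and \<open>A\<^sub>N\<close> is involved in the
  calculus only through its equation \<open>A\<^sub>N\<^sup>(\<^sup>N\<^sup>-\<^sup>1\<^sup>)(z) = - (\<kappa>/N) z A\<^sub>N(z)\<close>. The calculus rests on

    \<^item> \<open>\<partial>E\<^sub>j/\<partial>x = E\<^sub>j\<^sub>+\<^sub>1\<close>,
    \<^item> \<open>\<partial>E\<^sub>j/\<partial>t = - (j+1)/N t\<^sup>-\<^sup>1 E\<^sub>j - (x-y)/N t\<^sup>-\<^sup>1 E\<^sub>j\<^sub>+\<^sub>1\<close>,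
    \<^item> \<open>E\<^sub>N\<^sub>-\<^sub>1 = - (\<kappa>/N) (x-y) t\<^sup>-\<^sup>1 E\<^sub>0\<close>,

  which the next three lemmas verify for an arbitrary solution \<open>A 0\<close> of that equation with
  derivatives \<open>A j\<close>.
\<close>

type_synonym heat_exp = "nat \<Rightarrow> int \<Rightarrow> real \<Rightarrow> real \<Rightarrow> complex"

definition airy_term ::
    "nat \<Rightarrow> (nat \<Rightarrow> real \<Rightarrow> complex) \<Rightarrow> nat \<Rightarrow> real \<Rightarrow> real \<Rightarrow> real \<Rightarrow> complex" where
  "airy_term N A j x y t =
     (t powr (- (real j + 1) / real N)) *\<^sub>R A j ((x - y) * t powr (- 1 / real N))"

lemma airy_term_dx:
  assumes "\<And>z. (A j has_vector_derivative A (Suc j) z) (at z)" "t > 0"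
  shows "((\<lambda>x. airy_term N A j x y t) has_vector_derivative airy_term N A (Suc j) x y t) (at x)"
proof -
  let ?c = "t powr (- 1 / real N)"
  have "((\<lambda>x. (x - y) * ?c) has_vector_derivative ?c) (at x)"
    by (auto intro!: derivative_eq_intros simp flip: has_real_derivative_iff_has_vector_derivative)
  from vector_diff_chain_at[OF this assms(1)]
  have "((\<lambda>x. A j ((x - y) * ?c)) has_vector_derivative ?c *\<^sub>R A (Suc j) ((x - y) * ?c)) (at x)"
    by (simp add: o_def)
  then have "((\<lambda>x. (t powr (- (real j + 1) / real N)) *\<^sub>R A j ((x - y) * ?c)) has_vector_derivative
      (t powr (- (real j + 1) / real N)) *\<^sub>R ?c *\<^sub>R A (Suc j) ((x - y) * ?c)) (at x)"
    by (intro bounded_linear.has_vector_derivative[OF bounded_linear_scaleR_right])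
  moreover have "t powr (- (real j + 1) / real N) * ?c = t powr (- (real (Suc j) + 1) / real N)"
    by (simp add: add_divide_distrib diff_divide_distrib flip: powr_add)
  ultimately show ?thesis
    by (simp add: airy_term_def)
qed

lemma airy_term_dt:
  assumes A: "\<And>z. (A j has_vector_derivative A (Suc j) z) (at z)" and t: "t > 0" and N: "N > 0"
  shows "((\<lambda>t. airy_term N A j x y t) has_vector_derivative
     (- (real j + 1) / real N / t) *\<^sub>R airy_term N A j x y t
     - ((x - y) / real N / t) *\<^sub>R airy_term N A (Suc j) x y t) (at t)"
proof -
  let ?c = "\<lambda>t. t powr (- 1 / real N)" and ?b = "\<lambda>t. t powr (- (real j + 1) / real N)"
  have pw: "((\<lambda>t. t powr a) has_vector_derivative (a / t * t powr a)) (at t)" for a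
    using t by (auto intro!: derivative_eq_intros
      simp flip: has_real_derivative_iff_has_vector_derivative simp: powr_diff)
  have "((\<lambda>t. (x - y) * ?c t) has_vector_derivative (x - y) * (- 1 / real N / t * ?c t)) (at t)"
    by (intro bounded_linear.has_vector_derivative[OF bounded_linear_mult_right] pw)
  from vector_diff_chain_at[OF this A]
  have 1: "((\<lambda>t. A j ((x - y) * ?c t)) has_vector_derivative
      ((x - y) * (- 1 / real N / t * ?c t)) *\<^sub>R A (Suc j) ((x - y) * ?c t)) (at t)"
    by (simp add: o_def)
  have bc: "?b t * ?c t = t powr (- (real (Suc j) + 1) / real N)"
    by (simp add: add_divide_distrib diff_divide_distrib flip: powr_add)
  have coef: "?b t * ((x - y) * (- 1 / real N / t * ?c t)) =
      - ((x - y) / real N / t) * t powr (- (real (Suc j) + 1) / real N)"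
    unfolding bc[symmetric] by simp
  have pw': "((\<lambda>t. ?b t) has_field_derivative (- (real j + 1) / real N / t * ?b t)) (at t)"
    using pw[of "- (real j + 1) / real N"]
    by (simp add: has_real_derivative_iff_has_vector_derivative)
  have "((\<lambda>t. ?b t *\<^sub>R A j ((x - y) * ?c t)) has_vector_derivative
      ?b t *\<^sub>R (((x - y) * (- 1 / real N / t * ?c t)) *\<^sub>R A (Suc j) ((x - y) * ?c t))
      + (- (real j + 1) / real N / t * ?b t) *\<^sub>R A j ((x - y) * ?c t)) (at t)"
    by (rule has_vector_derivative_scaleR[OF pw' 1])
  then show ?thesis
    unfolding airy_term_def scaleR_scaleR coef by (simp add: algebra_simps)
qed

lemma airy_term_top:
  assumes "\<And>z. A (N - 1) z = - (\<kappa> / real N * z) *\<^sub>R A 0 z" "t > 0" "N > 0"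
  shows "airy_term N A (N - 1) x y t = - (\<kappa> / real N * (x - y) / t) *\<^sub>R airy_term N A 0 x y t"
proof -
  have "t powr (- (real (N - 1) + 1) / real N) = 1 / t"
    using assms(2,3) by (simp add: of_nat_diff powr_minus_divide)
  then show ?thesis
    unfolding airy_term_def assms(1) by (simp add: mult_ac)
qed

text \<open>The effect on an expansion of replacing every \<open>E\<^sub>j\<close> by \<open>E\<^sub>j\<^sub>+\<^sub>1\<close>, with \<open>E\<^sub>N\<^sub>-\<^sub>1\<close> eliminated.\<close>

definition hexp_raise :: "nat \<Rightarrow> real \<Rightarrow> heat_exp \<Rightarrow> heat_exp" where
  "hexp_raise N \<kappa> F = (\<lambda>j k x y.
     if j = 0 then - of_real (\<kappa> / real N * (x - y)) * F (N - 2) (k + 1) x y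
     else F (j - 1) k x y)"

definition hexp_dx :: "nat \<Rightarrow> real \<Rightarrow> heat_exp \<Rightarrow> heat_exp" where
  "hexp_dx N \<kappa> F = (\<lambda>j k x y. vderiv (\<lambda>s. F j k s y) x + hexp_raise N \<kappa> F j k x y)"

definition hexp_dt :: "nat \<Rightarrow> real \<Rightarrow> heat_exp \<Rightarrow> heat_exp" where
  "hexp_dt N \<kappa> F = (\<lambda>j k x y.
     of_real (of_int (k + 1) - (real j + 1) / real N) * F j (k + 1) x y
     - of_real ((x - y) / real N) * hexp_raise N \<kappa> F j (k + 1) x y)"

definition hexp_lax :: "nat \<Rightarrow> real \<Rightarrow> (nat \<Rightarrow> real \<Rightarrow> complex) \<Rightarrow> heat_exp \<Rightarrow> heat_exp" where
  "hexp_lax N \<kappa> u F = (\<lambda>j k x y.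
     \<Sum>i\<le>N. lax_op N u (int i) x * (hexp_dx N \<kappa> ^^ i) F j k x y)"

definition heat_kernel :: "(nat \<Rightarrow> nat \<Rightarrow> real \<Rightarrow> real \<Rightarrow> complex) \<Rightarrow> heat_exp" where
  "heat_kernel H = (\<lambda>j k x y.
     if k \<ge> 1 then H (nat k) j x y else if k = 0 \<and> j = 0 then 1 else 0)"

text \<open>
  A neighbourhood of the diagonal whose sections \<open>y = const\<close> are intervals: the initial condition
  for the equations in \<open>x\<close> is smoothness at \<open>x = y\<close>, so they determine the coefficients only as far
  as \<open>x\<close> is connected with \<open>y\<close> within the section.
\<close>

definition diagonal_nbhd :: "real set \<Rightarrow> (real \<times> real) set \<Rightarrow> bool" where
  "diagonal_nbhd A U \<longleftrightarrow> open U \<and> (\<forall>x\<in>A. (x, x) \<in> U) \<and> U \<subseteq> A \<times> A \<and>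
     (\<forall>y. is_interval {x. (x, y) \<in> U})"

text \<open>\<open>H k j\<close> is \<open>H\<^sub>k\<^sup>j\<close>; the values for \<open>k = 0\<close> or \<open>j > N - 2\<close> are not used.\<close>

definition hadamard_coefficients ::
    "nat \<Rightarrow> real \<Rightarrow> (nat \<Rightarrow> real \<Rightarrow> complex) \<Rightarrow> (real \<times> real) set \<Rightarrow>
     (nat \<Rightarrow> nat \<Rightarrow> real \<Rightarrow> real \<Rightarrow> complex) \<Rightarrow> bool" where
  "hadamard_coefficients N \<kappa> u U H \<longleftrightarrow>
     (\<forall>k\<ge>1. \<forall>j\<le>N - 2. smooth_on U (\<lambda>(x, y). H k j x y)) \<and>
     (\<forall>j\<le>N - 2. \<forall>k. \<forall>(x, y)\<in>U.
        hexp_dt N \<kappa> (heat_kernel H) j k x y =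
        of_real \<kappa> * hexp_lax N \<kappa> u (heat_kernel H) j k x y)"

end

theory Submission
  imports Defs
begin

text \<open>
  Formally the heat kernel is \<open>\<integral> \<Psi>(x, z) \<Psi>\<^sup>*(y, z) exp (\<kappa> t z\<^sup>N) dz / (2\<pi>i) = \<Sum>n. \<omega>\<^sub>n(x, y) E\<^sub>-\<^sub>n\<close> with
  \<open>E\<^sub>m = \<integral> z\<^sup>m exp ((x - y) z + \<kappa> t z\<^sup>N) dz / (2\<pi>i)\<close>. Iterating \<open>(x - y) E\<^sub>0 = - \<kappa> N t \<partial>\<^sup>N\<^sup>-\<^sup>1 E\<^sub>0\<close> expands
  \<open>E\<^sub>-\<^sub>n = \<partial>\<^sup>-\<^sup>n E\<^sub>0\<close> in the symbols \<open>E\<^sub>j t\<^sup>k\<close> with the residues of the theorem as coefficients, and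
  \<open>\<partial>E\<^sub>m = E\<^sub>m\<^sub>+\<^sub>1\<close>, \<open>\<partial>E\<^sub>m/\<partial>t = \<kappa> E\<^sub>m\<^sub>+\<^sub>N\<close> together with \<open>L \<Psi> = z\<^sup>N \<Psi>\<close> show that \<open>\<Sum>n. \<omega>\<^sub>n E\<^sub>-\<^sub>n\<close> solves
  the heat equation for \<open>x \<noteq> y\<close>. The first coefficient \<open>d\<close> in which it could differ from the heat
  kernel satisfies \<open>k d + (x - y) \<partial>d/\<partial>x = 0\<close>, so \<open>(x - y)\<^sup>k d\<close> is constant on each side of the
  diagonal. As the coefficients of the heat kernel are smooth, this constant is, up to sign, the
  coefficient of \<open>(x - y)\<^sup>-\<^sup>k\<close> in the asymptotic expansion of the other solution at the diagonal,
  which vanishes by the bilinear identities \<open>res\<^sub>z z\<^sup>N\<^sup>r (\<partial>\<^sup>q \<Psi>) \<Psi>\<^sup>* = 0\<close> for \<open>x = y\<close>.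
\<close>

text \<open>The transport equation leaves one free constant on each side of the diagonal for every
  coefficient, so only the behaviour at \<open>x = y\<close> singles out the heat kernel. The
  regularity of the candidate there is never shown directly; it follows from its equality with the
  heat kernel. The obstacle is that the bilinear identities see only the powers
  \<open>z\<^sup>N\<^sup>r\<close>, whereas a coefficient involves every \<omega>_n up to its index.
  The bridge is arithmetic: on the range where it does not vanish for reasons of order, the residue
  number of \<omega>_n times (n - 1)! is a combination of the falling factorials of n - 1 of orders
  0, N, 2N, ..., and each of these turns the Taylor coefficients of the \<omega>_n at the diagonal
  into one bilinear identity. The residue numbers are handled through \<open>\<partial>\<^sup>m x =
  x \<partial>\<^sup>m + m \<partial>\<^sup>m\<^sup>-\<^sup>1\<close>, a recursion that determines
  them from the values at \<open>k = 0\<close> and the vanishing for very negative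
  \<open>m\<close>.\<close>

unbundle no vec_syntax and fps_syntax

section \<open>Smooth functions of one variable and their jets\<close>

definition smooth1 :: "real set \<Rightarrow> (real \<Rightarrow> complex) \<Rightarrow> bool" where
  "smooth1 A f \<longleftrightarrow> (\<forall>n. \<forall>x\<in>A. ((vderiv ^^ n) f) differentiable (at x))"

lemma smooth1D:
  assumes "smooth1 A f" "x \<in> A"
  shows "((vderiv ^^ n) f has_vector_derivative (vderiv ^^ Suc n) f x) (at x)"
  using assms by (simp add: smooth1_def vderiv_def vector_derivative_works)

lemma smooth1D0:
  assumes "smooth1 A f" "x \<in> A"
  shows "(f has_vector_derivative vderiv f x) (at x)"
  using smooth1D[OF assms, of 0] by simp

text \<open>Checking a whole tower of candidate derivatives at once proves smoothness and computes
  every derivative together. Agreement on the open set suffices because derivatives are local;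
  outside it the total function \<open>f\<close> is arbitrary.\<close>

lemma smooth1_family:
  assumes A: "open A" and F: "\<And>n x. x \<in> A \<Longrightarrow> (F n has_vector_derivative F (Suc n) x) (at x)"
    and f: "\<And>x. x \<in> A \<Longrightarrow> f x = F 0 x"
  shows "smooth1 A f" and "\<And>n x. x \<in> A \<Longrightarrow> (vderiv ^^ n) f x = F n x"
proof -
  have *: "\<forall>x\<in>A. (vderiv ^^ n) f x = F n x" for n
  proof (induction n)
    case 0
    then show ?case using f by simp
  next
    case (Suc n)
    show ?case
    proof
      fix x assume x: "x \<in> A"
      have "((vderiv ^^ n) f has_vector_derivative F (Suc n) x) (at x)"
        by (rule has_vector_derivative_transform_within_open[OF F[OF x] A x]) (use Suc in auto)
      then show "(vderiv ^^ Suc n) f x = F (Suc n) x"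
        by (simp add: vderiv_def vector_derivative_at)
    qed
  qed
  then show "\<And>n x. x \<in> A \<Longrightarrow> (vderiv ^^ n) f x = F n x" by blast
  show "smooth1 A f"
    unfolding smooth1_def
  proof (intro allI ballI)
    fix n x assume x: "x \<in> A"
    have "((vderiv ^^ n) f has_vector_derivative F (Suc n) x) (at x)"
      by (rule has_vector_derivative_transform_within_open[OF F[OF x] A x]) (use * in auto)
    then show "(vderiv ^^ n) f differentiable at x"
      by (auto simp: has_vector_derivative_def intro: differentiableI)
  qed
qed

lemma smooth1_cong:
  assumes "open A" "smooth1 A g" "\<And>x. x \<in> A \<Longrightarrow> f x = g x"
  shows "smooth1 A f" and "\<And>n x. x \<in> A \<Longrightarrow> (vderiv ^^ n) f x = (vderiv ^^ n) g x"
  using smooth1_family[of A "\<lambda>n. (vderiv ^^ n) g" f] smooth1D[OF assms(2)] assms(1,3) by auto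

lemma smooth1_mono: "smooth1 A f \<Longrightarrow> B \<subseteq> A \<Longrightarrow> smooth1 B f"
  by (auto simp: smooth1_def)

lemma smooth1_vderiv: "smooth1 A f \<Longrightarrow> smooth1 A ((vderiv ^^ n) f)"
  by (simp add: smooth1_def flip: funpow_add[THEN fun_cong, unfolded o_def])

lemma smooth1_const: "open A \<Longrightarrow> smooth1 A (\<lambda>_. c)"
  and vderiv_const: "(vderiv ^^ n) (\<lambda>_. c) = (if n = 0 then (\<lambda>_. c) else (\<lambda>_. 0))"
proof -
  have d: "((\<lambda>x::real. if n = 0 then c else 0) has_vector_derivative 0) (at x)" for n :: nat and x
    by (auto intro: derivative_eq_intros)
  show "open A \<Longrightarrow> smooth1 A (\<lambda>_. c)"
    by (rule smooth1_family(1)[where F = "\<lambda>n _. if n = 0 then c else 0"]) (use d in auto)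
  have "(vderiv ^^ n) (\<lambda>_. c) x = (if n = 0 then c else 0)" for x
    by (rule smooth1_family(2)[where F = "\<lambda>n _. if n = 0 then c else 0" and A = UNIV]) (use d in auto)
  then show "(vderiv ^^ n) (\<lambda>_. c) = (if n = 0 then (\<lambda>_. c) else (\<lambda>_. 0))" by auto
qed

text \<open>The Taylor series at \<open>x\<close>. Dividing by factorials turns
  \<open>vderiv\<close> into \<open>fps_deriv\<close> and the Leibniz rule into the product of power
  series.\<close>

definition jet :: "real \<Rightarrow> (real \<Rightarrow> complex) \<Rightarrow> complex fps" where
  "jet x f = Abs_fps (\<lambda>n. (vderiv ^^ n) f x / fact n)"

lemma jet_nth: "jet x f $ n = (vderiv ^^ n) f x / fact n"
  by (simp add: jet_def)

lemma jet_nth_0 [simp]: "jet x f $ 0 = f x"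
  by (simp add: jet_def)

lemma jet_vderiv: "jet x (vderiv f) = fps_deriv (jet x f)"
  by (rule fps_ext) (simp add: jet_nth funpow_swap1 divide_simps del: of_nat_Suc)

lemma jet_vderiv_iter: "jet x ((vderiv ^^ n) f) = (fps_deriv ^^ n) (jet x f)"
  by (induction n) (simp_all add: jet_vderiv)

lemma jet_const: "jet x (\<lambda>_. c) = fps_const c"
  by (rule fps_ext) (simp add: jet_nth vderiv_const)

lemma jet_cong:
  assumes "open A" "smooth1 A g" "\<And>x. x \<in> A \<Longrightarrow> f x = g x" "x \<in> A"
  shows "jet x f = jet x g"
  by (rule fps_ext) (simp add: jet_nth smooth1_cong(2)[OF assms])

lemma has_vector_derivative_jet_nth:
  assumes "smooth1 A f" "x \<in> A"
  shows "((\<lambda>x. jet x f $ n) has_vector_derivative fps_deriv (jet x f) $ n) (at x)"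
proof -
  have "((\<lambda>x. (vderiv ^^ n) f x / fact n) has_vector_derivative (vderiv ^^ Suc n) f x / fact n) (at x)"
    by (rule has_vector_derivative_divide[OF smooth1D[OF assms]])
  moreover have "(vderiv ^^ Suc n) f x / fact n = fps_deriv (jet x f) $ n"
    by (simp add: jet_nth divide_simps del: of_nat_Suc)
  ultimately show ?thesis by (simp add: jet_nth)
qed

text \<open>The hypothesis on \<open>J\<close> says that moving the base point acts as the formal
  derivative, which characterizes families of Taylor series. Jets of sums and products thus reduce
  to rules for \<open>fps_deriv\<close>.\<close>

lemma smooth1_jet_family:
  assumes A: "open A"
    and J: "\<And>n x. x \<in> A \<Longrightarrow> ((\<lambda>x. J x $ n) has_vector_derivative fps_deriv (J x) $ n) (at x)"
    and f: "\<And>x. x \<in> A \<Longrightarrow> f x = J x $ 0"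
  shows "smooth1 A f" and "\<And>x. x \<in> A \<Longrightarrow> jet x f = J x"
proof -
  have d: "((\<lambda>x. fact n * J x $ n) has_vector_derivative fact (Suc n) * J x $ Suc n) (at x)"
    if "x \<in> A" for n x
    using has_vector_derivative_mult_right[OF J[OF that, of n], of "fact n"]
    by (simp add: algebra_simps)
  show "smooth1 A f"
    by (rule smooth1_family(1)[where F = "\<lambda>n x. fact n * J x $ n", OF A]) (use f d in auto)
  have "(vderiv ^^ n) f x = fact n * J x $ n" if "x \<in> A" for n x
    by (rule smooth1_family(2)[where F = "\<lambda>n x. fact n * J x $ n", OF A])
      (use f d that in auto)
  then show "jet x f = J x" if "x \<in> A" for x
    using that by (intro fps_ext) (simp add: jet_nth)
qed

lemma
  assumes "open A" "smooth1 A f" "smooth1 A g"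
  shows smooth1_add: "smooth1 A (\<lambda>x. f x + g x)"
    and jet_add: "x \<in> A \<Longrightarrow> jet x (\<lambda>x. f x + g x) = jet x f + jet x g"
proof -
  have d: "((\<lambda>x. (jet x f + jet x g) $ n) has_vector_derivative fps_deriv (jet x f + jet x g) $ n) (at x)"
    if "x \<in> A" for n x
    using has_vector_derivative_add[OF has_vector_derivative_jet_nth has_vector_derivative_jet_nth,
      OF assms(2) that assms(3) that]
    by (simp add: algebra_simps)
  show "smooth1 A (\<lambda>x. f x + g x)"
    by (rule smooth1_jet_family(1)[OF assms(1) d]) auto
  show "x \<in> A \<Longrightarrow> jet x (\<lambda>x. f x + g x) = jet x f + jet x g"
    by (rule smooth1_jet_family(2)[OF assms(1) d]) auto
qed

lemma
  assumes A: "open A" and f: "smooth1 A f" and g: "smooth1 A g"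
  shows smooth1_mult: "smooth1 A (\<lambda>x. f x * g x)"
    and jet_mult: "x \<in> A \<Longrightarrow> jet x (\<lambda>x. f x * g x) = jet x f * jet x g"
proof -
  have d: "((\<lambda>x. (jet x f * jet x g) $ n) has_vector_derivative fps_deriv (jet x f * jet x g) $ n) (at x)"
    if x: "x \<in> A" for n x
  proof -
    have "((\<lambda>x. \<Sum>i=0..n. jet x f $ i * jet x g $ (n - i)) has_vector_derivative
      (\<Sum>i=0..n. jet x f $ i * fps_deriv (jet x g) $ (n - i) + fps_deriv (jet x f) $ i * jet x g $ (n - i))) (at x)"
      by (intro has_vector_derivative_sum has_vector_derivative_mult
        has_vector_derivative_jet_nth[OF f x] has_vector_derivative_jet_nth[OF g x])
    then show ?thesis
      unfolding fps_deriv_mult by (simp add: fps_mult_nth sum.distrib)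
  qed
  show "smooth1 A (\<lambda>x. f x * g x)"
    by (rule smooth1_jet_family(1)[OF A d]) auto
  show "x \<in> A \<Longrightarrow> jet x (\<lambda>x. f x * g x) = jet x f * jet x g"
    by (rule smooth1_jet_family(2)[OF A d]) auto
qed

lemma
  assumes A: "open A" and f: "smooth1 A f"
  shows smooth1_cmult: "smooth1 A (\<lambda>x. c * f x)"
    and jet_cmult: "x \<in> A \<Longrightarrow> jet x (\<lambda>x. c * f x) = fps_const c * jet x f"
  using smooth1_mult[OF A smooth1_const[OF A] f, of c] jet_mult[OF A smooth1_const[OF A] f, of x c]
  by (simp_all add: jet_const)

lemma
  assumes A: "open A" and f: "\<And>i. i \<in> I \<Longrightarrow> smooth1 A (f i)"
  shows smooth1_sum: "smooth1 A (\<lambda>x. \<Sum>i\<in>I. f i x)"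
    and jet_sum: "x \<in> A \<Longrightarrow> jet x (\<lambda>x. \<Sum>i\<in>I. f i x) = (\<Sum>i\<in>I. jet x (f i))"
proof -
  have "smooth1 A (\<lambda>x. \<Sum>i\<in>I. f i x) \<and> (\<forall>x\<in>A. jet x (\<lambda>x. \<Sum>i\<in>I. f i x) = (\<Sum>i\<in>I. jet x (f i)))"
    using f
  proof (induction I rule: infinite_finite_induct)
    case (insert i I)
    then show ?case
      using smooth1_add[OF A, of "f i" "\<lambda>x. \<Sum>i\<in>I. f i x"]
        jet_add[OF A, of "f i" "\<lambda>x. \<Sum>i\<in>I. f i x"] by simp
  qed (simp_all add: smooth1_const[OF A] jet_const)
  then show "smooth1 A (\<lambda>x. \<Sum>i\<in>I. f i x)"
    "x \<in> A \<Longrightarrow> jet x (\<lambda>x. \<Sum>i\<in>I. f i x) = (\<Sum>i\<in>I. jet x (f i))" by auto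
qed

lemma smooth1_diff:
  assumes "open A" "smooth1 A f" "smooth1 A g"
  shows "smooth1 A (\<lambda>x. f x - g x)"
  using smooth1_add[OF assms(1,2) smooth1_cmult[OF assms(1,3), of "-1"]] by simp

lemma smooth1_shift: "open A \<Longrightarrow> smooth1 A (\<lambda>x. of_real (x - y))"
  and jet_shift: "jet x (\<lambda>x. of_real (x - y)) = fps_const (of_real (x - y)) + fps_X"
proof -
  have d: "((\<lambda>x. (fps_const (of_real (x - y)) + fps_X) $ n) has_vector_derivative
    fps_deriv (fps_const (of_real (x - y)) + fps_X :: complex fps) $ n) (at x)" for n x
    by (cases n)
      (auto intro!: derivative_eq_intros simp: has_vector_derivative_of_real fps_X_def
       simp flip: has_real_derivative_iff_has_vector_derivative)
  show "open A \<Longrightarrow> smooth1 A (\<lambda>x. of_real (x - y))"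
    by (rule smooth1_jet_family(1)[OF _ d]) auto
  show "jet x (\<lambda>x. of_real (x - y)) = fps_const (of_real (x - y)) + fps_X"
    by (rule smooth1_jet_family(2)[OF open_UNIV d]) auto
qed

section \<open>Powers of x - y off the diagonal\<close>

lemma has_vector_derivative_shift_powi:
  assumes "x \<noteq> y"
  shows "((\<lambda>x. of_real (x - y) powi e) has_vector_derivative
    of_int e * (of_real (x - y) :: complex) powi (e - 1)) (at x)"
proof -
  have 1: "((\<lambda>x. of_real (x - y) :: complex) has_vector_derivative 1) (at x)"
    by (auto intro!: derivative_eq_intros has_vector_derivative_of_real[where D=1, simplified]
       simp flip: has_real_derivative_iff_has_vector_derivative)
  have 2: "((\<lambda>z::complex. z powi e) has_field_derivative of_int e * (of_real (x - y)) powi (e - 1))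
      (at (of_real (x - y)))"
    using assms by (auto intro!: derivative_eq_intros)
  show ?thesis
    using field_vector_diff_chain_at[OF 1 2] by (simp add: o_def)
qed

lemma smooth1_shift_powi:
  assumes "open A" "y \<notin> A"
  shows "smooth1 A (\<lambda>x. of_real (x - y) powi e)"
proof -
  define F where "F = (\<lambda>n x. (\<Prod>i<n. of_int (e - int i)) * (of_real (x - y) powi (e - int n) :: complex))"
  have "(F n has_vector_derivative F (Suc n) x) (at x)" if "x \<in> A" for n x
    unfolding F_def
    using has_vector_derivative_mult_right[OF has_vector_derivative_shift_powi[of x y "e - int n"],
      of "\<Prod>i<n. of_int (e - int i)"] that assms
    by (auto simp: algebra_simps)
  then show ?thesis
    by (rule smooth1_family(1)[OF assms(1)]) (auto simp: F_def)
qed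

text \<open>Along a line of constant velocity \<open>v\<close> the derivative of \<open>F\<close> is
  a directional derivative, again a function of the same kind with one order less; a varying
  velocity would add chain rule terms. It serves for the identity and for
  \<open>x \<mapsto> (x, y)\<close>.\<close>

lemma higher_differentiable_section:
  fixes F :: "'a::real_normed_vector \<Rightarrow> complex" and \<phi> :: "real \<Rightarrow> 'a"
  assumes \<phi>: "\<And>x. (\<phi> has_vector_derivative v) (at x)"
    and U: "open U" and F: "higher_differentiable_on U F (Suc n)" and x: "\<phi> x \<in> U"
  shows "(vderiv ^^ n) (\<lambda>x. F (\<phi> x)) differentiable at x"
proof -
  have "open (\<phi> -` U)"
    using \<phi> by (intro open_vimage U continuous_at_imp_continuous_on)
      (auto intro: has_vector_derivative_continuous)
  then show ?thesis using F x
  proof (induction n arbitrary: F x)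
    case (Suc n)
    define g where "g = (\<lambda>p. frechet_derivative F (at p) v)"
    have g: "higher_differentiable_on U g (Suc n)"
      using Suc.prems(2) unfolding g_def by (subst (asm) higher_differentiable_on.simps(2)) blast
    have eq: "vderiv (\<lambda>x. F (\<phi> x)) x = g (\<phi> x)" if "\<phi> x \<in> U" for x
    proof -
      have "(F has_derivative frechet_derivative F (at (\<phi> x))) (at (\<phi> x))"
        using Suc.prems(2) that by (simp add: frechet_derivative_works)
      from vector_derivative_diff_chain_within[OF \<phi>[of x], of F "frechet_derivative F (at (\<phi> x))"]
      have "((\<lambda>x. F (\<phi> x)) has_vector_derivative g (\<phi> x)) (at x)"
        using has_derivative_at_withinI[OF \<open>(F has_derivative _) _\<close>] by (simp add: o_def g_def)
      then show ?thesis by (simp add: vderiv_def vector_derivative_at)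
    qed
    \<comment> \<open>The two functions agree only on the preimage of \<open>U\<close>, so the
      equality of iterated derivatives is carried along on that open set.\<close>
    have local: "\<forall>x\<in>\<phi> -` U. (vderiv ^^ m) (vderiv (\<lambda>x. F (\<phi> x))) x = (vderiv ^^ m) (\<lambda>x. g (\<phi> x)) x" for m
    proof (induction m)
      case (Suc m)
      show ?case
      proof
        fix x assume x: "x \<in> \<phi> -` U"
        have "\<forall>\<^sub>F z in nhds x. (vderiv ^^ m) (vderiv (\<lambda>x. F (\<phi> x))) z = (vderiv ^^ m) (\<lambda>x. g (\<phi> x)) z"
          using eventually_nhds_in_open[OF \<open>open (\<phi> -` U)\<close> x] Suc by (auto elim: eventually_mono)
        then show "(vderiv ^^ Suc m) (vderiv (\<lambda>x. F (\<phi> x))) x = (vderiv ^^ Suc m) (\<lambda>x. g (\<phi> x)) x"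
          by (simp add: vderiv_def) (rule vector_derivative_cong_eq, simp_all)
      qed
    qed (use eq in auto)
    have "(vderiv ^^ n) (\<lambda>x. g (\<phi> x)) differentiable at x"
      by (rule Suc.IH[OF Suc.prems(1) g Suc.prems(3)])
    then obtain D where "((vderiv ^^ n) (\<lambda>x. g (\<phi> x)) has_derivative D) (at x)"
      by (auto simp: differentiable_def)
    then have "((vderiv ^^ n) (vderiv (\<lambda>x. F (\<phi> x))) has_derivative D) (at x)"
      by (rule has_derivative_transform_within_open[OF _ Suc.prems(1)]) (use local Suc.prems(3) in auto)
    then show ?case
      unfolding funpow_Suc_right o_def by (auto simp: differentiable_def)
  next
    case 0
    then have "F differentiable at (\<phi> x)" by simp
    moreover have "\<phi> differentiable at x"
      using \<phi>[of x] by (auto simp: has_vector_derivative_def intro: differentiableI)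
    ultimately show ?case
      using differentiable_chain_at[of \<phi> x F] by (simp add: o_def)
  qed
qed

lemma smooth1_if_smooth_on: "open A \<Longrightarrow> smooth_on A f \<Longrightarrow> smooth1 A f"
  unfolding smooth1_def smooth_on_def
  by (intro allI ballI higher_differentiable_section[of "\<lambda>x. x" 1 A f])
    (auto simp flip: has_real_derivative_iff_has_vector_derivative
      simp del: higher_differentiable_on.simps)

lemma smooth1_section:
  assumes "open U" "smooth_on U (\<lambda>(x, y). f x y)"
  shows "smooth1 {x. (x, y) \<in> U} (\<lambda>x. f x y)"
proof -
  have "((\<lambda>x. (x, y)) has_vector_derivative (1, 0)) (at x)" for x
    by (intro has_vector_derivative_Pair) (auto simp flip: has_real_derivative_iff_has_vector_derivative)
  from higher_differentiable_section[OF this assms(1), of "\<lambda>(x, y). f x y"] assms(2)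
  show ?thesis unfolding smooth1_def smooth_on_def by (simp del: higher_differentiable_on.simps)
qed

section \<open>Pseudo-differential operators over power series\<close>

text \<open>Taking jets of the coefficients at a point turns operators with smooth coefficients into
  operators over \<open>\<complex>[[X]]\<close>, where identities hold without smoothness assumptions.\<close>

type_synonym fpdo = "int \<Rightarrow> complex fps"

definition ord_le :: "int \<Rightarrow> fpdo \<Rightarrow> bool" where
  "ord_le a A \<longleftrightarrow> (\<forall>i>a. A i = 0)"

definition fpdo_fun :: "complex fps \<Rightarrow> fpdo" where
  "fpdo_fun f = (\<lambda>i. if i = 0 then f else 0)"

definition fpdo_D :: "int \<Rightarrow> fpdo" where
  "fpdo_D k = (\<lambda>i. if i = k then 1 else 0)"

abbreviation bin :: "int \<Rightarrow> nat \<Rightarrow> complex fps" where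
  "bin i l \<equiv> fps_const (of_int i gchoose l)"

text \<open>The composition \<open>\<partial>\<^sup>i \<cdot> B\<close>.\<close>

definition Dpow :: "int \<Rightarrow> fpdo \<Rightarrow> fpdo" where
  "Dpow i B = (\<lambda>n. Sum_any (\<lambda>l. bin i l * (fps_deriv ^^ l) (B (n - i + int l))))"

text \<open>Left multiplication by \<partial>, which needs no sum. Identities for all integer powers
  are reduced to this single step.\<close>

definition Dleft :: "fpdo \<Rightarrow> fpdo" where
  "Dleft A = (\<lambda>n. fps_deriv (A n) + A (n - 1))"

definition fmul :: "fpdo \<Rightarrow> fpdo \<Rightarrow> fpdo" where
  "fmul A B = (\<lambda>n. Sum_any (\<lambda>i. A i * Dpow i B n))"

lemma fps_deriv_funpow_0 [simp]: "(fps_deriv ^^ l) (0 :: complex fps) = 0"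
  by (induction l) auto

lemma ord_leD: "ord_le a A \<Longrightarrow> i > a \<Longrightarrow> A i = 0"
  by (auto simp: ord_le_def)

lemma ord_le_mono: "ord_le a A \<Longrightarrow> a \<le> b \<Longrightarrow> ord_le b A"
  by (auto simp: ord_le_def)

lemma ord_le_fpdo_D: "ord_le k (fpdo_D k)"
  by (simp add: ord_le_def fpdo_D_def)

lemma ord_le_fpdo_fun: "ord_le 0 (fpdo_fun f)"
  by (simp add: ord_le_def fpdo_fun_def)

lemma ord_le_Dleft: "ord_le a A \<Longrightarrow> ord_le (a + 1) (Dleft A)"
  by (auto simp: ord_le_def Dleft_def)

lemma Dpow_eq:
  assumes "ord_le b B" "b - n + i \<le> int L"
  shows "Dpow i B n = (\<Sum>l\<le>L. bin i l * (fps_deriv ^^ l) (B (n - i + int l)))"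
  unfolding Dpow_def
proof (rule Sum_any.expand_superset)
  have "B (n - i + int l) = 0" if "\<not> l \<le> L" for l
    using assms(2) that by (intro ord_leD[OF assms(1)]) linarith
  then show "{l. bin i l * (fps_deriv ^^ l) (B (n - i + int l)) \<noteq> 0} \<subseteq> {..L}"
    by force
qed auto

lemma ord_le_Dpow: "ord_le b B \<Longrightarrow> ord_le (b + i) (Dpow i B)"
  unfolding ord_le_def Dpow_def by (auto intro!: Sum_any.neutral)

lemma Dpow_0: "ord_le b B \<Longrightarrow> Dpow 0 B = B"
proof
  fix n assume "ord_le b B"
  then have "Dpow 0 B n = (\<Sum>l\<le>nat (b - n). bin 0 l * (fps_deriv ^^ l) (B (n + int l)))"
    by (subst Dpow_eq[of b _ _ _ "nat (b - n)"]) auto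
  also have "\<dots> = (\<Sum>l\<le>nat (b - n). if l = 0 then B n else 0)"
    by (intro sum.cong) (auto simp: gbinomial_0_left)
  finally show "Dpow 0 B n = B n" by simp
qed

text \<open>Pascal's rule for generalized binomial coefficients, valid for every integer
  \<open>i\<close>: differentiating a coefficient raises \<open>l\<close>, shifting the index does
  not.\<close>

lemma Dleft_Dpow:
  assumes "ord_le b B"
  shows "Dleft (Dpow i B) = Dpow (i + 1) B"
proof
  fix n
  obtain L where L: "b - n + i + 1 \<le> int L" using nat_le_iff by blast
  let ?t = "\<lambda>l. (fps_deriv ^^ l) (B (n - 1 - i + int l))"
  have "Dpow (i + 1) B n = (\<Sum>l\<le>Suc L. bin (i + 1) l * ?t l)"
    using L by (subst Dpow_eq[OF assms, of _ _ "Suc L"]) (auto simp: algebra_simps)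
  also have "\<dots> = ?t 0 + (\<Sum>l\<le>L. bin (i + 1) (Suc l) * ?t (Suc l))"
    by (subst sum.atMost_Suc_shift) simp
  also have "(\<Sum>l\<le>L. bin (i + 1) (Suc l) * ?t (Suc l)) =
      (\<Sum>l\<le>L. bin i l * ?t (Suc l)) + (\<Sum>l\<le>L. bin i (Suc l) * ?t (Suc l))"
    by (simp add: sum.distrib[symmetric] gbinomial_Suc_Suc distrib_right
        flip: fps_const_add del: funpow.simps)
  also have "?t 0 + ((\<Sum>l\<le>L. bin i l * ?t (Suc l)) + (\<Sum>l\<le>L. bin i (Suc l) * ?t (Suc l))) =
      (\<Sum>l\<le>L. bin i l * ?t (Suc l)) + (\<Sum>l\<le>Suc L. bin i l * ?t l)"
    by (simp add: sum.atMost_Suc_shift del: sum.atMost_Suc funpow.simps)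
  also have "(\<Sum>l\<le>Suc L. bin i l * ?t l) = Dpow i B (n - 1)"
    using L by (subst Dpow_eq[OF assms, of _ _ "Suc L"]) auto
  also have "(\<Sum>l\<le>L. bin i l * ?t (Suc l)) = fps_deriv (Dpow i B n)"
    using L by (subst Dpow_eq[OF assms, of _ _ L]) (auto simp: fps_deriv_sum algebra_simps)
  finally show "Dleft (Dpow i B) n = Dpow (i + 1) B n" by (simp add: Dleft_def)
qed

text \<open>Since \<open>\<partial>\<close> is injective, an identity for \<open>\<partial>\<^sup>-\<^sup>1\<close> follows from the one for \<open>\<partial>\<close>.\<close>

lemma Dleft_inj:
  assumes A: "ord_le a A" and B: "ord_le b B" and eq: "Dleft A = Dleft B"
  shows "A = B"
proof -
  have **: "A i = B i" if "max a b - int n < i" for n i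
    using that
  proof (induction n arbitrary: i)
    case 0
    then show ?case using ord_leD[OF A, of i] ord_leD[OF B, of i] by auto
  next
    case (Suc n)
    have "A (i + 1) = B (i + 1)" using Suc by auto
    with fun_cong[OF eq, of "i + 1"] show ?case by (simp add: Dleft_def)
  qed
  have "A i = B i" for i
    by (rule **[of "nat (max a b - i + 1)"]) linarith
  then show ?thesis by blast
qed

text \<open>In the applications the step upwards applies \<partial> and the step downwards cancels
  it by \<open>Dleft_inj\<close>, so one equivalence covers both.\<close>

lemma int_shift_induct:
  fixes i :: int
  assumes "P 0" "\<And>i. P i \<longleftrightarrow> P (i + 1)"
  shows "P i"
proof (induction i rule: int_induct[where k = 0])
  case (step2 i)
  then show ?case using assms(2)[of "i - 1"] by simp
qed (use assms in auto)

lemma Dpow_Dpow: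
  assumes "ord_le b B"
  shows "Dpow i (Dpow j B) = Dpow (i + j) B"
proof (induction i rule: int_shift_induct)
  case 1
  then show ?case using Dpow_0[OF ord_le_Dpow[OF assms]] by simp
next
  case (2 i)
  have 1: "Dleft (Dpow i (Dpow j B)) = Dpow (i + 1) (Dpow j B)"
    by (rule Dleft_Dpow[OF ord_le_Dpow[OF assms]])
  have 2: "Dleft (Dpow (i + j) B) = Dpow (i + 1 + j) B"
    using Dleft_Dpow[OF assms] by (simp add: algebra_simps)
  show ?case
    using Dleft_inj[OF ord_le_Dpow[OF ord_le_Dpow[OF assms]] ord_le_Dpow[OF assms], of i j "i + j"] 1 2
    by auto
qed

lemma fmul_eq:
  assumes "ord_le a A" "ord_le b B" "lo \<le> n - b" "a \<le> hi"
  shows "fmul A B n = (\<Sum>i=lo..hi. A i * Dpow i B n)"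
  unfolding fmul_def
proof (rule Sum_any.expand_superset)
  show "{i. A i * Dpow i B n \<noteq> 0} \<subseteq> {lo..hi}"
  proof
    fix i assume "i \<in> {i. A i * Dpow i B n \<noteq> 0}"
    then have "\<not> a < i" "\<not> b + i < n"
      using ord_leD[OF assms(1), of i] ord_leD[OF ord_le_Dpow[OF assms(2)], of i n] by auto
    then show "i \<in> {lo..hi}" using assms(3,4) by auto
  qed
qed auto

lemma ord_le_fmul:
  assumes "ord_le a A" "ord_le b B"
  shows "ord_le (a + b) (fmul A B)"
  unfolding ord_le_def
proof (intro allI impI)
  fix n assume "a + b < n"
  then show "fmul A B n = 0" using fmul_eq[OF assms, of "n - b" n a] by simp
qed

lemma fmul_top:
  assumes "ord_le a A" "ord_le b B"
  shows "fmul A B (a + b) = A a * B b"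
proof -
  have "fmul A B (a + b) = A a * Dpow a B (a + b)"
    using fmul_eq[OF assms, of a "a + b" a] by simp
  also have "Dpow a B (a + b) = B b"
    using Dpow_eq[OF assms(2), of "a + b" a 0] by (simp add: algebra_simps)
  finally show ?thesis .
qed

lemma fmul_fpdo_fun: "ord_le b B \<Longrightarrow> fmul (fpdo_fun f) B n = f * B n"
  unfolding fmul_def
  by (subst Sum_any.expand_superset[of "{0}"]) (auto simp: fpdo_fun_def Dpow_0)

lemma fmul_fpdo_D: "fmul (fpdo_D k) B n = Dpow k B n"
  unfolding fmul_def
  by (subst Sum_any.expand_superset[of "{k}"]) (auto simp: fpdo_D_def)

lemma Dleft_fmul:
  assumes A: "ord_le a A" and B: "ord_le b B"
  shows "Dleft (fmul A B) = fmul (Dleft A) B"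
proof
  fix n
  let ?lo = "n - b - 2"
  have "fmul (Dleft A) B n = (\<Sum>i=?lo+1..a+1. Dleft A i * Dpow i B n)"
    by (rule fmul_eq[OF ord_le_Dleft[OF A] B]) auto
  also have "\<dots> = (\<Sum>i=?lo+1..a+1. fps_deriv (A i) * Dpow i B n) +
     (\<Sum>i=?lo+1..a+1. A (i - 1) * Dpow i B n)"
    by (simp add: Dleft_def distrib_right sum.distrib)
  also have "(\<Sum>i=?lo+1..a+1. A (i - 1) * Dpow i B n) = (\<Sum>i=?lo..a. A i * Dpow (i + 1) B n)"
    by (rule sum.reindex_bij_witness[of _ "\<lambda>i. i + 1" "\<lambda>i. i - 1"]) auto
  also have "\<dots> = (\<Sum>i=?lo..a. A i * fps_deriv (Dpow i B n)) + (\<Sum>i=?lo..a. A i * Dpow i B (n - 1))"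
    by (simp add: Dleft_Dpow[OF B, symmetric] Dleft_def distrib_left sum.distrib)
  also have "(\<Sum>i=?lo..a. A i * Dpow i B (n - 1)) = fmul A B (n - 1)"
    by (rule fmul_eq[OF A B, symmetric]) auto
  also have "(\<Sum>i=?lo+1..a+1. fps_deriv (A i) * Dpow i B n) = (\<Sum>i=?lo..a. fps_deriv (A i) * Dpow i B n)"
  proof (rule sum.mono_neutral_cong)
    fix i assume "i \<in> {?lo..a} - {?lo+1..a+1}"
    then show "fps_deriv (A i) * Dpow i B n = 0"
      by (subst ord_leD[OF ord_le_Dpow[OF B], of i n]) auto
  next
    fix i assume "i \<in> {?lo+1..a+1} - {?lo..a}"
    then show "fps_deriv (A i) * Dpow i B n = 0"
      by (subst ord_leD[OF A, of i]) auto
  qed auto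
  also have "\<dots> + ((\<Sum>i=?lo..a. A i * fps_deriv (Dpow i B n)) + fmul A B (n - 1)) =
     fps_deriv (\<Sum>i=?lo..a. A i * Dpow i B n) + fmul A B (n - 1)"
    by (simp add: fps_deriv_sum sum.distrib add.commute)
  also have "(\<Sum>i=?lo..a. A i * Dpow i B n) = fmul A B n"
    by (rule fmul_eq[OF A B, symmetric]) auto
  finally show "Dleft (fmul A B) n = fmul (Dleft A) B n" by (simp add: Dleft_def)
qed

lemma Dpow_fmul:
  assumes A: "ord_le a A" and B: "ord_le b B"
  shows "fmul (Dpow i A) B = Dpow i (fmul A B)"
proof (induction i rule: int_shift_induct)
  case 1
  then show ?case using Dpow_0[OF A] Dpow_0[OF ord_le_fmul[OF A B]] by simp
next
  case (2 i)
  have 1: "Dleft (fmul (Dpow i A) B) = fmul (Dpow (i + 1) A) B"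
    by (simp add: Dleft_fmul[OF ord_le_Dpow[OF A] B] Dleft_Dpow[OF A])
  have 2: "Dleft (Dpow i (fmul A B)) = Dpow (i + 1) (fmul A B)"
    by (rule Dleft_Dpow[OF ord_le_fmul[OF A B]])
  show ?case
    using Dleft_inj[OF ord_le_fmul[OF ord_le_Dpow[OF A] B] ord_le_Dpow[OF ord_le_fmul[OF A B]], of i i] 1 2
    by auto
qed

text \<open>\<open>fmul A B\<close> is a left combination of the operators \<open>Dpow i B\<close>,
  so everything comes down to \<open>Dpow_fmul\<close>. As that was reduced to one step of
  \<partial>, no convolution identity for binomial coefficients occurs.\<close>

lemma fmul_assoc:
  assumes A: "ord_le a A" and B: "ord_le b B" and C: "ord_le c C"
  shows "fmul (fmul A B) C = fmul A (fmul B C)"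
proof
  fix n
  let ?I = "{n - c - b..a}" and ?M = "{n - c..a + b}"
  have "fmul (fmul A B) C n = (\<Sum>m\<in>?M. fmul A B m * Dpow m C n)"
    by (rule fmul_eq[OF ord_le_fmul[OF A B] C]) auto
  also have "\<dots> = (\<Sum>m\<in>?M. (\<Sum>i\<in>?I. A i * Dpow i B m) * Dpow m C n)"
    by (intro sum.cong refl arg_cong2[where f = "(*)"] fmul_eq[OF A B]) auto
  also have "\<dots> = (\<Sum>i\<in>?I. A i * (\<Sum>m\<in>?M. Dpow i B m * Dpow m C n))"
    by (simp add: sum_distrib_left sum_distrib_right mult.assoc) (rule sum.swap)
  also have "\<dots> = (\<Sum>i\<in>?I. A i * fmul (Dpow i B) C n)"
    by (intro sum.cong refl arg_cong2[where f = "(*)"] fmul_eq[OF ord_le_Dpow[OF B] C, symmetric]) auto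
  also have "\<dots> = (\<Sum>i\<in>?I. A i * Dpow i (fmul B C) n)"
    by (simp add: Dpow_fmul[OF B C])
  also have "\<dots> = fmul A (fmul B C) n"
    by (rule fmul_eq[OF A ord_le_fmul[OF B C], symmetric]) auto
  finally show "fmul (fmul A B) C n = fmul A (fmul B C) n" .
qed

lemma Dpow_fpdo_D: "Dpow i (fpdo_D k) n = fpdo_D (i + k) n"
proof -
  have one: "(fps_deriv ^^ l) 1 = (if l = 0 then 1 else 0 :: complex fps)" for l
    by (induction l) auto
  have t: "bin i l * (fps_deriv ^^ l) (fpdo_D k (n - i + int l)) = (if l = 0 then fpdo_D (i + k) n else 0)"
    for l
    by (cases "l = 0") (auto simp: fpdo_D_def one)
  have "Dpow i (fpdo_D k) n = (\<Sum>l\<le>nat (k - n + i). if l = 0 then fpdo_D (i + k) n else 0)"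
    by (subst Dpow_eq[OF ord_le_fpdo_D, of _ _ _ "nat (k - n + i)"])
      (auto simp: t simp del: sum.delta sum.delta')
  then show ?thesis by simp
qed

lemma fmul_fpdo_D_right:
  assumes "ord_le a A"
  shows "fmul A (fpdo_D k) n = A (n - k)"
proof -
  have "fmul A (fpdo_D k) n = (\<Sum>i=min (n - k) a..max a (n - k). A i * fpdo_D (i + k) n)"
    by (subst fmul_eq[OF assms ord_le_fpdo_D, of "min (n - k) a" _ _ "max a (n - k)"])
       (auto simp: Dpow_fpdo_D)
  also have "\<dots> = (\<Sum>i\<in>{n - k}. A i)"
    by (rule sum.mono_neutral_cong_right) (auto simp: fpdo_D_def)
  finally show ?thesis by simp
qed

text \<open>The composition \<open>\<partial>\<^sup>b \<cdot> S\<^sup>*\<close> in closed form.\<close>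

definition Dpow_adj :: "int \<Rightarrow> fpdo \<Rightarrow> fpdo" where
  "Dpow_adj b S = (\<lambda>m. \<Sum>s\<le>nat (b - m).
     fps_const ((-1) powi (m - b + int s) * (of_int (m + int s) gchoose s)) *
     (fps_deriv ^^ s) (S (m - b + int s)))"

lemma Dpow_adj_eq:
  assumes "ord_le 0 S" "b - m \<le> int L"
  shows "Dpow_adj b S m = (\<Sum>s\<le>L.
     fps_const ((-1) powi (m - b + int s) * (of_int (m + int s) gchoose s)) *
     (fps_deriv ^^ s) (S (m - b + int s)))"
  unfolding Dpow_adj_def
proof (rule sum.mono_neutral_cong_left)
  show "\<forall>s\<in>{..L} - {..nat (b - m)}.
    fps_const ((-1) powi (m - b + int s) * (of_int (m + int s) gchoose s)) *
     (fps_deriv ^^ s) (S (m - b + int s)) = 0"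
  proof
    fix s assume "s \<in> {..L} - {..nat (b - m)}"
    then have "S (m - b + int s) = 0" by (intro ord_leD[OF assms(1)]) auto
    then show "fps_const ((-1) powi (m - b + int s) * (of_int (m + int s) gchoose s)) *
     (fps_deriv ^^ s) (S (m - b + int s)) = 0" by simp
  qed
qed (use assms in auto)

lemma ord_le_Dpow_adj:
  assumes "ord_le 0 S"
  shows "ord_le b (Dpow_adj b S)"
  unfolding ord_le_def
proof (intro allI impI)
  fix m assume "b < m"
  then show "Dpow_adj b S m = 0"
    using Dpow_adj_eq[OF assms, of b m 0] ord_leD[OF assms, of "m - b"] by simp
qed

lemma Dpow_adj_0_0: "Dpow_adj 0 S 0 = S 0"
  by (simp add: Dpow_adj_def)

lemma Dleft_Dpow_adj:
  assumes S: "ord_le 0 S"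
  shows "Dleft (Dpow_adj b S) = Dpow_adj (b + 1) S"
proof
  fix m
  obtain L where L: "b - m + 1 \<le> int L" using nat_le_iff by blast
  let ?t = "\<lambda>s. (fps_deriv ^^ s) (S (m - b - 1 + int s))"
  let ?e = "\<lambda>s. (-1) powi (m - b - 1 + int s) :: complex"
  have "Dpow_adj (b + 1) S m =
      (\<Sum>s\<le>Suc L. fps_const (?e s * (of_int (m + int s) gchoose s)) * ?t s)"
    using L by (subst Dpow_adj_eq[OF S, of _ _ "Suc L"]) (auto simp: algebra_simps)
  also have "\<dots> = fps_const (?e 0) * ?t 0 +
      (\<Sum>s\<le>L. fps_const (?e (Suc s) * (of_int (m + int (Suc s)) gchoose Suc s)) * ?t (Suc s))"
    by (subst sum.atMost_Suc_shift) simp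
  also have "(\<Sum>s\<le>L. fps_const (?e (Suc s) * (of_int (m + int (Suc s)) gchoose Suc s)) * ?t (Suc s)) =
      (\<Sum>s\<le>L. fps_const (?e (Suc s) * (of_int (m + int s) gchoose s)) * ?t (Suc s)) +
      (\<Sum>s\<le>L. fps_const (?e (Suc s) * (of_int (m - 1 + int (Suc s)) gchoose Suc s)) * ?t (Suc s))"
  proof (unfold sum.distrib[symmetric], intro sum.cong refl)
    fix s
    have "(of_int (m + int (Suc s)) gchoose Suc s :: complex) =
      (of_int (m + int s) gchoose s) + (of_int (m - 1 + int (Suc s)) gchoose Suc s)"
      using gbinomial_Suc_Suc[of "of_int (m + int s) :: complex" s] by (simp add: algebra_simps)
    then show "fps_const (?e (Suc s) * (of_int (m + int (Suc s)) gchoose Suc s)) * ?t (Suc s) =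
      fps_const (?e (Suc s) * (of_int (m + int s) gchoose s)) * ?t (Suc s) +
      fps_const (?e (Suc s) * (of_int (m - 1 + int (Suc s)) gchoose Suc s)) * ?t (Suc s)"
      by (simp only: distrib_left distrib_right fps_const_add[symmetric])
  qed
  also have "fps_const (?e 0) * ?t 0 +
     ((\<Sum>s\<le>L. fps_const (?e (Suc s) * (of_int (m + int s) gchoose s)) * ?t (Suc s)) +
      (\<Sum>s\<le>L. fps_const (?e (Suc s) * (of_int (m - 1 + int (Suc s)) gchoose Suc s)) * ?t (Suc s))) =
     (\<Sum>s\<le>L. fps_const (?e (Suc s) * (of_int (m + int s) gchoose s)) * ?t (Suc s)) +
     (\<Sum>s\<le>Suc L. fps_const (?e s * (of_int (m - 1 + int s) gchoose s)) * ?t s)"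
    by (simp add: sum.atMost_Suc_shift del: sum.atMost_Suc funpow.simps of_nat_Suc)
  also have "(\<Sum>s\<le>Suc L. fps_const (?e s * (of_int (m - 1 + int s) gchoose s)) * ?t s) =
      Dpow_adj b S (m - 1)"
    using L by (subst Dpow_adj_eq[OF S, of _ _ "Suc L"]) (auto simp: algebra_simps)
  also have "(\<Sum>s\<le>L. fps_const (?e (Suc s) * (of_int (m + int s) gchoose s)) * ?t (Suc s)) =
      fps_deriv (Dpow_adj b S m)"
    using L by (subst Dpow_adj_eq[OF S, of _ _ L]) (auto simp: fps_deriv_sum algebra_simps)
  finally show "Dleft (Dpow_adj b S) m = Dpow_adj (b + 1) S m" by (simp add: Dleft_def)
qed

lemma Dpow_Dpow_adj:
  assumes S: "ord_le 0 S"
  shows "Dpow b (Dpow_adj 0 S) = Dpow_adj b S"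
proof (induction b rule: int_shift_induct)
  case 1
  then show ?case using Dpow_0[OF ord_le_Dpow_adj[OF S]] by simp
next
  case (2 b)
  show ?case
    using Dleft_inj[OF ord_le_Dpow[OF ord_le_Dpow_adj[OF S]] ord_le_Dpow_adj[OF S], of b 0 b]
      Dleft_Dpow[OF ord_le_Dpow_adj[OF S], of b 0] Dleft_Dpow_adj[OF S, of b] by auto
qed

text \<open>The pairing \<open>res\<^sub>\<partial> (A S T\<^sup>*) = res\<^sub>\<partial> (A (T S\<^sup>*)\<^sup>*)\<close> with \<open>T S\<^sup>* = 1\<close>.\<close>

lemma residue_differential_zero:
  assumes S: "ord_le 0 S" and T: "ord_le 0 T" and A: "ord_le (int a) A"
    and A_neg: "\<And>i. i < 0 \<Longrightarrow> A i = 0"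
    and TS: "fmul T (Dpow_adj 0 S) = fpdo_D 0" and K: "a + 1 \<le> K"
  shows "(\<Sum>\<beta>\<le>K. fmul A S (int \<beta> - 1) * (fps_const ((-1) ^ \<beta>) * T (- int \<beta>))) = 0"
proof -
  have AS: "fmul A S n = (\<Sum>i\<le>a. A (int i) * Dpow (int i) S n)" for n
  proof -
    have "fmul A S n = (\<Sum>i=min 0 n..int a. A i * Dpow i S n)"
      by (rule fmul_eq[OF A S]) auto
    also have "\<dots> = (\<Sum>i=0..int a. A i * Dpow i S n)"
      by (rule sum.mono_neutral_right) (auto simp: A_neg)
    also have "\<dots> = (\<Sum>i\<le>a. A (int i) * Dpow (int i) S n)"
      by (rule sum.reindex_bij_witness[of _ int nat]) auto
    finally show ?thesis .
  qed
  \<comment> \<open>Both sides are the same sum after the reflection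
    \<open>(- 1 - i + s gchoose s) = (- 1) ^ s * (i gchoose s)\<close>. This is how the adjoint
    moves a factor across the residue.\<close>
  have key: "fps_const ((-1) ^ \<beta>) * Dpow (int i) S (int \<beta> - 1) =
      fps_const ((-1) ^ Suc i) * Dpow (- int \<beta>) (Dpow_adj 0 S) (- 1 - int i)" for i \<beta>
  proof -
    obtain L where L: "int i + 1 - int \<beta> \<le> int L" using nat_le_iff by blast
    have "Dpow (- int \<beta>) (Dpow_adj 0 S) (- 1 - int i) =
      (\<Sum>s\<le>L. fps_const ((-1) powi (- 1 - int i + int \<beta> + int s) * (of_int (- 1 - int i + int s) gchoose s)) *
         (fps_deriv ^^ s) (S (- 1 - int i + int \<beta> + int s)))"
      using L by (subst Dpow_Dpow_adj[OF S], subst Dpow_adj_eq[OF S, of _ _ L]) auto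
    also have "\<dots> = (\<Sum>s\<le>L. fps_const ((-1) ^ Suc i * (-1) ^ \<beta>) *
        (bin (int i) s * (fps_deriv ^^ s) (S (- 1 - int i + int \<beta> + int s))))"
    proof (intro sum.cong refl)
      fix s
      have g: "(of_int (- 1 - int i + int s) gchoose s :: complex) = (-1) ^ s * (of_int (int i) gchoose s)"
        using gbinomial_negated_upper[of "of_int (int i) :: complex" s]
        by (simp add: algebra_simps flip: power_mult_distrib)
      have "(-1 :: complex) powi (- 1 - int i + int \<beta> + int s) =
        (-1) powi (- int (Suc i)) * (-1) powi int \<beta> * (-1) powi int s"
        by (subst power_int_add[symmetric] | simp)+
      also have "\<dots> = (-1) ^ Suc i * (-1) ^ \<beta> * (-1) ^ s"
        unfolding power_int_minus power_int_of_nat by (simp add: power_inverse[symmetric])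
      finally have e: "(-1 :: complex) powi (- 1 - int i + int \<beta> + int s) = (-1) ^ Suc i * (-1) ^ \<beta> * (-1) ^ s" .
      have "(-1 :: complex) powi (- 1 - int i + int \<beta> + int s) * (of_int (- 1 - int i + int s) gchoose s) =
        ((-1) ^ Suc i * (-1) ^ \<beta>) * (of_int (int i) gchoose s)"
        unfolding e g by (simp flip: power_mult_distrib)
      then show "fps_const ((-1) powi (- 1 - int i + int \<beta> + int s) * (of_int (- 1 - int i + int s) gchoose s)) *
         (fps_deriv ^^ s) (S (- 1 - int i + int \<beta> + int s)) =
         fps_const ((-1) ^ Suc i * (-1) ^ \<beta>) *
         (bin (int i) s * (fps_deriv ^^ s) (S (- 1 - int i + int \<beta> + int s)))"
        by (simp only: fps_const_mult[symmetric] mult.assoc)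
    qed
    also have "\<dots> = fps_const ((-1) ^ Suc i * (-1) ^ \<beta>) * Dpow (int i) S (int \<beta> - 1)"
      using L by (subst Dpow_eq[OF S, of _ _ L]) (auto simp: sum_distrib_left algebra_simps)
    finally show ?thesis
      by (simp add: mult.assoc[symmetric] flip: power_mult_distrib)
  qed
  \<comment> \<open>\<open>\<partial>\<^sup>-\<^sup>\<beta>\<close> times the adjoint has order
    \<open>- \<beta>\<close>, so only \<beta> \<le> i + 1 contributes at index
    \<open>- 1 - i\<close>; hence the bound on \<open>K\<close>.\<close>
  have TS': "fmul T (Dpow_adj 0 S) (- 1 - int i) =
     (\<Sum>\<beta>\<le>K. T (- int \<beta>) * Dpow (- int \<beta>) (Dpow_adj 0 S) (- 1 - int i))" if "i \<le> a" for i
  proof -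
    have "fmul T (Dpow_adj 0 S) (- 1 - int i) =
      (\<Sum>b=- int K..0. T b * Dpow b (Dpow_adj 0 S) (- 1 - int i))"
      using K that by (intro fmul_eq[OF T ord_le_Dpow_adj[OF S]]) auto
    also have "\<dots> = (\<Sum>\<beta>\<le>K. T (- int \<beta>) * Dpow (- int \<beta>) (Dpow_adj 0 S) (- 1 - int i))"
      by (rule sum.reindex_bij_witness[of _ "\<lambda>\<beta>. - int \<beta>" "\<lambda>b. nat (- b)"]) auto
    finally show ?thesis .
  qed
  have "(\<Sum>\<beta>\<le>K. fmul A S (int \<beta> - 1) * (fps_const ((-1) ^ \<beta>) * T (- int \<beta>))) =
    (\<Sum>\<beta>\<le>K. \<Sum>i\<le>a. A (int i) * T (- int \<beta>) * (fps_const ((-1) ^ \<beta>) * Dpow (int i) S (int \<beta> - 1)))"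
    unfolding AS sum_distrib_right by (simp add: mult_ac)
  also have "\<dots> = (\<Sum>i\<le>a. A (int i) * fps_const ((-1) ^ Suc i) *
      (\<Sum>\<beta>\<le>K. T (- int \<beta>) * Dpow (- int \<beta>) (Dpow_adj 0 S) (- 1 - int i)))"
    unfolding key sum_distrib_left by (subst sum.swap) (simp add: mult_ac)
  also have "\<dots> = (\<Sum>i\<le>a. A (int i) * fps_const ((-1) ^ Suc i) * fmul T (Dpow_adj 0 S) (- 1 - int i))"
    using TS' by (intro sum.cong) auto
  \<comment> \<open>Here it matters that \<open>A\<close> is a differential operator:
    \<open>i\<close> is nonnegative, and the identity has no coefficient at
    \<open>- 1 - i\<close>.\<close>
  also have "\<dots> = 0"
    unfolding TS fpdo_D_def by (intro sum.neutral) auto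
  finally show ?thesis .
qed

section \<open>Differential operators and the residues of powers of L\<close>

lemma Dpow_int_funpow: "ord_le b B \<Longrightarrow> Dpow (int i) B = (Dleft ^^ i) B"
proof (induction i)
  case (Suc i)
  then show ?case using Dleft_Dpow[of b B "int i"] by (simp add: add.commute)
qed (simp add: Dpow_0)

lemma Dleft_funpow_neg:
  "(\<And>n. n < 0 \<Longrightarrow> A n = 0) \<Longrightarrow> n < 0 \<Longrightarrow> (Dleft ^^ i) A n = 0"
  by (induction i arbitrary: n) (simp_all add: Dleft_def)

lemma fmul_neg:
  assumes "ord_le a A" "ord_le b B" "\<And>n. n < 0 \<Longrightarrow> A n = 0" "\<And>n. n < 0 \<Longrightarrow> B n = 0" "n < 0"
  shows "fmul A B n = 0"
proof -
  have "A i * Dpow i B n = 0" for i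
    using assms(3)[of i] Dpow_int_funpow[OF assms(2), of "nat i"]
      Dleft_funpow_neg[of B, OF assms(4,5), of "nat i"]
    by (cases "i < 0") auto
  then show ?thesis unfolding fmul_def by (auto intro!: Sum_any.neutral simp del: mult_eq_0_iff)
qed

lemma ord_le_Dleft_funpow: "ord_le a A \<Longrightarrow> ord_le (a + int q) ((Dleft ^^ q) A)"
  by (induction q) (auto dest: ord_le_Dleft simp: algebra_simps)

lemma Dleft_funpow_fmul:
  "ord_le a A \<Longrightarrow> ord_le b B \<Longrightarrow> fmul ((Dleft ^^ q) A) B = (Dleft ^^ q) (fmul A B)"
  by (induction q) (simp_all add: Dleft_fmul[OF ord_le_Dleft_funpow, symmetric])

lemma fmul_D_iterate:
  assumes L: "ord_le (int N) L" and S: "ord_le 0 S" and LS: "fmul L S = fmul S (fpdo_D (int N))"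
  shows "ord_le (int (N * r)) ((fmul L ^^ r) (fpdo_D 0))"
    and "fmul ((fmul L ^^ r) (fpdo_D 0)) S = fmul S (fpdo_D (int (N * r)))"
proof -
  have o: "ord_le (int (N * r)) ((fmul L ^^ r) (fpdo_D 0))" for r
  proof (induction r)
    case (Suc r)
    from ord_le_fmul[OF L Suc] show ?case by (simp add: algebra_simps)
  qed (simp add: ord_le_fpdo_D)
  then show "ord_le (int (N * r)) ((fmul L ^^ r) (fpdo_D 0))" .
  show "fmul ((fmul L ^^ r) (fpdo_D 0)) S = fmul S (fpdo_D (int (N * r)))"
  proof (induction r)
    case 0
    then show ?case
      by (auto simp: fmul_fpdo_D Dpow_0[OF S] fmul_fpdo_D_right[OF S])
  next
    case (Suc r)
    have DD: "fmul (fpdo_D i) (fpdo_D k) = fpdo_D (i + k)" for i k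
      by (auto simp: fmul_fpdo_D Dpow_fpdo_D)
    have "fmul ((fmul L ^^ Suc r) (fpdo_D 0)) S = fmul L (fmul S (fpdo_D (int (N * r))))"
      by (simp add: fmul_assoc[OF L o S] Suc)
    also have "\<dots> = fmul (fmul L S) (fpdo_D (int (N * r)))"
      by (rule fmul_assoc[OF L S ord_le_fpdo_D, symmetric])
    also have "\<dots> = fmul S (fpdo_D (int (N * Suc r)))"
      by (simp add: LS fmul_assoc[OF S ord_le_fpdo_D ord_le_fpdo_D] DD)
    finally show ?case .
  qed
qed

text \<open>The pairing is applied to the differential operator
  \<open>\<partial>\<^sup>q L\<^sup>r\<close>: composed with \<open>S\<close> it is
  \<open>\<partial>\<^sup>q S \<partial>\<^sup>N\<^sup>r\<close>, whose coefficients are those of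
  \<open>\<partial>\<^sup>q S\<close> shifted by \<open>N r\<close>.\<close>

lemma dressing_residue_fpdo:
  assumes L: "ord_le (int N) L" and Lneg: "\<And>i. i < 0 \<Longrightarrow> L i = 0"
    and S: "ord_le 0 S" and T: "ord_le 0 T"
    and LS: "fmul L S = fmul S (fpdo_D (int N))" and TS: "fmul T (Dpow_adj 0 S) = fpdo_D 0"
    and K: "q + N * r + 1 \<le> K"
  shows "(\<Sum>\<beta>\<le>K. (Dleft ^^ q) S (int \<beta> - 1 - int (N * r)) *
    (fps_const ((-1) ^ \<beta>) * T (- int \<beta>))) = 0"
proof -
  define B where "B = (fmul L ^^ r) (fpdo_D 0)"
  note B = fmul_D_iterate[OF L S LS, of r, folded B_def]
  have Bneg: "B n = 0" if "n < 0" for n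
    using that unfolding B_def
  proof (induction r arbitrary: n)
    case (Suc r)
    then show ?case
      using fmul_neg[OF L fmul_D_iterate(1)[OF L S LS] Lneg] by simp
  qed (simp add: fpdo_D_def)
  have shift: "(Dleft ^^ q) (\<lambda>n. S (n - c)) = (\<lambda>n. (Dleft ^^ q) S (n - c))" for c
    by (induction q) (auto simp: Dleft_def algebra_simps)
  have "fmul S (fpdo_D (int (N * r))) = (\<lambda>n. S (n - int (N * r)))"
    by (rule ext) (rule fmul_fpdo_D_right[OF S])
  then have "fmul ((Dleft ^^ q) B) S = (\<lambda>n. (Dleft ^^ q) S (n - int (N * r)))"
    by (simp only: Dleft_funpow_fmul[OF B(1) S] B(2) shift)
  moreover have "ord_le (int (q + N * r)) ((Dleft ^^ q) B)"
    using ord_le_Dleft_funpow[OF B(1), of q] by (simp add: add.commute)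
  ultimately show ?thesis
    using residue_differential_zero[OF S T, of "q + N * r" "(Dleft ^^ q) B" K]
      Dleft_funpow_neg[OF Bneg] TS K by simp
qed

text \<open>An inverse is only known to have some order. As \<open>P\<close> is monic of order 0, a
  leading coefficient of \<open>T\<close> in positive order would survive in the product, so the
  order descends to 0.\<close>

lemma ord_le_left_inverse:
  assumes P: "ord_le 0 P" "P 0 = 1" and T: "ord_le t T" and TP: "fmul T P = fpdo_D 0"
  shows "ord_le 0 T" "T 0 = 1"
proof -
  have "ord_le (int t) T \<Longrightarrow> ord_le 0 T" for t
  proof (induction t)
    case (Suc t)
    have "T (int (Suc t)) = 0"
      using fmul_top[OF Suc.prems P(1)] by (simp add: TP P(2) fpdo_D_def)
    with Suc.prems have "ord_le (int t) T"
      unfolding ord_le_def by (metis int_ops(4) add.commute zless_imp_add1_zle le_less)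
    then show ?case by (rule Suc.IH)
  qed simp
  from this[of "nat t"] show *: "ord_le 0 T" using ord_le_mono[OF T, of "int (nat t)"] by simp
  show "T 0 = 1"
    using fmul_top[OF * P(1)] by (simp add: TP P(2) fpdo_D_def)
qed

section \<open>The dressing operator\<close>

definition smooth_pdo :: "real set \<Rightarrow> int \<Rightarrow> pdo \<Rightarrow> bool" where
  "smooth_pdo A a P \<longleftrightarrow> (\<forall>i>a. P i = (\<lambda>_. 0)) \<and> (\<forall>i. smooth1 A (P i))"

definition pdo_jet :: "real \<Rightarrow> pdo \<Rightarrow> fpdo" where
  "pdo_jet x P = (\<lambda>i. jet x (P i))"

lemma is_pdo_onE:
  assumes "is_pdo_on A P" "open A"
  obtains a where "smooth_pdo A a P"
  using assms by (auto simp: is_pdo_on_def smooth_pdo_def intro: smooth1_if_smooth_on)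

lemma jet_0 [simp]: "jet x (\<lambda>_. 0) = 0"
  by (simp add: jet_const)

lemma ord_le_pdo_jet: "smooth_pdo A a P \<Longrightarrow> ord_le a (pdo_jet x P)"
  by (auto simp: smooth_pdo_def ord_le_def pdo_jet_def)

lemma pdo_jet_nth_0: "pdo_jet x P n $ 0 = P n x"
  by (simp add: pdo_jet_def)

lemma pdo_jet_cong:
  assumes "open A" "x \<in> A" "smooth_pdo A a Q" "pdo_eq_on A P Q"
  shows "pdo_jet x P = pdo_jet x Q"
  using assms by (auto simp: pdo_jet_def smooth_pdo_def pdo_eq_on_def intro!: jet_cong[of A])

lemma
  assumes "open A"
  shows smooth_pdo_D: "smooth_pdo A k (pdo_D k)"
    and pdo_jet_D: "pdo_jet x (pdo_D k) = fpdo_D k"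
  using smooth1_const[OF assms] by (auto simp: smooth_pdo_def pdo_D_def pdo_jet_def fpdo_D_def jet_const)

lemma
  assumes "smooth1 A f" "open A"
  shows smooth_pdo_fun: "smooth_pdo A 0 (pdo_fun f)"
    and pdo_jet_fun: "pdo_jet x (pdo_fun f) = fpdo_fun (jet x f)"
  using assms by (auto simp: smooth_pdo_def pdo_fun_def pdo_jet_def fpdo_fun_def smooth1_const)

text \<open>\<open>Sum_any\<close> gives 0 on an infinite support, so finiteness is needed. Above
  the order the coefficients are the zero function on the whole line, hence so are their
  derivatives.\<close>

lemma pdo_mult_eq:
  assumes P: "smooth_pdo A a P" and Q: "smooth_pdo A b Q"
  shows "pdo_mult P Q n = (\<lambda>x. \<Sum>i=n-b..a. \<Sum>l\<le>nat (a + b - n).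
    (of_int i gchoose l) * (P i x * (vderiv ^^ l) (Q (n - i + int l)) x))"
proof
  fix x
  let ?f = "\<lambda>(i, l). P i x * (of_int i gchoose l) * (vderiv ^^ l) (Q (n - i + int l)) x"
  have "pdo_mult P Q n x = sum ?f ({n-b..a} \<times> {..nat (a + b - n)})"
    unfolding pdo_mult_def
  proof (rule Sum_any.expand_superset)
    show "{il. ?f il \<noteq> 0} \<subseteq> {n-b..a} \<times> {..nat (a + b - n)}"
    proof
      fix il assume il: "il \<in> {il. ?f il \<noteq> 0}"
      obtain i l where [simp]: "il = (i, l)" by (cases il)
      have "P i \<noteq> (\<lambda>_. 0)" using il by auto
      then have i: "i \<le> a" using P by (auto simp: smooth_pdo_def not_less[symmetric])
      have "Q (n - i + int l) \<noteq> (\<lambda>_. 0)"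
      proof
        assume "Q (n - i + int l) = (\<lambda>_. 0)"
        then have "(vderiv ^^ l) (Q (n - i + int l)) x = 0" by (simp add: vderiv_const)
        with il show False by simp
      qed
      then have "n - i + int l \<le> b" using Q by (auto simp: smooth_pdo_def not_less[symmetric])
      with i show "il \<in> {n-b..a} \<times> {..nat (a + b - n)}" by auto
    qed
  qed auto
  then show "pdo_mult P Q n x = (\<Sum>i=n-b..a. \<Sum>l\<le>nat (a + b - n).
    (of_int i gchoose l) * (P i x * (vderiv ^^ l) (Q (n - i + int l)) x))"
    by (simp add: sum.cartesian_product mult_ac)
qed

text \<open>Multiplicativity of jets carries operator identities on \<open>A\<close> into the
  algebra over power series, and reading off constant terms brings them back.\<close>

lemma
  assumes A: "open A" and P: "smooth_pdo A a P" and Q: "smooth_pdo A b Q"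
  shows smooth_pdo_mult: "smooth_pdo A (a + b) (pdo_mult P Q)"
    and pdo_jet_mult: "x \<in> A \<Longrightarrow> pdo_jet x (pdo_mult P Q) = fmul (pdo_jet x P) (pdo_jet x Q)"
proof -
  have s: "smooth1 A (\<lambda>x. P i x * (vderiv ^^ l) (Q j) x)" for i l j
    using P Q by (intro smooth1_mult[OF A] smooth1_vderiv) (auto simp: smooth_pdo_def)
  have s': "smooth1 A (\<lambda>x. \<Sum>l\<le>L. (of_int i gchoose l) * (P i x * (vderiv ^^ l) (Q (n - i + int l)) x))" for i n L
    by (intro smooth1_sum[OF A] smooth1_cmult[OF A] s)
  show "smooth_pdo A (a + b) (pdo_mult P Q)"
    unfolding smooth_pdo_def
  proof (intro conjI allI impI)
    fix n show "smooth1 A (pdo_mult P Q n)"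
      unfolding pdo_mult_eq[OF P Q] by (intro smooth1_sum[OF A] s')
  next
    fix n assume "a + b < n"
    then show "pdo_mult P Q n = (\<lambda>_. 0)" unfolding pdo_mult_eq[OF P Q] by simp
  qed
  show "pdo_jet x (pdo_mult P Q) = fmul (pdo_jet x P) (pdo_jet x Q)" if x: "x \<in> A"
  proof
    fix n
    have "pdo_jet x (pdo_mult P Q) n = (\<Sum>i=n-b..a. \<Sum>l\<le>nat (a + b - n).
      fps_const (of_int i gchoose l) * (jet x (P i) * (fps_deriv ^^ l) (jet x (Q (n - i + int l)))))"
      unfolding pdo_jet_def pdo_mult_eq[OF P Q]
      using P Q
      by (subst jet_sum[OF A s' x], intro sum.cong refl,
          subst jet_sum[OF A smooth1_cmult[OF A s] x], intro sum.cong refl,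
          subst jet_cmult[OF A s x], subst jet_mult[OF A _ _ x])
         (auto simp: smooth_pdo_def smooth1_vderiv jet_vderiv_iter)
    also have "\<dots> = (\<Sum>i=n-b..a. pdo_jet x P i * Dpow i (pdo_jet x Q) n)"
    proof (intro sum.cong refl)
      fix i assume "i \<in> {n-b..a}"
      then show "(\<Sum>l\<le>nat (a + b - n).
        fps_const (of_int i gchoose l) * (jet x (P i) * (fps_deriv ^^ l) (jet x (Q (n - i + int l))))) =
        pdo_jet x P i * Dpow i (pdo_jet x Q) n"
        by (subst Dpow_eq[OF ord_le_pdo_jet[OF Q], of _ _ "nat (a + b - n)"])
          (auto simp: pdo_jet_def sum_distrib_left mult_ac)
    qed
    also have "\<dots> = fmul (pdo_jet x P) (pdo_jet x Q) n"
      by (rule fmul_eq[symmetric, OF ord_le_pdo_jet[OF P] ord_le_pdo_jet[OF Q]]) auto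
    finally show "pdo_jet x (pdo_mult P Q) n = fmul (pdo_jet x P) (pdo_jet x Q) n" .
  qed
qed

definition pdo_Dleft :: "pdo \<Rightarrow> pdo" where
  "pdo_Dleft P = (\<lambda>n x. vderiv (P n) x + P (n - 1) x)"

lemma
  assumes A: "open A" and P: "smooth_pdo A a P"
  shows smooth_pdo_Dleft: "smooth_pdo A (a + 1) (pdo_Dleft P)"
    and pdo_jet_Dleft: "x \<in> A \<Longrightarrow> pdo_jet x (pdo_Dleft P) = Dleft (pdo_jet x P)"
proof -
  have s: "smooth1 A (P n)" "smooth1 A (vderiv (P n))" for n
    using P smooth1_vderiv[of A "P n" 1] by (auto simp: smooth_pdo_def)
  have z: "vderiv (P n) = (\<lambda>_. 0)" "P (n - 1) = (\<lambda>_. 0)" if "a + 1 < n" for n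
  proof -
    have "P n = (\<lambda>_. 0)" using P that by (auto simp: smooth_pdo_def)
    then show "vderiv (P n) = (\<lambda>_. 0)" using vderiv_const[of 1 0] by simp
    show "P (n - 1) = (\<lambda>_. 0)" using P that by (auto simp: smooth_pdo_def)
  qed
  show "smooth_pdo A (a + 1) (pdo_Dleft P)"
    using smooth1_add[OF A s(2) s(1)] z by (auto simp: smooth_pdo_def pdo_Dleft_def)
  show "x \<in> A \<Longrightarrow> pdo_jet x (pdo_Dleft P) = Dleft (pdo_jet x P)"
    using jet_add[OF A s(2) s(1)] by (auto simp: pdo_jet_def pdo_Dleft_def Dleft_def jet_vderiv)
qed

lemma
  assumes A: "open A" and P: "smooth_pdo A a P"
  shows smooth_pdo_Dleft_funpow: "smooth_pdo A (a + int q) ((pdo_Dleft ^^ q) P)"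
    and pdo_jet_Dleft_funpow: "x \<in> A \<Longrightarrow> pdo_jet x ((pdo_Dleft ^^ q) P) = (Dleft ^^ q) (pdo_jet x P)"
proof -
  show *: "smooth_pdo A (a + int q) ((pdo_Dleft ^^ q) P)" for q
    using P by (induction q) (auto dest: smooth_pdo_Dleft[OF A] simp: algebra_simps)
  show "x \<in> A \<Longrightarrow> pdo_jet x ((pdo_Dleft ^^ q) P) = (Dleft ^^ q) (pdo_jet x P)"
    by (induction q) (simp_all add: pdo_jet_Dleft[OF A *])
qed

lemma pdo_adjoint_eq:
  assumes S: "smooth_pdo A 0 S"
  shows "pdo_adjoint S n = (\<lambda>x. \<Sum>s\<le>nat (- n).
     ((-1) powi (n + int s) * (of_int (n + int s) gchoose s)) * (vderiv ^^ s) (S (n + int s)) x)"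
proof
  fix x
  have 1: "pdo_mult (pdo_D i) (pdo_fun f) n x =
    (if n \<le> i then (of_int i gchoose nat (i - n)) * (vderiv ^^ nat (i - n)) f x else 0)" for i f
  proof -
    have "pdo_mult (pdo_D i) (pdo_fun f) n x =
      (\<Sum>(i', l)\<in>(if n \<le> i then {(i, nat (i - n))} else {}).
         pdo_D i i' x * (of_int i' gchoose l) * (vderiv ^^ l) (pdo_fun f (n - i' + int l)) x)"
      unfolding pdo_mult_def
    proof (rule Sum_any.expand_superset)
      show "{a. (case a of (i', l) \<Rightarrow>
          pdo_D i i' x * (of_int i' gchoose l) * (vderiv ^^ l) (pdo_fun f (n - i' + int l)) x) \<noteq> 0}
        \<subseteq> (if n \<le> i then {(i, nat (i - n))} else {})"
        by (auto simp: pdo_D_def pdo_fun_def vderiv_const split: if_splits)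
    qed auto
    then show ?thesis by (auto simp: pdo_D_def pdo_fun_def)
  qed
  have "pdo_adjoint S n x = (\<Sum>i=n..0. (-1) powi i * pdo_mult (pdo_D i) (pdo_fun (S i)) n x)"
    unfolding pdo_adjoint_def
  proof (rule Sum_any.expand_superset)
    show "{i. (-1) powi i * pdo_mult (pdo_D i) (pdo_fun (S i)) n x \<noteq> 0} \<subseteq> {n..0}"
    proof
      fix i assume "i \<in> {i. (-1) powi i * pdo_mult (pdo_D i) (pdo_fun (S i)) n x \<noteq> 0}"
      then have *: "pdo_mult (pdo_D i) (pdo_fun (S i)) n x \<noteq> 0" by auto
      then have "n \<le> i" unfolding 1 by (auto split: if_splits)
      moreover have "S i \<noteq> (\<lambda>_. 0)" using * unfolding 1 by (auto simp: vderiv_const split: if_splits)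
      then have "i \<le> 0" using S by (auto simp: smooth_pdo_def not_less[symmetric])
      ultimately show "i \<in> {n..0}" by simp
    qed
  qed auto
  also have "\<dots> = (\<Sum>s\<in>(if n \<le> 0 then {..nat (- n)} else {}).
     ((-1) powi (n + int s) * (of_int (n + int s) gchoose s)) * (vderiv ^^ s) (S (n + int s)) x)"
    unfolding 1
    by (rule sum.reindex_bij_witness[of _ "\<lambda>s. n + int s" "\<lambda>i. nat (i - n)"])
       (auto split: if_splits)
  also have "\<dots> = (\<Sum>s\<le>nat (- n).
     ((-1) powi (n + int s) * (of_int (n + int s) gchoose s)) * (vderiv ^^ s) (S (n + int s)) x)"
    using S by (auto simp: smooth_pdo_def)
  finally show "pdo_adjoint S n x = (\<Sum>s\<le>nat (- n).
     ((-1) powi (n + int s) * (of_int (n + int s) gchoose s)) * (vderiv ^^ s) (S (n + int s)) x)" .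
qed

lemma
  assumes A: "open A" and S: "smooth_pdo A 0 S"
  shows smooth_pdo_adjoint: "smooth_pdo A 0 (pdo_adjoint S)"
    and pdo_jet_adjoint: "x \<in> A \<Longrightarrow> pdo_jet x (pdo_adjoint S) = Dpow_adj 0 (pdo_jet x S)"
proof -
  have s: "smooth1 A ((vderiv ^^ l) (S j))" for l j
    using S by (intro smooth1_vderiv) (auto simp: smooth_pdo_def)
  show "smooth_pdo A 0 (pdo_adjoint S)"
    unfolding smooth_pdo_def
  proof (intro conjI allI impI)
    fix n :: int assume "0 < n"
    then show "pdo_adjoint S n = (\<lambda>_. 0)"
      unfolding pdo_adjoint_eq[OF S] using S by (auto simp: smooth_pdo_def)
  next
    show "smooth1 A (pdo_adjoint S n)" for n
      unfolding pdo_adjoint_eq[OF S] by (intro smooth1_sum[OF A] smooth1_cmult[OF A] s)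
  qed
  show "pdo_jet x (pdo_adjoint S) = Dpow_adj 0 (pdo_jet x S)" if x: "x \<in> A"
  proof
    fix n
    show "pdo_jet x (pdo_adjoint S) n = Dpow_adj 0 (pdo_jet x S) n"
      unfolding pdo_jet_def pdo_adjoint_eq[OF S] Dpow_adj_def
      by (subst jet_sum[OF A smooth1_cmult[OF A s] x], intro sum.cong)
         (auto simp: jet_cmult[OF A s x] jet_vderiv_iter)
  qed
qed

lemma smooth_pdo_lax_op:
  assumes "open A" "\<forall>i\<le>N - 2. smooth_on A (u i)"
  shows "smooth_pdo A (int N) (lax_op N u)"
  unfolding smooth_pdo_def lax_op_def
  using assms(2) smooth1_const[OF assms(1)]
  by (auto intro!: smooth1_if_smooth_on[OF assms(1)] simp: nat_le_iff of_nat_diff)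

text \<open>The differential equation \<open>L \<Psi> = z\<^sup>N \<Psi>\<close> and the bilinear identities
  \<open>res\<^sub>z z\<^sup>N\<^sup>r (\<partial>\<^sup>q \<Psi>) \<Psi>\<^sup>* = 0\<close> for \<open>q, r \<ge> 0\<close>, in terms of coefficients.\<close>

lemma
  assumes X: "open X" and u: "\<forall>i\<le>N - 2. smooth_on X (u i)" and S: "dressing_operator N u X S"
    and x: "x \<in> X"
  shows dressing_smooth_pdo: "smooth_pdo X 0 S"
    and lax_dressing_fpdo: "fmul (pdo_jet x (lax_op N u)) (pdo_jet x S) = fmul (pdo_jet x S) (fpdo_D (int N))"
    and lax_dressing: "(\<Sum>i\<le>N. lax_op N u (int i) x * (pdo_Dleft ^^ i) S n x) = S (n - int N) x"
proof -
  let ?L = "lax_op N u"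
  show S0: "smooth_pdo X 0 S"
    using S is_pdo_onE[OF _ X, of S] by (auto simp: dressing_operator_def smooth_pdo_def)
  note L0 = smooth_pdo_lax_op[OF X u]
  from S obtain S' where S': "pdo_inverse_on X S S'"
    and LS: "pdo_eq_on X ?L (pdo_mult S (pdo_mult (pdo_D (int N)) S'))"
    by (auto simp: dressing_operator_def)
  from S' obtain b where b: "smooth_pdo X b S'"
    by (auto simp: pdo_inverse_on_def elim: is_pdo_onE[OF _ X])
  let ?l = "pdo_jet x ?L" and ?s = "pdo_jet x S" and ?s' = "pdo_jet x S'"
  note o = ord_le_pdo_jet[OF S0] ord_le_pdo_jet[OF b] ord_le_pdo_jet[OF L0]
  note DS = smooth_pdo_mult[OF X smooth_pdo_D[OF X] b, of "int N"]
  have 1: "?l = fmul ?s (fmul (fpdo_D (int N)) ?s')"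
    using pdo_jet_cong[OF X x smooth_pdo_mult[OF X S0 DS] LS]
    by (simp add: pdo_jet_mult[OF X S0 DS x] pdo_jet_mult[OF X smooth_pdo_D[OF X] b x] pdo_jet_D[OF X])
  have 2: "fmul ?s' ?s = fpdo_D 0"
    using S' pdo_jet_cong[OF X x smooth_pdo_D[OF X], of "pdo_mult S' S" 0]
    by (simp add: pdo_inverse_on_def pdo_jet_mult[OF X b S0 x] pdo_jet_D[OF X])
  have "fmul ?l ?s = fmul ?s (fmul (fmul (fpdo_D (int N)) ?s') ?s)"
    unfolding 1 by (rule fmul_assoc[OF o(1) ord_le_fmul[OF ord_le_fpdo_D o(2)] o(1)])
  also have "fmul (fmul (fpdo_D (int N)) ?s') ?s = fmul (fpdo_D (int N)) (fpdo_D 0)"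
    by (simp add: fmul_assoc[OF ord_le_fpdo_D o(2) o(1)] 2)
  also have "\<dots> = fpdo_D (int N)"
    by (auto simp: fmul_fpdo_D Dpow_fpdo_D)
  finally show 3: "fmul ?l ?s = fmul ?s (fpdo_D (int N))" .
  have "fmul ?l ?s n = (\<Sum>i=min 0 n..int N. ?l i * Dpow i ?s n)"
    by (rule fmul_eq[OF o(3,1)]) auto
  also have "\<dots> = (\<Sum>i=0..int N. ?l i * Dpow i ?s n)"
    by (rule sum.mono_neutral_right) (auto simp: pdo_jet_def lax_op_def)
  also have "\<dots> = (\<Sum>i\<le>N. ?l (int i) * Dpow (int i) ?s n)"
    by (rule sum.reindex_bij_witness[of _ int nat]) auto
  also have "\<dots> = (\<Sum>i\<le>N. ?l (int i) * pdo_jet x ((pdo_Dleft ^^ i) S) n)"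
    by (simp add: Dpow_int_funpow[OF o(1)] pdo_jet_Dleft_funpow[OF X S0 x])
  finally have "(\<Sum>i\<le>N. ?l (int i) * pdo_jet x ((pdo_Dleft ^^ i) S) n) = ?s (n - int N)"
    by (simp add: 3 fmul_fpdo_D_right[OF o(1)])
  then have "(\<Sum>i\<le>N. ?l (int i) * pdo_jet x ((pdo_Dleft ^^ i) S) n) $ 0 = ?s (n - int N) $ 0"
    by simp
  then show "(\<Sum>i\<le>N. ?L (int i) x * (pdo_Dleft ^^ i) S n x) = S (n - int N) x"
    by (simp add: fps_sum_nth pdo_jet_nth_0)
qed

lemma
  assumes X: "open X" and u: "\<forall>i\<le>N - 2. smooth_on X (u i)" and S: "dressing_operator N u X S"
    and T: "pdo_inverse_on X (pdo_adjoint S) T" and y: "y \<in> X"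
  shows adjoint_inverse_0: "T 0 y = 1"
    and dressing_residue: "q + N * r + 1 \<le> K \<Longrightarrow>
      (\<Sum>\<beta>\<le>K. (pdo_Dleft ^^ q) S (int \<beta> - 1 - int (N * r)) y * ((-1) ^ \<beta> * T (- int \<beta>) y)) = 0"
proof -
  note S0 = dressing_smooth_pdo[OF X u S y] and L0 = smooth_pdo_lax_op[OF X u]
  note A0 = smooth_pdo_adjoint[OF X S0]
  from T obtain t where t: "smooth_pdo X t T"
    by (auto simp: pdo_inverse_on_def elim: is_pdo_onE[OF _ X])
  let ?s = "pdo_jet y S" and ?t = "pdo_jet y T"
  note os = ord_le_pdo_jet[OF S0, of y]
  have TS: "fmul ?t (Dpow_adj 0 ?s) = fpdo_D 0"
    using T pdo_jet_cong[OF X y smooth_pdo_D[OF X], of "pdo_mult T (pdo_adjoint S)" 0]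
    by (simp add: pdo_inverse_on_def pdo_jet_mult[OF X t A0 y] pdo_jet_D[OF X] pdo_jet_adjoint[OF X S0 y])
  \<comment> \<open>\<open>S 0\<close> is 1 only on \<open>X\<close>, but as \<open>X\<close> is
    open its whole jet at \<open>y\<close> is that of 1; so the adjoint is monic.\<close>
  have "jet y (S 0) = jet y (\<lambda>_. 1)"
    using S y by (intro jet_cong[OF X smooth1_const[OF X]]) (auto simp: dressing_operator_def)
  then have "Dpow_adj 0 ?s 0 = 1"
    by (simp add: Dpow_adj_0_0 pdo_jet_def jet_const)
  note T0 = ord_le_left_inverse[OF ord_le_Dpow_adj[OF os] this ord_le_pdo_jet[OF t] TS]
  show "T 0 y = 1"
    using T0(2) pdo_jet_nth_0[of y T 0] by simp
  assume K: "q + N * r + 1 \<le> K"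
  have "(\<Sum>\<beta>\<le>K. pdo_jet y ((pdo_Dleft ^^ q) S) (int \<beta> - 1 - int (N * r)) *
    (fps_const ((-1) ^ \<beta>) * ?t (- int \<beta>))) = 0"
    using dressing_residue_fpdo[OF ord_le_pdo_jet[OF L0] _ os T0(1) lax_dressing_fpdo[OF X u S y] TS K]
    by (simp add: pdo_jet_Dleft_funpow[OF X S0 y]) (simp add: pdo_jet_def lax_op_def)
  then have "(\<Sum>\<beta>\<le>K. pdo_jet y ((pdo_Dleft ^^ q) S) (int \<beta> - 1 - int (N * r)) *
    (fps_const ((-1) ^ \<beta>) * ?t (- int \<beta>))) $ 0 = 0" by simp
  then show "(\<Sum>\<beta>\<le>K. (pdo_Dleft ^^ q) S (int \<beta> - 1 - int (N * r)) y * ((-1) ^ \<beta> * T (- int \<beta>) y)) = 0"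
    by (simp add: fps_sum_nth pdo_jet_nth_0)
qed

section \<open>The coefficients of \<open>\<partial>\<^sup>m (x\<^sup>-\<^sup>1 \<partial>\<^sup>N\<^sup>-\<^sup>1)\<^sup>k\<close>\<close>

text \<open>Moving \<open>\<partial>\<^sup>m\<close> past \<open>x\<^sup>-\<^sup>1\<close> gives the
  terms \<open>(- m)_l x\<^sup>-\<^sup>1\<^sup>-\<^sup>l \<partial>\<^sup>m\<^sup>-\<^sup>l\<close>
  with rising factorials, because the \<open>l\<close>-th derivative of
  \<open>x\<^sup>-\<^sup>1\<close> is
  \<open>(- 1)\<^sup>l l! x\<^sup>-\<^sup>1\<^sup>-\<^sup>l\<close>. The order of the remaining
  operator bounds \<open>l\<close>.\<close>

primrec pos_coeff :: "nat \<Rightarrow> int \<Rightarrow> nat \<Rightarrow> int \<Rightarrow> complex" where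
  "pos_coeff N i 0 m = (if m = i then 1 else 0)"
| "pos_coeff N i (Suc k) m = (\<Sum>l\<le>nat (m + (int k + 1) * (int N - 1) - i).
     pochhammer (- of_int m) l * pos_coeff N i k (m - int l + int N - 1))"

text \<open>Negative powers come from the inverse
  \<open>\<partial>\<^sup>1\<^sup>-\<^sup>N x\<close> of
  \<open>x\<^sup>-\<^sup>1 \<partial>\<^sup>N\<^sup>-\<^sup>1\<close>. They occur because
  \<open>\<partial>\<^sup>m E\<^sub>0\<close> with large \<open>m\<close> involves negative powers
  of \<open>t\<close>.\<close>

primrec neg_coeff :: "nat \<Rightarrow> int \<Rightarrow> nat \<Rightarrow> int \<Rightarrow> complex" where
  "neg_coeff N i 0 m = (if m = i then 1 else 0)"
| "neg_coeff N i (Suc k) m =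
     neg_coeff N i k (m - int N + 1) + of_int (m - int N + 1) * neg_coeff N i k (m - int N)"

text \<open>\<open>\<partial>\<^sup>m (x\<^sup>-\<^sup>1 \<partial>\<^sup>N\<^sup>-\<^sup>1)\<^sup>k = \<Sum>i. res_coeff N k m i x\<^sup>i\<^sup>-\<^sup>m\<^sup>-\<^sup>k\<^sup>N \<partial>\<^sup>i\<close> for all integers \<open>k\<close> and \<open>m\<close>.\<close>

definition res_coeff :: "nat \<Rightarrow> int \<Rightarrow> int \<Rightarrow> int \<Rightarrow> complex" where
  "res_coeff N k m i = (if k \<ge> 0 then pos_coeff N i (nat k) m else neg_coeff N i (nat (- k)) m)"

lemma res_coeff_0: "res_coeff N 0 m i = (if m = i then 1 else 0)"
  by (simp add: res_coeff_def)

lemma pos_coeff_eq_0: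
  "m + int k * (int N - 1) < i \<Longrightarrow> pos_coeff N i k m = 0"
proof (induction k arbitrary: m)
  case (Suc k)
  have "pos_coeff N i k (m - int l + int N - 1) = 0" for l
    using Suc.prems by (intro Suc.IH) (simp add: algebra_simps)
  then show ?case by (simp del: of_int_minus)
qed simp

lemma neg_coeff_eq_0:
  "m - int k * (int N - 1) < i \<Longrightarrow> neg_coeff N i k m = 0"
proof (induction k arbitrary: m)
  case (Suc k)
  have "neg_coeff N i k (m - int N + 1) = 0" "neg_coeff N i k (m - int N) = 0"
    using Suc.prems by (intro Suc.IH; simp add: algebra_simps)+
  then show ?case by simp
qed simp

lemma res_coeff_eq_0: "m + k * (int N - 1) < i \<Longrightarrow> res_coeff N k m i = 0"
  using pos_coeff_eq_0[of m "nat k" N i] neg_coeff_eq_0[of m "nat (- k)" N i]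
  by (auto simp: res_coeff_def)

lemma pos_coeff_rec:
  "pos_coeff N i (Suc k) m + of_int m * pos_coeff N i (Suc k) (m - 1) = pos_coeff N i k (m + int N - 1)"
proof (cases "m + (int k + 1) * (int N - 1) - i \<le> 0")
  case True
  then have "pos_coeff N i (Suc k) (m - 1) = 0"
    by (intro pos_coeff_eq_0) (simp add: algebra_simps)
  with True show ?thesis by simp
next
  case False
  then obtain L where L: "m + (int k + 1) * (int N - 1) - i = int (Suc L)"
    by (metis gr0_implies_Suc linorder_not_less zero_less_imp_eq_int)
  then have L': "nat (m + (int k + 1) * (int N - 1) - i) = Suc L"
    "nat (m - 1 + (int k + 1) * (int N - 1) - i) = L" by simp_all
  have "pos_coeff N i (Suc k) m = pos_coeff N i k (m + int N - 1) +
    (\<Sum>l\<le>L. pochhammer (- of_int m) (Suc l) * pos_coeff N i k (m - int (Suc l) + int N - 1))"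
    unfolding pos_coeff.simps L' by (subst sum.atMost_Suc_shift) simp
  also have "(\<Sum>l\<le>L. pochhammer (- of_int m) (Suc l) * pos_coeff N i k (m - int (Suc l) + int N - 1)) =
    - of_int m * pos_coeff N i (Suc k) (m - 1)"
    unfolding pos_coeff.simps L' by (simp add: pochhammer_rec sum_distrib_left algebra_simps)
  finally show ?thesis by simp
qed

text \<open>\<open>\<partial>\<^sup>m \<cdot> x = x \<partial>\<^sup>m + m \<partial>\<^sup>m\<^sup>-\<^sup>1\<close> applied to \<open>(x\<^sup>-\<^sup>1 \<partial>\<^sup>N\<^sup>-\<^sup>1)\<^sup>k\<close>.\<close>

lemma res_coeff_rec:
  "res_coeff N k m i + of_int m * res_coeff N k (m - 1) i = res_coeff N (k - 1) (m + int N - 1) i"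
proof (cases "k > 0")
  case True
  then have "nat k = Suc (nat (k - 1))" by simp
  then show ?thesis using True pos_coeff_rec[of N i "nat (k - 1)" m] by (simp only: res_coeff_def) simp
next
  case False
  then have "res_coeff N k m i = neg_coeff N i (nat (- k)) m" for m
    by (auto simp: res_coeff_def)
  moreover have "nat (- (k - 1)) = Suc (nat (- k))" using False by simp
  ultimately show ?thesis using False by (simp add: res_coeff_def algebra_simps)
qed

text \<open>Two families subject to the recursion are compared through their difference. For growing
  \<open>k\<close> it is solved upwards in \<open>m\<close> from the vanishing for small
  \<open>m\<close>; for falling \<open>k\<close> it gives the next values outright.\<close>

lemma res_coeff_rec_unique:
  fixes Z :: "int \<Rightarrow> int \<Rightarrow> complex"
  assumes rec: "\<And>k m. Z k m + of_int m * Z k (m - 1) = Z (k - 1) (m + c)"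
    and Z0: "\<And>m. Z 0 m = 0" and low: "\<And>k m. m < M k \<Longrightarrow> Z k m = 0"
  shows "Z k m = 0"
proof -
  have up: "\<forall>m. Z (int k) m = 0" for k
  proof (induction k)
    case (Suc k)
    have "Z (int (Suc k)) m = 0" for m
    proof -
      have "Z (int (Suc k)) (M (int (Suc k)) - 1 + int n) = 0" for n
      proof (induction n)
        case (Suc n)
        then show ?case
          using rec[of "int (Suc k)" "M (int (Suc k)) + int n"] \<open>\<forall>m. Z (int k) m = 0\<close>
          by (simp add: algebra_simps)
      qed (simp add: low)
      from this[of "nat (m - M (int (Suc k)) + 1)"] show ?thesis
        using low[of m "int (Suc k)"] by (cases "m < M (int (Suc k))") (auto simp del: of_nat_Suc)
    qed
    then show ?case by blast
  qed (simp add: Z0)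
  have down: "\<forall>m. Z (- int k) m = 0" for k
  proof (induction k)
    case (Suc k)
    have "- int (Suc k) = - int k - 1" by simp
    then have "Z (- int (Suc k)) m = 0" for m
      using rec[of "- int k" "m - c"] Suc by (simp only:) simp
    then show ?case by blast
  qed (simp add: Z0)
  show ?thesis
    using up[of "nat k"] down[of "nat (- k)"] by (cases "k \<ge> 0") auto
qed

text \<open>Multiplication of \<open>\<partial>\<^sup>m (x\<^sup>-\<^sup>1 \<partial>\<^sup>N\<^sup>-\<^sup>1)\<^sup>k\<close> by \<open>\<partial>\<close> from the left.\<close>

lemma res_coeff_deriv:
  "res_coeff N k (m + 1) i =
     of_int (i - m - k * int N) * res_coeff N k m i + res_coeff N k m (i - 1)"
proof -
  define Z where "Z = (\<lambda>k m. res_coeff N k (m + 1) i -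
     of_int (i - m - k * int N) * res_coeff N k m i - res_coeff N k m (i - 1))"
  have "Z k m = 0"
  proof (rule res_coeff_rec_unique[where c = "int N - 1" and M = "\<lambda>k. i - 1 - k * (int N - 1)"])
    fix k m
    have r: "res_coeff N (k - 1) (m + int N) i = res_coeff N k (m + 1) i + of_int (m + 1) * res_coeff N k m i"
      using res_coeff_rec[of N k "m + 1" i] by (simp add: add.commute)
    show "Z k m + of_int m * Z k (m - 1) = Z (k - 1) (m + (int N - 1))"
      unfolding Z_def using r res_coeff_rec[of N k m i, symmetric] res_coeff_rec[of N k m "i - 1", symmetric]
      by (simp add: algebra_simps)
  next
    show "Z 0 m = 0" for m
      by (auto simp: Z_def res_coeff_0)
  next
    show "m < i - 1 - k * (int N - 1) \<Longrightarrow> Z k m = 0" for k m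
      by (simp add: Z_def res_coeff_eq_0)
  qed
  then show ?thesis by (simp add: Z_def algebra_simps)
qed

text \<open>Comparison of the coefficients of \<open>\<partial>\<^sup>-\<^sup>1\<close> in \<open>Q\<close> and of \<open>\<partial>\<^sup>N\<^sup>-\<^sup>2\<close> in \<open>Q x\<^sup>-\<^sup>1 \<partial>\<^sup>N\<^sup>-\<^sup>1\<close>
  for \<open>Q = \<partial>\<^sup>m (x\<^sup>-\<^sup>1 \<partial>\<^sup>N\<^sup>-\<^sup>1)\<^sup>k\<close>.\<close>

lemma res_coeff_wrap: "res_coeff N k m (- 1) = res_coeff N (k + 1) m (int N - 2)"
proof -
  define Z where "Z = (\<lambda>k m. res_coeff N k m (- 1) - res_coeff N (k + 1) m (int N - 2))"
  have low: "m < - 1 - k * (int N - 1) \<Longrightarrow> Z k m = 0" for k m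
    by (simp add: Z_def res_coeff_eq_0 algebra_simps)
  have rec: "Z k m + of_int m * Z k (m - 1) = Z (k - 1) (m + (int N - 1))" for k m
    unfolding Z_def
    using res_coeff_rec[of N k m "- 1", symmetric] res_coeff_rec[of N "k + 1" m "int N - 2", symmetric]
    by (simp add: algebra_simps)
  have Z0: "Z 0 m = 0" for m
  proof -
    have r: "res_coeff N 1 m (int N - 2) + of_int m * res_coeff N 1 (m - 1) (int N - 2) =
      (if m = - 1 then 1 else 0)" for m
      using res_coeff_rec[of N 1 m "int N - 2"] by (simp add: res_coeff_0 algebra_simps)
    have l: "res_coeff N 1 m (int N - 2) = 0" if "m < - 1" for m
      using that by (intro res_coeff_eq_0) simp
    have 1: "res_coeff N 1 (- 1) (int N - 2) = 1"
      using r[of "- 1"] l[of "- 2"] by simp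
    \<comment> \<open>The factor \<open>m\<close> is zero at \<open>m = 0\<close>, so the value 1 at
      \<open>m = - 1\<close> does not propagate upwards.\<close>
    have "res_coeff N 1 (int n) (int N - 2) = 0" for n
    proof (induction n)
      case (Suc n)
      then show ?case using r[of "int (Suc n)"] by simp
    qed (use r[of 0] in simp)
    from this[of "nat m"] 1 l[of m] show ?thesis
      by (cases "m < - 1"; cases "m = - 1") (auto simp: Z_def res_coeff_0)
  qed
  have "Z k m = 0"
    by (rule res_coeff_rec_unique[OF rec Z0 low])
  then show ?thesis by (simp add: Z_def)
qed

text \<open>For nonnegative \<open>m\<close> and a positive exponent, \<open>\<partial>\<^sup>m
  (x\<^sup>-\<^sup>1 \<partial>\<^sup>N\<^sup>-\<^sup>1)\<^sup>k\<close> is a differential operator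
  divisible on the right by \<open>\<partial>\<^sup>N\<^sup>-\<^sup>1\<close>. At
  \<open>m = 0\<close> this is why the sum in the theorem starts with \<open>n = 1\<close>.\<close>

lemma res_coeff_nonneg_eq_0:
  assumes "j < int N - 1" and N: "N \<ge> 1"
  shows "res_coeff N (int (Suc k)) (int m) j = 0"
proof (induction k arbitrary: m)
  case 0
  have "res_coeff N 1 (int m) j = 0"
  proof (induction m)
    case 0
    then show ?case using res_coeff_rec[of N 1 0 j] assms by (simp add: res_coeff_0)
  next
    case (Suc m)
    then show ?case using res_coeff_rec[of N 1 "int (Suc m)" j] assms by (simp add: res_coeff_0)
  qed
  then show ?case by simp
next
  case (Suc k)
  note IH = Suc
  show ?case
  proof (induction m)
    case 0
    have "res_coeff N (int (Suc k)) (int N - 1) j = 0"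
      using IH[of "N - 1"] N by (simp add: of_nat_diff)
    then show ?case using res_coeff_rec[of N "int (Suc (Suc k))" 0 j] by simp
  next
    case (Suc m)
    have "res_coeff N (int (Suc k)) (int (Suc m) + int N - 1) j = 0"
      using IH[of "m + N"] by (simp add: algebra_simps)
    then show ?case using res_coeff_rec[of N "int (Suc (Suc k))" "int (Suc m)" j] Suc by simp
  qed
qed

section \<open>Falling factorials in the residue numbers\<close>

definition ffall :: "nat \<Rightarrow> nat \<Rightarrow> complex" where
  "ffall p r = (if r \<le> p then fact p / fact (p - r) else 0)"

lemma ffall_diff: "ffall (Suc p) (Suc r) - ffall p (Suc r) = of_nat (Suc r) * ffall p r"
proof (cases "Suc r \<le> p")
  case True
  then obtain d where "p = Suc r + d" by (auto simp: le_iff_add)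
  then show ?thesis by (simp add: ffall_def divide_simps del: of_nat_Suc) (simp add: algebra_simps)
qed (auto simp: ffall_def not_le less_Suc_eq)

lemma ffall_mult: "r \<le> p \<Longrightarrow> ffall p r * ffall (p - r) s = ffall p (r + s)"
  by (auto simp: ffall_def add.commute)

text \<open>At \<open>m = - p - 1\<close> the recursion times p! reads
  \<open>D p - D (Suc p) = ffall p (N - 1) * D' (p - (N - 1))\<close>, where \<open>D'\<close>
  belongs to the previous exponent and the right side is 0 for p < N - 1. This sends falling
  factorials of order \<open>N i\<close> to order \<open>N i + N - 1\<close>, and summation leads to
  order \<open>N (i + 1)\<close>. Beyond the bound on \<open>p\<close> the operator has order below
  \<open>j\<close>.\<close>

lemma res_coeff_ffall:
  assumes j: "0 \<le> j" "j \<le> int N - 2"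
  shows "\<exists>a. \<forall>p. int p \<le> (int k + 1) * (int N - 1) - j - 1 \<longrightarrow>
    res_coeff N (int k + 1) (- int p - 1) j * fact p = (\<Sum>i\<le>k. a i * ffall p (N * i))"
proof (induction k)
  case 0
  define D where "D = (\<lambda>p. res_coeff N 1 (- int p - 1) j * fact p)"
  have "D p = D 0" if "int p \<le> int N - 1 - j - 1" for p
    using that
  proof (induction p)
    case (Suc p)
    have "res_coeff N 1 (- int p - 1) j - of_nat (Suc p) * res_coeff N 1 (- int (Suc p) - 1) j =
      res_coeff N 0 (int N - 2 - int p) j"
      using res_coeff_rec[of N 1 "- int p - 1" j] by (simp add: algebra_simps)
    from this[symmetric] have "D p - D (Suc p) = fact p * res_coeff N 0 (int N - 2 - int p) j"
      by (simp only: D_def fact_Suc) (simp add: algebra_simps)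
    \<comment> \<open>The inhomogeneity sits at \<open>p = N - 2 - j\<close>, exactly where the step
      would leave the admissible range.\<close>
    also have "\<dots> = 0" using Suc.prems by (simp add: res_coeff_0)
    finally show ?case using Suc by simp
  qed simp
  then show ?case
    by (intro exI[of _ "\<lambda>_. D 0"]) (simp add: D_def ffall_def)
next
  case (Suc k)
  then obtain a where a: "\<And>p. int p \<le> (int k + 1) * (int N - 1) - j - 1 \<Longrightarrow>
    res_coeff N (int k + 1) (- int p - 1) j * fact p = (\<Sum>i\<le>k. a i * ffall p (N * i))" by blast
  define D where "D = (\<lambda>p. res_coeff N (int k + 2) (- int p - 1) j * fact p)"
  \<comment> \<open>Summation by \<open>ffall_diff\<close>: order \<open>N - 1 + N i\<close> comes
    from order \<open>N (i + 1)\<close> divided by that number, negated because the difference is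
    \<open>D p - D (Suc p)\<close>. \<open>D 0\<close> is the constant of summation.\<close>
  define a' where "a' = (\<lambda>i. if i = 0 then D 0 else - a (i - 1) / of_nat (N * i))"
  define Q where "Q = (\<lambda>p. \<Sum>i\<le>Suc k. a' i * ffall p (N * i))"
  have N: "N \<ge> 2" using j by simp
  have Q: "Q p = D 0 + (\<Sum>i\<le>k. a' (Suc i) * ffall p (N * Suc i))" for p
    unfolding Q_def by (subst sum.atMost_Suc_shift) (simp add: a'_def ffall_def)
  have step_Q: "Q p - Q (Suc p) = (\<Sum>i\<le>k. a i * ffall p (N - 1 + N * i))" for p
  proof -
    have "a' (Suc i) * ffall p (N * Suc i) - a' (Suc i) * ffall (Suc p) (N * Suc i) =
      a i * ffall p (N - 1 + N * i)" for i
    proof -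
      have e: "N * Suc i = Suc (N - 1 + N * i)" using N by simp
      have "a' (Suc i) * ffall p (N * Suc i) - a' (Suc i) * ffall (Suc p) (N * Suc i) =
        - a' (Suc i) * (ffall (Suc p) (N * Suc i) - ffall p (N * Suc i))" by (simp add: algebra_simps)
      also have "\<dots> = - a' (Suc i) * (of_nat (N * Suc i) * ffall p (N - 1 + N * i))"
        unfolding e ffall_diff by simp
      also have "\<dots> = a i * ffall p (N - 1 + N * i)"
      proof -
        have "of_nat (N * Suc i) \<noteq> (0 :: complex)"
          using N by (simp only: of_nat_eq_0_iff) simp
        moreover have "a' (Suc i) = - a i / of_nat (N * Suc i)" by (simp add: a'_def)
        ultimately show ?thesis by (simp only:) (simp del: of_nat_mult mult_Suc_right)
      qed
      finally show ?thesis .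
    qed
    then show ?thesis unfolding Q by (simp add: sum_subtractf[symmetric] del: mult_Suc_right)
  qed
  have step_D: "D p - D (Suc p) = (\<Sum>i\<le>k. a i * ffall p (N - 1 + N * i))"
    if p: "int (Suc p) \<le> (int k + 2) * (int N - 1) - j - 1" for p
  proof -
    have "res_coeff N (int k + 2) (- int p - 1) j -
        of_nat (Suc p) * res_coeff N (int k + 2) (- int (Suc p) - 1) j =
      res_coeff N (int k + 1) (int N - 2 - int p) j"
      using res_coeff_rec[of N "int k + 2" "- int p - 1" j] by (simp add: algebra_simps)
    from this[symmetric] have "D p - D (Suc p) = fact p * res_coeff N (int k + 1) (int N - 2 - int p) j"
      by (simp only: D_def fact_Suc) (simp add: algebra_simps)
    also have "\<dots> = (\<Sum>i\<le>k. a i * ffall p (N - 1 + N * i))"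
    proof (cases "p \<ge> N - 1")
      case True
      define r where "r = p - (N - 1)"
      have r: "p = r + (N - 1)" using True by (simp add: r_def)
      have "fact p * res_coeff N (int k + 1) (int N - 2 - int p) j =
        ffall p (N - 1) * (res_coeff N (int k + 1) (- int r - 1) j * fact r)"
      proof -
        have "int N - 2 - int p = - int r - 1" using N by (simp add: r)
        moreover have "fact p = ffall p (N - 1) * fact r" by (simp add: r ffall_def)
        ultimately show ?thesis by (simp only: mult_ac)
      qed
      also have "\<dots> = ffall p (N - 1) * (\<Sum>i\<le>k. a i * ffall r (N * i))"
        using p N by (subst a) (auto simp: r of_nat_diff algebra_simps)
      also have "\<dots> = (\<Sum>i\<le>k. a i * ffall p (N - 1 + N * i))"
        by (simp only: ffall_mult[OF True, symmetric] r_def sum_distrib_left mult.left_commute)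
      finally show ?thesis .
    next
      case False
      then have "res_coeff N (int k + 1) (int N - 2 - int p) j = 0"
      proof -
        have "int N - 2 - int p = int (N - 2 - p)" using False N by simp
        then show ?thesis
          using res_coeff_nonneg_eq_0[of j N k "N - 2 - p"] j N by (simp add: add.commute)
      qed
      moreover have "ffall p (N - 1 + r) = 0" for r
        using False unfolding ffall_def by (intro if_not_P) linarith
      ultimately show ?thesis by (simp only: mult_zero_right sum.neutral_const)
    qed
    finally show ?thesis .
  qed
  have "D p = Q p" if "int p \<le> (int k + 2) * (int N - 1) - j - 1" for p
    using that
  proof (induction p)
    case 0
    show ?case using N unfolding Q by (simp add: ffall_def)
  next
    case (Suc p)
    then show ?case using step_D[of p] step_Q[of p] by (simp add: algebra_simps)
  qed
  then show ?case
    by (intro exI[of _ a']) (auto simp: D_def Q_def add.commute)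
qed

text \<open>Leibniz' rule ends after two terms because \<open>x0\<close> has constant derivative;
  for negative \<open>m\<close> this is again checked one \<partial> at a time.\<close>

lemma Dpow_mult_shift:
  assumes Z: "ord_le b Z" and x0: "fps_deriv x0 = (1 :: complex fps)"
  shows "Dpow m (\<lambda>n. x0 * Z n) = (\<lambda>n. x0 * Dpow m Z n + of_int m * Dpow (m - 1) Z n)"
proof -
  let ?W = "\<lambda>m n. x0 * Dpow m Z n + of_int m * Dpow (m - 1) Z n"
  have Z': "ord_le b (\<lambda>n. x0 * Z n)" using Z by (auto simp: ord_le_def)
  have W: "ord_le (b + m) (?W m)" for m
    using ord_leD[OF ord_le_Dpow[OF Z]] by (auto simp: ord_le_def)
  have d: "fps_deriv (Dpow m Z n) = Dpow (m + 1) Z n - Dpow m Z (n - 1)" for m n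
    using fun_cong[OF Dleft_Dpow[OF Z, of m], of n] by (simp add: Dleft_def algebra_simps)
  have WD: "Dleft (?W m) = ?W (m + 1)" for m
    by (rule ext) (simp add: Dleft_def d x0 algebra_simps)
  show ?thesis
  proof (induction m rule: int_shift_induct)
    case 1
    then show ?case by (simp add: Dpow_0[OF Z'] Dpow_0[OF Z])
  next
    case (2 m)
    show ?case
      using Dleft_inj[OF ord_le_Dpow[OF Z'] W, of m m] Dleft_Dpow[OF Z', of m] WD[of m] by auto
  qed
qed

text \<open>Right multiplication by \<open>\<partial>\<^sup>-\<^sup>i\<^sup>-\<^sup>1\<close> moves
  the coefficient of \<open>\<partial>\<^sup>i\<close> into the residue. At a fixed point these
  coefficients obey the recursion of \<open>res_coeff\<close> with an extra factor
  \<open>h = x - y\<close>, which homogeneity absorbs into a power of \<open>h\<close>.\<close>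

lemma airy_residue:
  assumes N: "N \<ge> 1" and xy: "x \<noteq> y"
  shows "pdo_res (pdo_mult (pdo_D m) (pdo_mult
      (pdo_power (pdo_mult (pdo_fun (\<lambda>s. 1 / of_real (s - y))) (pdo_D (int N - 1))) k)
      (pdo_D (- i - 1)))) x =
    res_coeff N (int k) m i * of_real (x - y) powi (i - m - int k * int N)"
proof -
  define A where "A = - {y}"
  have A: "open A" and x: "x \<in> A" using xy by (auto simp: A_def)
  define f :: "real \<Rightarrow> complex" where "f = (\<lambda>s. 1 / of_real (s - y))"
  define R where "R = pdo_mult (pdo_fun f) (pdo_D (int N - 1))"
  define h where "h = (of_real (x - y) :: complex)"
  have h: "h \<noteq> 0" using xy by (simp add: h_def)
  have f: "smooth1 A f"
    using smooth1_shift_powi[OF A, of y "- 1"] by (simp add: A_def f_def field_simps)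
  define x0 where "x0 = jet x (\<lambda>s. of_real (s - y))"
  have x0: "fps_deriv x0 = 1" "x0 $ 0 = h" by (simp_all add: x0_def jet_shift h_def del: of_real_diff)
  have "x0 * jet x f = jet x (\<lambda>s. of_real (s - y) * f s)"
    unfolding x0_def by (rule jet_mult[OF A smooth1_shift[OF A] f x, symmetric])
  also have "\<dots> = jet x (\<lambda>_. 1)"
    by (rule jet_cong[OF A smooth1_const[OF A] _ x]) (auto simp: f_def A_def)
  finally have x0f: "x0 * jet x f = 1" by (simp add: jet_const)
  note sf = smooth_pdo_fun[OF f A] and sD = smooth_pdo_D[OF A, of "int N - 1"]
  have sR: "smooth_pdo A (int N - 1) R"
    using smooth_pdo_mult[OF A sf sD] by (simp add: R_def)
  have sP: "smooth_pdo A (int k * (int N - 1)) (pdo_power R k)" for k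
  proof (induction k)
    case (Suc k)
    from smooth_pdo_mult[OF A sR Suc] show ?case by (simp add: algebra_simps)
  qed (simp add: smooth_pdo_D[OF A])
  define P where "P = (\<lambda>k. pdo_jet x (pdo_power R k))"
  have oP: "ord_le (int k * (int N - 1)) (P k)" for k
    unfolding P_def by (rule ord_le_pdo_jet[OF sP])
  have P0: "P 0 = fpdo_D 0" by (simp add: P_def pdo_jet_D[OF A])
  \<comment> \<open>Multiplying by the jet of x - y avoids expanding its reciprocal.\<close>
  have PS: "(\<lambda>n. x0 * P (Suc k) n) = Dpow (int N - 1) (P k)" for k
  proof
    fix n
    have "P (Suc k) = fmul (fmul (fpdo_fun (jet x f)) (fpdo_D (int N - 1))) (P k)"
      by (simp add: P_def pdo_jet_mult[OF A sR sP x])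
        (simp add: R_def pdo_jet_mult[OF A sf sD x] pdo_jet_fun[OF f A] pdo_jet_D[OF A])
    also have "\<dots> = fmul (fpdo_fun (jet x f)) (fmul (fpdo_D (int N - 1)) (P k))"
      by (rule fmul_assoc[OF ord_le_fpdo_fun ord_le_fpdo_D oP])
    finally have "P (Suc k) n = jet x f * Dpow (int N - 1) (P k) n"
      using fmul_fpdo_fun[OF ord_le_fmul[OF ord_le_fpdo_D oP]] by (simp add: fmul_fpdo_D)
    then show "x0 * P (Suc k) n = Dpow (int N - 1) (P k) n"
      by (simp add: mult.assoc[symmetric] x0f)
  qed
  define \<rho> where "\<rho> = (\<lambda>k m. Dpow m (P k) i $ 0)"
  have \<rho>_rec: "h * \<rho> (Suc k) m + of_int m * \<rho> (Suc k) (m - 1) = \<rho> k (m + int N - 1)" for k m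
  proof -
    have "Dpow m (\<lambda>n. x0 * P (Suc k) n) i = x0 * Dpow m (P (Suc k)) i + of_int m * Dpow (m - 1) (P (Suc k)) i"
      by (simp only: Dpow_mult_shift[OF oP x0(1)])
    moreover have "Dpow m (\<lambda>n. x0 * P (Suc k) n) = Dpow (m + int N - 1) (P k)"
      by (simp only: PS Dpow_Dpow[OF oP]) (simp add: algebra_simps)
    ultimately have "Dpow (m + int N - 1) (P k) i $ 0 =
      (x0 * Dpow m (P (Suc k)) i + of_int m * Dpow (m - 1) (P (Suc k)) i) $ 0" by simp
    then show ?thesis by (simp add: \<rho>_def x0(2) fps_of_int[symmetric])
  qed
  have \<rho>_low: "\<rho> k m = 0" if "m + int k * (int N - 1) < i" for k m
    using ord_leD[OF ord_le_Dpow[OF oP], of k m i] that by (simp add: \<rho>_def)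
  have \<rho>: "\<rho> k m = res_coeff N (int k) m i * h powi (i - m - int k * int N)" for k m
  proof (induction k arbitrary: m)
    case 0
    then show ?case
      by (simp add: \<rho>_def P0 Dpow_fpdo_D res_coeff_0) (simp add: fpdo_D_def)
  next
    case (Suc k)
    define E where "E = (\<lambda>m. res_coeff N (int (Suc k)) m i * h powi (i - m - int (Suc k) * int N))"
    have E_rec: "h * E m + of_int m * E (m - 1) = \<rho> k (m + int N - 1)" for m
    proof -
      let ?e = "i - m - int (Suc k) * int N"
      have "h * E m + of_int m * E (m - 1) =
        (res_coeff N (int (Suc k)) m i + of_int m * res_coeff N (int (Suc k)) (m - 1) i) * h powi (?e + 1)"
      proof -
        have "i - (m - 1) - int (Suc k) * int N = ?e + 1" by simp
        moreover have "h powi (?e + 1) = h powi ?e * h" using h by (simp add: power_int_add_1)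
        ultimately show ?thesis unfolding E_def by (simp only:) (simp only: distrib_right distrib_left mult_ac)
      qed
      also have "\<dots> = \<rho> k (m + int N - 1)"
        unfolding res_coeff_rec Suc by (simp add: algebra_simps)
      finally show ?thesis .
    qed
    let ?M = "i - int (Suc k) * (int N - 1)"
    have low: "\<rho> (Suc k) m = E m" if "m < ?M" for m
      using that \<rho>_low[of m "Suc k"] by (simp add: E_def res_coeff_eq_0)
    define M where "M = ?M"
    \<comment> \<open>As \<open>h\<close> is not 0, the recursion determines the value at
      \<open>m\<close> from the one at \<open>m - 1\<close>; the start lies below the order
      bound.\<close>
    have up: "\<rho> (Suc k) (M - 1 + int n) = E (M - 1 + int n)" for n
    proof (induction n)
      case (Suc n)
      have e: "M + int n - 1 = M - 1 + int n" "M - 1 + int (Suc n) = M + int n" by simp_all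
      have "h * \<rho> (Suc k) (M + int n) = h * E (M + int n)"
        using \<rho>_rec[of k "M + int n"] E_rec[of "M + int n"] unfolding e Suc
        by (metis add_right_cancel)
      then show ?case using h unfolding e by simp
    qed (use low[of "M - 1"] in \<open>simp add: M_def\<close>)
    from up[of "nat (m - M + 1)"] low[of m] have "\<rho> (Suc k) m = E m"
      by (cases "m < M") (auto simp: M_def simp del: of_nat_Suc)
    then show ?case by (simp add: E_def)
  qed
  have "pdo_res (pdo_mult (pdo_D m) (pdo_mult (pdo_power R k) (pdo_D (- i - 1)))) x =
    pdo_jet x (pdo_mult (pdo_D m) (pdo_mult (pdo_power R k) (pdo_D (- i - 1)))) (- 1) $ 0"
    by (simp add: pdo_res_def pdo_jet_nth_0)
  also have "pdo_jet x (pdo_mult (pdo_D m) (pdo_mult (pdo_power R k) (pdo_D (- i - 1)))) =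
    fmul (fpdo_D m) (fmul (P k) (fpdo_D (- i - 1)))"
    by (simp add: pdo_jet_mult[OF A smooth_pdo_D[OF A] smooth_pdo_mult[OF A sP smooth_pdo_D[OF A]] x]
       pdo_jet_mult[OF A sP smooth_pdo_D[OF A] x] pdo_jet_D[OF A] P_def)
  also have "\<dots> = fmul (fmul (fpdo_D m) (P k)) (fpdo_D (- i - 1))"
    by (rule fmul_assoc[OF ord_le_fpdo_D oP ord_le_fpdo_D, symmetric])
  also have "\<dots> (- 1) $ 0 = \<rho> k m"
    by (simp add: fmul_fpdo_D_right[OF ord_le_fmul[OF ord_le_fpdo_D oP]] fmul_fpdo_D \<rho>_def)
  finally show ?thesis by (simp add: \<rho> R_def f_def h_def)
qed

section \<open>Formal solutions of the heat equation\<close>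

text \<open>The symbols \<open>E\<^sub>j t\<^sup>k\<close>, \<open>0 \<le> j \<le> N - 2\<close>, are numbered by \<open>p = (N - 1) k - j\<close>; then
  \<open>\<partial>\<close> couples only \<open>p\<close> and \<open>p + 1\<close>.\<close>

definition airy_j :: "nat \<Rightarrow> int \<Rightarrow> int" where
  "airy_j N p = (- p) mod (int N - 1)"

definition airy_k :: "nat \<Rightarrow> int \<Rightarrow> int" where
  "airy_k N p = - ((- p) div (int N - 1))"

definition heat_seq :: "nat \<Rightarrow> heat_exp \<Rightarrow> real \<Rightarrow> int \<Rightarrow> real \<Rightarrow> complex" where
  "heat_seq N F y p x = F (nat (airy_j N p)) (airy_k N p) x y"

text \<open>The factor with which \<partial> carries symbol \<open>p + 1\<close> into symbol
  \<open>p\<close>. It differs from 1 only where \<open>E\<^sub>N\<^sub>-\<^sub>1\<close> is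
  eliminated in favour of \<open>E\<^sub>0\<close>, which also lowers \<open>k\<close>.\<close>

definition airy_mult :: "nat \<Rightarrow> real \<Rightarrow> real \<Rightarrow> int \<Rightarrow> real \<Rightarrow> complex" where
  "airy_mult N \<kappa> y p x = (if airy_j N p = 0 then - of_real (\<kappa> / real N * (x - y)) else 1)"

definition seq_dx :: "nat \<Rightarrow> real \<Rightarrow> real \<Rightarrow> (int \<Rightarrow> real \<Rightarrow> complex) \<Rightarrow> int \<Rightarrow> real \<Rightarrow> complex" where
  "seq_dx N \<kappa> y f = (\<lambda>p x. vderiv (f p) x + airy_mult N \<kappa> y p x * f (p + 1) x)"

definition seq_dt :: "nat \<Rightarrow> real \<Rightarrow> real \<Rightarrow> (int \<Rightarrow> real \<Rightarrow> complex) \<Rightarrow> int \<Rightarrow> real \<Rightarrow> complex" where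
  "seq_dt N \<kappa> y f = (\<lambda>p x.
     of_real (of_int (airy_k N p + 1) - (of_int (airy_j N p) + 1) / real N) * f (p + int N - 1) x
     - of_real ((x - y) / real N) * (airy_mult N \<kappa> y p x * f (p + int N) x))"

lemma
  assumes "N \<ge> 2" "0 \<le> j" "j \<le> int N - 2"
  shows airy_j_index: "airy_j N ((int N - 1) * k - j) = j"
    and airy_k_index: "airy_k N ((int N - 1) * k - j) = k"
proof -
  have "- ((int N - 1) * k - j) = j + (int N - 1) * (- k)" by simp
  then show "airy_j N ((int N - 1) * k - j) = j" "airy_k N ((int N - 1) * k - j) = k"
    unfolding airy_j_def airy_k_def using assms
    by (simp_all only: mod_mult_self2 div_mult_self2) simp_all
qed

lemma airy_index:
  assumes "N \<ge> 2"
  shows "p = (int N - 1) * airy_k N p - airy_j N p" "0 \<le> airy_j N p" "airy_j N p \<le> int N - 2"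
proof -
  have "(- p) div (int N - 1) * (int N - 1) + (- p) mod (int N - 1) = - p"
    by (rule div_mult_mod_eq)
  then show "p = (int N - 1) * airy_k N p - airy_j N p"
    unfolding airy_j_def airy_k_def by (simp add: algebra_simps)
  show "0 \<le> airy_j N p" "airy_j N p \<le> int N - 2"
    unfolding airy_j_def using assms pos_mod_bound[of "int N - 1" "- p"] pos_mod_sign[of "int N - 1" "- p"]
    by linarith+
qed

lemma airy_index_Suc:
  assumes "N \<ge> 2"
  shows "airy_j N (p + 1) = (if airy_j N p = 0 then int N - 2 else airy_j N p - 1)"
    and "airy_k N (p + 1) = (if airy_j N p = 0 then airy_k N p + 1 else airy_k N p)"
proof -
  let ?j = "airy_j N p" and ?k = "airy_k N p"
  have p: "p = (int N - 1) * ?k - ?j" "0 \<le> ?j" "?j \<le> int N - 2" using airy_index[OF assms] by auto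
  have 1: "p + 1 = (int N - 1) * (?k + 1) - (int N - 2)" if "?j = 0"
    using p(1) that by (simp add: algebra_simps)
  have 2: "p + 1 = (int N - 1) * ?k - (?j - 1)"
    using p(1) by simp
  have "airy_j N (p + 1) = int N - 2" "airy_k N (p + 1) = ?k + 1" if "?j = 0"
    unfolding 1[OF that] by (rule airy_j_index airy_k_index; use assms in simp)+
  moreover have "airy_j N (p + 1) = ?j - 1" "airy_k N (p + 1) = ?k" if "?j \<noteq> 0"
    unfolding 2 by (rule airy_j_index airy_k_index; use assms that p(2,3) in simp)+
  ultimately show "airy_j N (p + 1) = (if ?j = 0 then int N - 2 else ?j - 1)"
    "airy_k N (p + 1) = (if ?j = 0 then ?k + 1 else ?k)" by auto
qed

lemma airy_index_period:
  assumes "N \<ge> 2"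
  shows "airy_j N (p + int N - 1) = airy_j N p" "airy_k N (p + int N - 1) = airy_k N p + 1"
proof -
  have *: "p + int N - 1 = (int N - 1) * (airy_k N p + 1) - airy_j N p"
    using airy_index(1)[OF assms, of p] by (simp add: algebra_simps)
  show "airy_j N (p + int N - 1) = airy_j N p" "airy_k N (p + int N - 1) = airy_k N p + 1"
    unfolding * by (rule airy_j_index airy_k_index; use assms airy_index[OF assms] in auto)+
qed

lemma heat_seq_index:
  assumes "N \<ge> 2" "j \<le> N - 2"
  shows "heat_seq N F y ((int N - 1) * k - int j) x = F j k x y"
  using assms airy_j_index[of N "int j" k] airy_k_index[of N "int j" k]
  by (simp add: heat_seq_def)

lemma heat_seq_raise:
  assumes N: "N \<ge> 2"
  shows "hexp_raise N \<kappa> F (nat (airy_j N p)) (airy_k N p) x y =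
    airy_mult N \<kappa> y p x * heat_seq N F y (p + 1) x"
proof -
  have "nat (airy_j N p - 1) = nat (airy_j N p) - 1" by simp
  then show ?thesis
    using airy_index(2)[OF N, of p] N
    by (auto simp: hexp_raise_def heat_seq_def airy_mult_def airy_index_Suc[OF N] nat_diff_distrib)
qed

lemma heat_seq_dx:
  assumes N: "N \<ge> 2"
  shows "heat_seq N (hexp_dx N \<kappa> F) y = seq_dx N \<kappa> y (heat_seq N F y)"
  unfolding heat_seq_def[of N "hexp_dx N \<kappa> F", abs_def]
  by (simp add: hexp_dx_def seq_dx_def heat_seq_raise[OF N]) (simp add: heat_seq_def[abs_def])

lemma heat_seq_dx_funpow:
  "N \<ge> 2 \<Longrightarrow> heat_seq N ((hexp_dx N \<kappa> ^^ i) F) y = (seq_dx N \<kappa> y ^^ i) (heat_seq N F y)"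
  by (induction i) (simp_all add: heat_seq_dx)

lemma heat_seq_dt:
  assumes N: "N \<ge> 2"
  shows "heat_seq N (hexp_dt N \<kappa> F) y p x = seq_dt N \<kappa> y (heat_seq N F y) p x"
proof -
  have "airy_mult N \<kappa> y (p + int N - 1) x = airy_mult N \<kappa> y p x"
    by (simp add: airy_mult_def airy_index_period[OF N])
  then have "hexp_raise N \<kappa> F (nat (airy_j N p)) (airy_k N p + 1) x y =
    airy_mult N \<kappa> y p x * heat_seq N F y (p + int N) x"
    using heat_seq_raise[OF N, of \<kappa> F "p + int N - 1" x y] by (simp add: airy_index_period[OF N])
  moreover have "heat_seq N F y (p + int N - 1) x = F (nat (airy_j N p)) (airy_k N p + 1) x y"
    by (simp add: heat_seq_def airy_index_period[OF N])
  ultimately show ?thesis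
    using airy_index(2)[OF N, of p]
    unfolding heat_seq_def[of N "hexp_dt N \<kappa> F"] by (simp add: hexp_dt_def seq_dt_def)
qed

text \<open>The expansion of \<open>E\<^sub>m\<close>, \<open>m \<in> \<int>\<close>, in the symbols \<open>E\<^sub>j t\<^sup>k\<close>.\<close>

definition airy_seq :: "nat \<Rightarrow> real \<Rightarrow> real \<Rightarrow> int \<Rightarrow> int \<Rightarrow> real \<Rightarrow> complex" where
  "airy_seq N \<kappa> y m p x = of_real (- \<kappa> * real N) powi airy_k N p *
     res_coeff N (airy_k N p) m (airy_j N p) *
     of_real (x - y) powi (airy_j N p - m - airy_k N p * int N)"

text \<open>The order bound of \<open>res_coeff\<close> in terms of \<open>p\<close>: the expansion
  of \<open>E\<^sub>m\<close> starts at symbol \<open>- m\<close>, so an expansion bounded above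
  contributes only finitely many terms to each symbol.\<close>

lemma airy_seq_eq_0:
  assumes "N \<ge> 2" "m < - p"
  shows "airy_seq N \<kappa> y m p x = 0"
  using airy_index(1)[OF assms(1), of p] assms(2)
  by (simp add: airy_seq_def res_coeff_eq_0 mult.commute)

lemma smooth1_airy_seq: "open A \<Longrightarrow> y \<notin> A \<Longrightarrow> smooth1 A (airy_seq N \<kappa> y m p)"
  unfolding airy_seq_def[abs_def] by (intro smooth1_cmult smooth1_shift_powi)

lemma vderiv_airy_seq:
  assumes "x \<noteq> y"
  shows "vderiv (airy_seq N \<kappa> y m p) x = of_real (- \<kappa> * real N) powi airy_k N p *
     res_coeff N (airy_k N p) m (airy_j N p) *
     (of_int (airy_j N p - m - airy_k N p * int N) *
      of_real (x - y) powi (airy_j N p - m - airy_k N p * int N - 1))"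
  unfolding vderiv_def airy_seq_def[abs_def]
  by (intro vector_derivative_at has_vector_derivative_mult_right has_vector_derivative_shift_powi assms)

text \<open>For positive \<open>j\<close> this is \<open>res_coeff_deriv\<close>. At
  \<open>j = 0\<close> the eliminated \<open>E\<^sub>N\<^sub>-\<^sub>1\<close> enters from the next
  power of \<open>t\<close>, and \<open>res_coeff_wrap\<close> identifies its coefficient with the
  one of index - 1 that the formula demands.\<close>

lemma seq_dx_airy_seq:
  assumes N: "N \<ge> 2" and \<kappa>: "\<kappa>\<^sup>2 = 1" and xy: "x \<noteq> y"
  shows "vderiv (airy_seq N \<kappa> y m p) x + airy_mult N \<kappa> y p x * airy_seq N \<kappa> y m (p + 1) x =
    airy_seq N \<kappa> y (m + 1) p x"
proof -
  define j k where "j = airy_j N p" and "k = airy_k N p"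
  define h c where "h = (of_real (x - y) :: complex)" and "c = (of_real (- \<kappa> * real N) :: complex)"
  have h: "h \<noteq> 0" and c: "c \<noteq> 0" using xy N \<kappa> by (auto simp: h_def c_def)
  \<comment> \<open>By \<open>\<kappa>\<^sup>2 = 1\<close> the factor of the elimination cancels one
    power of \<open>- \<kappa> N\<close>.\<close>
  have hc: "- of_real (\<kappa> / real N * (x - y)) * c = h"
  proof -
    have "- (\<kappa> / real N * (x - y)) * (- \<kappa> * real N) = \<kappa>\<^sup>2 * (x - y)"
      using N by (simp add: field_simps power2_eq_square)
    then have "- (\<kappa> / real N * (x - y)) * (- \<kappa> * real N) = x - y" by (simp add: \<kappa>)
    then show ?thesis unfolding h_def c_def
      by (metis of_real_minus of_real_mult)
  qed
  have 1: "airy_mult N \<kappa> y p x * airy_seq N \<kappa> y m (p + 1) x =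
    c powi k * res_coeff N k m (j - 1) * h powi (j - m - k * int N - 1)"
  proof (cases "j = 0")
    case True
    define e where "e = int N - 2 - m - (k + 1) * int N"
    have e: "e + 1 = j - m - k * int N - 1" using True by (simp add: e_def algebra_simps)
    have "airy_mult N \<kappa> y p x * airy_seq N \<kappa> y m (p + 1) x =
      - of_real (\<kappa> / real N * (x - y)) *
      (c powi (k + 1) * res_coeff N (k + 1) m (int N - 2) * h powi e)"
      using True by (simp add: airy_mult_def airy_seq_def airy_index_Suc[OF N] j_def k_def h_def c_def e_def)
    also have "\<dots> = (- of_real (\<kappa> / real N * (x - y)) * c) *
      (c powi k * res_coeff N k m (- 1) * h powi e)"
      using c by (simp only: res_coeff_wrap) (simp add: power_int_add_1)
    also have "\<dots> = c powi k * res_coeff N k m (- 1) * h powi (e + 1)"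
      unfolding hc using h by (simp add: power_int_add_1)
    finally show ?thesis unfolding e using True by simp
  next
    case False
    have e: "j - 1 - m - k * int N = j - m - k * int N - 1" by simp
    show ?thesis
      using False
      unfolding airy_mult_def airy_seq_def airy_index_Suc[OF N] j_def[symmetric] k_def[symmetric]
        h_def[symmetric] c_def[symmetric]
      by (simp add: e)
  qed
  have "vderiv (airy_seq N \<kappa> y m p) x + airy_mult N \<kappa> y p x * airy_seq N \<kappa> y m (p + 1) x =
    c powi k * (of_int (j - m - k * int N) * res_coeff N k m j + res_coeff N k m (j - 1)) *
      h powi (j - m - k * int N - 1)"
    unfolding 1 vderiv_airy_seq[OF xy] by (simp add: j_def k_def h_def c_def algebra_simps)
  also have "\<dots> = airy_seq N \<kappa> y (m + 1) p x"
    unfolding res_coeff_deriv[symmetric]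
    by (simp add: airy_seq_def j_def k_def h_def c_def algebra_simps)
  finally show ?thesis .
qed

lemma seq_dt_airy_seq:
  assumes N: "N \<ge> 2" and \<kappa>: "\<kappa>\<^sup>2 = 1" and xy: "x \<noteq> y"
  shows "seq_dt N \<kappa> y (airy_seq N \<kappa> y m) p x = of_real \<kappa> * airy_seq N \<kappa> y (m + int N) p x"
proof -
  define j k where "j = airy_j N p" and "k = airy_k N p"
  define h c where "h = (of_real (x - y) :: complex)" and "c = (of_real (- \<kappa> * real N) :: complex)"
  have h: "h \<noteq> 0" and c: "c \<noteq> 0" using xy N \<kappa> by (auto simp: h_def c_def)
  define C where "C = (\<lambda>m. res_coeff N (k + 1) m j)"
  define e where "e = j - m - (k + 1) * int N"
  have "airy_mult N \<kappa> y (p + int N - 1) x = airy_mult N \<kappa> y p x"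
    by (simp add: airy_mult_def airy_index_period[OF N])
  then have 1: "airy_mult N \<kappa> y p x * airy_seq N \<kappa> y m (p + int N) x =
    airy_seq N \<kappa> y (m + 1) (p + int N - 1) x - vderiv (airy_seq N \<kappa> y m (p + int N - 1)) x"
    using seq_dx_airy_seq[OF N \<kappa> xy, of m "p + int N - 1"] by (simp add: algebra_simps)
  have 2: "airy_seq N \<kappa> y m (p + int N - 1) x = c powi (k + 1) * C m * h powi e"
    "airy_seq N \<kappa> y (m + 1) (p + int N - 1) x = c powi (k + 1) * C (m + 1) * h powi (e - 1)"
    by (simp_all add: airy_seq_def airy_index_period[OF N] j_def k_def h_def c_def C_def e_def algebra_simps)
  have 3: "vderiv (airy_seq N \<kappa> y m (p + int N - 1)) x = c powi (k + 1) * C m * (of_int e * h powi (e - 1))"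
    by (simp add: vderiv_airy_seq[OF xy] airy_index_period[OF N] j_def k_def h_def c_def C_def e_def)
  have he: "h powi e = h * h powi (e - 1)"
    using h power_int_add_1[of h "e - 1"] by (simp add: mult.commute)
  have "of_nat N * seq_dt N \<kappa> y (airy_seq N \<kappa> y m) p x =
    (of_nat N * of_int (k + 1) - (of_int j + 1)) * (c powi (k + 1) * C m * h powi e) -
    h * (c powi (k + 1) * C (m + 1) * h powi (e - 1) - c powi (k + 1) * C m * (of_int e * h powi (e - 1)))"
    unfolding seq_dt_def 1 unfolding 2 3 using N
    by (simp add: j_def[symmetric] k_def[symmetric] h_def field_simps)
  \<comment> \<open>The explicit numbers combine to \<open>N (k + 1) - j - 1 + e = - m - 1\<close>,
    which leaves the left side of \<open>res_coeff_rec\<close> at \<open>m + 1\<close>.\<close>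
  also have "\<dots> = - (c powi (k + 1)) * h powi e * (C (m + 1) + of_int (m + 1) * C m)"
    unfolding he by (simp add: e_def algebra_simps)
  also have "C (m + 1) + of_int (m + 1) * C m = res_coeff N k (m + int N) j"
    unfolding C_def using res_coeff_rec[of N "k + 1" "m + 1" j] by (simp add: add.commute)
  also have "- (c powi (k + 1)) = of_nat N * of_real \<kappa> * c powi k"
    using c by (simp add: power_int_add_1) (simp add: c_def mult_ac)
  also have "of_nat N * of_real \<kappa> * c powi k * h powi e * res_coeff N k (m + int N) j =
    of_nat N * (of_real \<kappa> * airy_seq N \<kappa> y (m + int N) p x)"
    by (simp add: airy_seq_def j_def k_def h_def c_def e_def algebra_simps)
  finally show ?thesis using N by simp
qed

text \<open>\<open>\<Sum>m\<le>a. W\<^sub>m E\<^sub>m\<close>\<close>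

definition airy_expand :: "nat \<Rightarrow> real \<Rightarrow> real \<Rightarrow> int \<Rightarrow> pdo \<Rightarrow> int \<Rightarrow> real \<Rightarrow> complex" where
  "airy_expand N \<kappa> y a W p x = (\<Sum>m=- p..a. W m x * airy_seq N \<kappa> y m p x)"

lemma airy_expand_eq:
  assumes "N \<ge> 2" "smooth_pdo A a W" "lo \<le> - p" "a \<le> hi"
  shows "airy_expand N \<kappa> y a W p x = (\<Sum>m=lo..hi. W m x * airy_seq N \<kappa> y m p x)"
  unfolding airy_expand_def
  using assms airy_seq_eq_0[OF assms(1), of _ p \<kappa> y x]
  by (intro sum.mono_neutral_left) (auto simp: smooth_pdo_def)

lemma smooth1_airy_expand:
  assumes A: "open A" "y \<notin> A" and W: "smooth_pdo A a W"
  shows "smooth1 A (airy_expand N \<kappa> y a W p)"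
  unfolding airy_expand_def[abs_def]
  using W by (intro smooth1_sum smooth1_mult smooth1_airy_seq A) (auto simp: smooth_pdo_def)

text \<open>The product rule for \<open>W\<^sub>m E\<^sub>m\<close> has the same shape as the rule
  for \<open>\<partial> \<cdot> W\<^sub>m \<partial>\<^sup>m\<close>; thus \<partial> acts on
  expansions through its action on \<open>W\<close>.\<close>

lemma seq_dx_airy_expand:
  assumes N: "N \<ge> 2" and \<kappa>: "\<kappa>\<^sup>2 = 1" and A: "open A" "y \<notin> A" and W: "smooth_pdo A a W" and x: "x \<in> A"
  shows "seq_dx N \<kappa> y (airy_expand N \<kappa> y a W) p x = airy_expand N \<kappa> y (a + 1) (pdo_Dleft W) p x"
proof -
  have xy: "x \<noteq> y" using A x by auto
  let ?G = "\<lambda>m p. airy_seq N \<kappa> y m p" and ?I = "{- p - 1..a}"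
  have W1: "smooth1 A (W m)" for m using W by (auto simp: smooth_pdo_def)
  have e: "airy_expand N \<kappa> y a W p = (\<lambda>x. \<Sum>m\<in>?I. W m x * ?G m p x)"
    by (rule ext, rule airy_expand_eq[OF N W]) auto
  have "((\<lambda>x. \<Sum>m\<in>?I. W m x * ?G m p x) has_vector_derivative
    (\<Sum>m\<in>?I. W m x * vderiv (?G m p) x + vderiv (W m) x * ?G m p x)) (at x)"
    by (intro has_vector_derivative_sum has_vector_derivative_mult smooth1D0[OF W1 x]
        smooth1D0[OF smooth1_airy_seq[OF A] x])
  then have 1: "vderiv (airy_expand N \<kappa> y a W p) x =
     (\<Sum>m\<in>?I. W m x * vderiv (?G m p) x + vderiv (W m) x * ?G m p x)"
    unfolding e vderiv_def by (rule vector_derivative_at)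
  have 2: "airy_expand N \<kappa> y a W (p + 1) x = (\<Sum>m\<in>?I. W m x * ?G m (p + 1) x)"
    by (rule airy_expand_eq[OF N W]) auto
  have "seq_dx N \<kappa> y (airy_expand N \<kappa> y a W) p x =
    (\<Sum>m\<in>?I. W m x * (vderiv (?G m p) x + airy_mult N \<kappa> y p x * ?G m (p + 1) x) + vderiv (W m) x * ?G m p x)"
    unfolding seq_dx_def 1 2 by (simp add: sum_distrib_left sum.distrib[symmetric] algebra_simps)
  also have "\<dots> = (\<Sum>m\<in>?I. W m x * ?G (m + 1) p x) + (\<Sum>m\<in>?I. vderiv (W m) x * ?G m p x)"
    unfolding seq_dx_airy_seq[OF N \<kappa> xy] sum.distrib ..
  also have "(\<Sum>m\<in>?I. W m x * ?G (m + 1) p x) = (\<Sum>m=- p..a + 1. W (m - 1) x * ?G m p x)"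
    by (rule sum.reindex_bij_witness[of _ "\<lambda>m. m - 1" "\<lambda>m. m + 1"]) auto
  also have "(\<Sum>m\<in>?I. vderiv (W m) x * ?G m p x) = (\<Sum>m=- p..a + 1. vderiv (W m) x * ?G m p x)"
  proof (rule sum.mono_neutral_cong)
    fix m assume "m \<in> {- p..a + 1} - ?I"
    then have "W m = (\<lambda>_. 0)" using W by (auto simp: smooth_pdo_def)
    then show "vderiv (W m) x * ?G m p x = 0" using vderiv_const[of 1 0] by simp
  next
    fix m assume "m \<in> ?I - {- p..a + 1}"
    then show "vderiv (W m) x * ?G m p x = 0" by (subst airy_seq_eq_0[OF N]) auto
  qed auto
  also have "(\<Sum>m=- p..a + 1. W (m - 1) x * ?G m p x) + (\<Sum>m=- p..a + 1. vderiv (W m) x * ?G m p x) =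
    airy_expand N \<kappa> y (a + 1) (pdo_Dleft W) p x"
    by (simp add: airy_expand_def pdo_Dleft_def sum.distrib[symmetric] algebra_simps)
  finally show ?thesis .
qed

lemma vderiv_cong:
  assumes "open A" "x \<in> A" "\<And>x. x \<in> A \<Longrightarrow> f x = g x"
  shows "vderiv f x = vderiv g x"
  unfolding vderiv_def
  using eventually_nhds_in_open[OF assms(1,2)] assms(3)
  by (intro vector_derivative_cong_eq) (auto elim: eventually_mono)

lemma seq_dx_cong:
  assumes "open A" "x \<in> A" "\<And>p x. x \<in> A \<Longrightarrow> f p x = g p x"
  shows "seq_dx N \<kappa> y f p x = seq_dx N \<kappa> y g p x"
  unfolding seq_dx_def using assms(2,3) vderiv_cong[OF assms(1,2), of "f p" "g p"] by simp

lemma seq_dx_funpow_airy_expand: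
  assumes N: "N \<ge> 2" and \<kappa>: "\<kappa>\<^sup>2 = 1" and A: "open A" "y \<notin> A" and W: "smooth_pdo A a W"
  shows "x \<in> A \<Longrightarrow> (seq_dx N \<kappa> y ^^ i) (airy_expand N \<kappa> y a W) p x =
    airy_expand N \<kappa> y (a + int i) ((pdo_Dleft ^^ i) W) p x"
proof (induction i arbitrary: p x)
  case (Suc i)
  have "(seq_dx N \<kappa> y ^^ Suc i) (airy_expand N \<kappa> y a W) p x =
    seq_dx N \<kappa> y (airy_expand N \<kappa> y (a + int i) ((pdo_Dleft ^^ i) W)) p x"
    using seq_dx_cong[OF A(1) Suc.prems Suc.IH] by simp
  also have "\<dots> = airy_expand N \<kappa> y (a + int i + 1) (pdo_Dleft ((pdo_Dleft ^^ i) W)) p x"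
    by (rule seq_dx_airy_expand[OF N \<kappa> A smooth_pdo_Dleft_funpow[OF A(1) W] Suc.prems])
  finally show ?case by (simp add: algebra_simps)
qed simp

text \<open>By \<open>LW\<close> the operator turns the sum of the
  \<open>W\<^sub>m E\<^sub>m\<close> into that of the
  \<open>W\<^sub>m E\<^sub>m\<^sub>+\<^sub>N\<close>, and \<kappa> times
  \<open>E\<^sub>m\<^sub>+\<^sub>N\<close> is the derivative of \<open>E\<^sub>m\<close> in
  \<open>t\<close>.\<close>

lemma heat_equation_airy_expand:
  assumes N: "N \<ge> 2" and \<kappa>: "\<kappa>\<^sup>2 = 1" and A: "open A" "y \<notin> A" and W: "smooth_pdo A 0 W" and x: "x \<in> A"
    and LW: "\<And>m. (\<Sum>i\<le>N. l i * (pdo_Dleft ^^ i) W m x) = W (m - int N) x"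
  shows "seq_dt N \<kappa> y (airy_expand N \<kappa> y 0 W) p x =
    of_real \<kappa> * (\<Sum>i\<le>N. l i * (seq_dx N \<kappa> y ^^ i) (airy_expand N \<kappa> y 0 W) p x)"
proof -
  have xy: "x \<noteq> y" using A x by auto
  let ?G = "\<lambda>m p. airy_seq N \<kappa> y m p x"
  have "(\<Sum>i\<le>N. l i * (seq_dx N \<kappa> y ^^ i) (airy_expand N \<kappa> y 0 W) p x) =
    (\<Sum>i\<le>N. l i * (\<Sum>m=- p..int N. (pdo_Dleft ^^ i) W m x * ?G m p))"
    using airy_expand_eq[OF N smooth_pdo_Dleft_funpow[OF A(1) W], of "- p" p _ "int N"]
    by (simp add: seq_dx_funpow_airy_expand[OF N \<kappa> A W x])
  also have "\<dots> = (\<Sum>m=- p..int N. (\<Sum>i\<le>N. l i * (pdo_Dleft ^^ i) W m x) * ?G m p)"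
    by (simp add: sum_distrib_left sum_distrib_right mult.assoc) (rule sum.swap)
  also have "\<dots> = (\<Sum>m=- p - int N..0. W m x * ?G (m + int N) p)"
    unfolding LW by (rule sum.reindex_bij_witness[of _ "\<lambda>m. m + int N" "\<lambda>m. m - int N"]) auto
  finally have 1: "of_real \<kappa> * (\<Sum>i\<le>N. l i * (seq_dx N \<kappa> y ^^ i) (airy_expand N \<kappa> y 0 W) p x) =
    (\<Sum>m=- p - int N..0. W m x * seq_dt N \<kappa> y (airy_seq N \<kappa> y m) p x)"
    by (simp add: seq_dt_airy_seq[OF N \<kappa> xy] sum_distrib_left mult_ac)
  have 2: "airy_expand N \<kappa> y 0 W q x = (\<Sum>m=- p - int N..0. W m x * ?G m q)" if "q \<le> p + int N" for q
    using that by (intro airy_expand_eq[OF N W]) auto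
  have 3: "a * (\<Sum>m\<in>I. W m x * f m) - b * (c * (\<Sum>m\<in>I. W m x * g m)) =
    (\<Sum>m\<in>I. W m x * (a * f m - b * (c * g m)))" for a b c and f g :: "int \<Rightarrow> complex" and I
    by (simp add: sum_distrib_left right_diff_distrib sum_subtractf mult_ac)
  show ?thesis
    unfolding 1 seq_dt_def by (subst (1 2) 2; (rule 3)?; simp)
qed

section \<open>Uniqueness\<close>

lemma smooth1_power: "open A \<Longrightarrow> smooth1 A f \<Longrightarrow> smooth1 A (\<lambda>x. f x ^ n)"
  by (induction n) (auto intro: smooth1_const smooth1_mult)

lemma jet_power: "open A \<Longrightarrow> smooth1 A f \<Longrightarrow> x \<in> A \<Longrightarrow> jet x (\<lambda>x. f x ^ n) = jet x f ^ n"
  by (induction n) (simp_all add: jet_const jet_mult smooth1_power)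

text \<open>For complex values the mean value inequality replaces the mean value theorem: the bound
  on the derivative is integrated once for every order.\<close>

lemma peano_remainder:
  assumes A: "open A" "y \<in> A" and "smooth1 A r" and "\<And>l. l \<le> p \<Longrightarrow> (vderiv ^^ l) r y = 0" and "\<epsilon> > 0"
  shows "\<exists>\<delta>>0. \<forall>x. \<bar>x - y\<bar> < \<delta> \<longrightarrow> norm (r x) \<le> \<epsilon> * \<bar>x - y\<bar> ^ p"
  using assms(3-)
proof (induction p arbitrary: r)
  case 0
  have "isCont r y"
    using smooth1D0[OF 0(1) A(2)] by (rule has_vector_derivative_continuous)
  then obtain \<delta> where "\<delta> > 0" "\<And>x. norm (x - y) < \<delta> \<Longrightarrow> norm (r x - r y) < \<epsilon>"
    using 0(3) unfolding continuous_at_eps_delta dist_norm by blast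
  then show ?case using 0(2)[of 0] by (intro exI[of _ \<delta>]) (auto intro: less_imp_le)
next
  case (Suc p)
  have "(vderiv ^^ l) (vderiv r) y = 0" if "l \<le> p" for l
    using Suc.prems(2)[of "Suc l"] that by (simp add: funpow_swap1)
  from Suc.IH[OF smooth1_vderiv[of A r 1, simplified, OF Suc.prems(1)] this Suc.prems(3)]
  obtain \<delta> where \<delta>: "\<delta> > 0" "\<And>x. \<bar>x - y\<bar> < \<delta> \<Longrightarrow> norm (vderiv r x) \<le> \<epsilon> * \<bar>x - y\<bar> ^ p" by blast
  obtain \<eta> where \<eta>: "\<eta> > 0" "ball y \<eta> \<subseteq> A" using A open_contains_ball by blast
  show ?case
  proof (intro exI[of _ "min \<delta> \<eta>"] conjI allI impI)
    fix x assume x: "\<bar>x - y\<bar> < min \<delta> \<eta>"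
    let ?C = "cball y \<bar>x - y\<bar>"
    have z: "\<bar>z - y\<bar> \<le> \<bar>x - y\<bar>" "z \<in> A" "\<bar>z - y\<bar> < \<delta>" if "z \<in> ?C" for z
      using that x \<eta>(2) by (auto simp: dist_real_def subset_iff)
    have "norm (r x - r y) \<le> \<epsilon> * \<bar>x - y\<bar> ^ p * norm (x - y)"
    proof (rule differentiable_bound[where S = ?C and f' = "\<lambda>z h. h *\<^sub>R vderiv r z"])
      fix z assume zC: "z \<in> ?C"
      show "(r has_derivative (\<lambda>h. h *\<^sub>R vderiv r z)) (at z within ?C)"
        using smooth1D0[OF Suc.prems(1) z(2)[OF zC]]
        by (auto simp: has_vector_derivative_def intro: has_derivative_at_withinI)
      have "norm (vderiv r z) \<le> \<epsilon> * \<bar>z - y\<bar> ^ p" using \<delta>(2) z(3)[OF zC] by blast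
      also have "\<dots> \<le> \<epsilon> * \<bar>x - y\<bar> ^ p"
        using Suc.prems(3) z(1)[OF zC] by (intro mult_left_mono power_mono) auto
      finally have "norm (vderiv r z) \<le> \<epsilon> * \<bar>x - y\<bar> ^ p" .
      then show "onorm (\<lambda>h. h *\<^sub>R vderiv r z) \<le> \<epsilon> * \<bar>x - y\<bar> ^ p"
        by (intro onorm_le) (auto intro!: mult_left_mono simp: mult.commute)
    qed (auto simp: dist_real_def)
    then show "norm (r x) \<le> \<epsilon> * \<bar>x - y\<bar> ^ Suc p"
      using Suc.prems(2)[of 0] by (simp add: mult_ac)
  qed (use \<delta> \<eta> in auto)
qed

text \<open>Multiplying by a positive power of x - y sends the quotient to 0, so a finite limit
  forces the lowest coefficient to vanish; cancelling x - y then lowers \<open>p\<close>.\<close>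

lemma polynomial_quotient_limit:
  fixes a :: "nat \<Rightarrow> complex"
  assumes "at y within B \<noteq> bot"
    and "((\<lambda>x. (\<Sum>l\<le>p. a l * of_real (x - y) ^ l) / of_real (x - y) ^ p) \<longlongrightarrow> L) (at y within B)"
  shows "L = a p"
  using assms(2)
proof (induction p arbitrary: a)
  case 0
  then show ?case using assms(1) by (simp add: tendsto_const_iff)
next
  case (Suc p)
  let ?F = "at y within B" and ?h = "\<lambda>x. of_real (x - y) :: complex"
  let ?q = "\<lambda>x. \<Sum>l\<le>Suc p. a l * ?h x ^ l"
  have h: "(?h \<longlongrightarrow> 0) ?F"
    by (auto intro!: tendsto_eq_intros)
  have nz: "\<forall>\<^sub>F x in ?F. ?h x \<noteq> 0"
    by (auto simp: eventually_at intro!: exI[of _ 1])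
  have "((\<lambda>x. ?q x / ?h x ^ Suc p * ?h x ^ Suc p) \<longlongrightarrow> L * 0 ^ Suc p) ?F"
    by (intro tendsto_mult Suc.prems tendsto_power h)
  then have "((\<lambda>x. ?q x / ?h x ^ Suc p * ?h x ^ Suc p) \<longlongrightarrow> 0) ?F"
    unfolding power_0_Suc mult_zero_right .
  then have "(?q \<longlongrightarrow> 0) ?F"
    by (rule Lim_transform_eventually) (use nz in eventually_elim, simp)
  moreover have "(?q \<longlongrightarrow> (\<Sum>l\<le>Suc p. a l * 0 ^ l)) ?F"
    by (intro tendsto_sum tendsto_mult tendsto_const tendsto_power h)
  ultimately have "(\<Sum>l\<le>Suc p. a l * 0 ^ l) = 0"
    using tendsto_unique[OF assms(1)] by blast
  then have a0: "a 0 = 0"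
    by (subst (asm) sum.atMost_Suc_shift) simp
  have "\<forall>\<^sub>F x in ?F. ?q x / ?h x ^ Suc p = (\<Sum>l\<le>p. a (Suc l) * ?h x ^ l) / ?h x ^ p"
    using nz
  proof eventually_elim
    case (elim x)
    have "?q x = ?h x * (\<Sum>l\<le>p. a (Suc l) * ?h x ^ l)"
      by (subst sum.atMost_Suc_shift) (simp add: a0 sum_distrib_left mult_ac)
    with elim show ?case by simp
  qed
  from Suc.IH[OF Lim_transform_eventually[OF Suc.prems this]] show ?case .
qed

lemma taylor_quotient_limit:
  assumes A: "open A" "y \<in> A" and f: "smooth1 A f" and F: "at y within B \<noteq> bot"
    and lim: "((\<lambda>x. f x / of_real (x - y) ^ p) \<longlongrightarrow> L) (at y within B)"
  shows "L = jet y f $ p"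
proof -
  let ?h = "\<lambda>x. of_real (x - y) :: complex"
  let ?q = "\<lambda>x. \<Sum>l\<le>p. jet y f $ l * ?h x ^ l"
  define r where "r = (\<lambda>x. f x - ?q x)"
  note sh = smooth1_power[OF A(1) smooth1_shift[OF A(1)]]
  have sq: "smooth1 A ?q"
    by (intro smooth1_sum smooth1_cmult sh A)
  have sr: "smooth1 A r"
    unfolding r_def by (intro smooth1_diff A f sq)
  have "jet y ?q = (\<Sum>l\<le>p. fps_const (jet y f $ l) * fps_X ^ l)"
    by (subst jet_sum[OF A(1) smooth1_cmult[OF A(1) sh] A(2)])
      (simp add: jet_cmult[OF A(1) sh A(2)] jet_power[OF A(1) smooth1_shift[OF A(1)] A(2)] jet_shift
         del: of_real_diff)
  then have jq: "jet y ?q $ l = jet y f $ l" if "l \<le> p" for l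
    using that by (simp add: fps_sum_nth fps_X_power_nth if_distrib[of "\<lambda>t. _ * t"] cong: if_cong)
  have "jet y r = jet y f - jet y ?q"
  proof -
    have "jet y f = jet y (\<lambda>x. r x + ?q x)" by (simp add: r_def)
    also have "\<dots> = jet y r + jet y ?q" by (rule jet_add[OF A(1) sr sq A(2)])
    finally show ?thesis unfolding eq_diff_eq by (rule sym)
  qed
  then have "jet y r $ l = 0" if "l \<le> p" for l using jq that by simp
  then have r0: "(vderiv ^^ l) r y = 0" if "l \<le> p" for l using that by (simp add: jet_nth)
  have "((\<lambda>x. r x / ?h x ^ p) \<longlongrightarrow> 0) (at y within B)"
    unfolding tendsto_iff
  proof (intro allI impI)
    fix \<epsilon> :: real assume "\<epsilon> > 0"
    then obtain \<delta> where \<delta>: "\<delta> > 0" "\<And>x. \<bar>x - y\<bar> < \<delta> \<Longrightarrow> norm (r x) \<le> \<epsilon> / 2 * \<bar>x - y\<bar> ^ p"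
      using peano_remainder[OF A sr r0, of p "\<epsilon> / 2"] by auto
    show "\<forall>\<^sub>F x in at y within B. dist (r x / ?h x ^ p) 0 < \<epsilon>"
      unfolding eventually_at
    proof (intro exI[of _ \<delta>] conjI ballI impI)
      fix x assume x: "x \<noteq> y \<and> dist x y < \<delta>"
      then have "norm (r x) \<le> \<epsilon> / 2 * \<bar>x - y\<bar> ^ p" using \<delta>(2) by (simp add: dist_real_def)
      then have "norm (r x / ?h x ^ p) \<le> \<epsilon> / 2"
        using x by (simp add: norm_divide norm_power divide_le_eq del: of_real_diff)
      then show "dist (r x / ?h x ^ p) 0 < \<epsilon>" using \<open>\<epsilon> > 0\<close> by simp
    qed (use \<delta> in auto)
  qed
  then have "((\<lambda>x. f x / ?h x ^ p - r x / ?h x ^ p) \<longlongrightarrow> L - 0) (at y within B)"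
    by (intro tendsto_diff lim)
  then have "((\<lambda>x. ?q x / ?h x ^ p) \<longlongrightarrow> L) (at y within B)"
    by (simp add: r_def diff_divide_distrib)
  from polynomial_quotient_limit[OF F this] show ?thesis .
qed

section \<open>Lowest terms of a formal solution\<close>

lemma smooth1_airy_mult: "open A \<Longrightarrow> smooth1 A (airy_mult N \<kappa> y p)"
proof -
  assume A: "open A"
  have "smooth1 A (\<lambda>x. - of_real (\<kappa> / real N) * of_real (x - y))"
    by (intro smooth1_cmult smooth1_shift A)
  moreover have "airy_mult N \<kappa> y p =
    (if airy_j N p = 0 then (\<lambda>x. - of_real (\<kappa> / real N) * of_real (x - y)) else (\<lambda>_. 1))"
    by (auto simp: airy_mult_def)
  ultimately show ?thesis by (simp only: smooth1_const[OF A] split: if_split) simp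
qed

lemma smooth1_seq_dx_funpow:
  assumes A: "open A" and f: "\<And>p. smooth1 A (f p)"
  shows "smooth1 A ((seq_dx N \<kappa> y ^^ i) f p)"
proof (induction i arbitrary: p)
  case (Suc i)
  have "smooth1 A (vderiv ((seq_dx N \<kappa> y ^^ i) f p))"
    using smooth1_vderiv[OF Suc, of 1] by simp
  then show ?case
    unfolding funpow.simps o_def seq_dx_def[of _ _ _ "(seq_dx N \<kappa> y ^^ i) f"]
    by (intro smooth1_add smooth1_mult smooth1_airy_mult A Suc)
qed (simp add: f)

lemma seq_dx_funpow_diff:
  assumes A: "open A" and f: "\<And>p. smooth1 A (f p)" and g: "\<And>p. smooth1 A (g p)"
  shows "x \<in> A \<Longrightarrow> (seq_dx N \<kappa> y ^^ i) (\<lambda>p x. f p x - g p x) p x =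
    (seq_dx N \<kappa> y ^^ i) f p x - (seq_dx N \<kappa> y ^^ i) g p x"
proof (induction i arbitrary: p x)
  case (Suc i)
  let ?f = "(seq_dx N \<kappa> y ^^ i) f" and ?g = "(seq_dx N \<kappa> y ^^ i) g"
  have "vderiv (\<lambda>x. ?f p x - ?g p x) x = vderiv (?f p) x - vderiv (?g p) x"
    unfolding vderiv_def[of "\<lambda>x. ?f p x - ?g p x"]
    by (intro vector_derivative_at has_vector_derivative_diff smooth1D0[OF _ Suc.prems]
       smooth1_seq_dx_funpow A f g)
  then show ?case
    using seq_dx_cong[OF A Suc.prems Suc.IH] by (simp add: seq_dx_def[of _ _ _ ?f] seq_dx_def[of _ _ _ ?g]
      seq_dx_def[of _ _ _ "\<lambda>p x. ?f p x - ?g p x"] algebra_simps)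
qed simp

text \<open>Each step looks at most one index ahead. Going from \<open>p\<close> to
  \<open>q0 + 1\<close> in \<open>Suc r\<close> steps leaves no room for \<open>vderiv\<close>;
  going to \<open>q0\<close> leaves room for one, at any of \<open>Suc r\<close> places. The factor
  x - y is picked up where \<open>airy_j\<close> is 0, and \<open>airy_j N p + 1\<close> of these
  places differentiate it.\<close>

lemma
  assumes A: "open A" and d: "\<And>p. smooth1 A (d p)" and d0: "\<And>q x. q < q0 \<Longrightarrow> x \<in> A \<Longrightarrow> d q x = 0"
  shows seq_dx_funpow_below: "x \<in> A \<Longrightarrow> p + int r < q0 \<Longrightarrow> (seq_dx N \<kappa> y ^^ r) d p x = 0"
    and seq_dx_funpow_sublead: "N \<ge> 2 \<Longrightarrow> x \<in> A \<Longrightarrow> p + int r = q0 \<Longrightarrow> r \<le> N - 1 \<Longrightarrow>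
      (seq_dx N \<kappa> y ^^ Suc r) d p x =
        (if int r \<le> airy_j N p then of_nat (Suc r) * vderiv (d q0) x
         else - of_real (\<kappa> / real N) *
           (of_nat (Suc r) * of_real (x - y) * vderiv (d q0) x + (of_int (airy_j N p) + 1) * d q0 x)) +
        airy_mult N \<kappa> y p x *
          (if int r \<le> airy_j N (p + 1) then 1 else - of_real (\<kappa> / real N * (x - y))) * d (q0 + 1) x"
proof -
  let ?\<mu> = "\<lambda>x. - of_real (\<kappa> / real N * (x - y)) :: complex"
  show below: "x \<in> A \<Longrightarrow> p + int r < q0 \<Longrightarrow> (seq_dx N \<kappa> y ^^ r) d p x = 0" for x p r
  proof (induction r arbitrary: p x)
    case (Suc r)
    have "vderiv ((seq_dx N \<kappa> y ^^ r) d p) x = vderiv (\<lambda>_. 0) x"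
      by (rule vderiv_cong[OF A Suc.prems(1)]) (use Suc in auto)
    then show ?case
      using Suc.IH[OF Suc.prems(1), of "p + 1"] Suc.prems(2) vderiv_const[of 1 0]
      by (simp add: seq_dx_def[of _ _ _ "(seq_dx N \<kappa> y ^^ r) d"])
  qed (use d0 in auto)
  have lead: "(seq_dx N \<kappa> y ^^ r) d p x = (if int r \<le> airy_j N p then 1 else ?\<mu> x) * d q0 x"
    if N: "N \<ge> 2" and "x \<in> A" "p + int r = q0" "r \<le> N - 1" for x p r
    using that(2-)
  proof (induction r arbitrary: p x)
    case 0
    then show ?case using airy_index(2)[OF N] by simp
  next
    case (Suc r)
    have "vderiv ((seq_dx N \<kappa> y ^^ r) d p) x = vderiv (\<lambda>_. 0) x"
      by (rule vderiv_cong[OF A Suc.prems(1)]) (use Suc below in auto)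
    then have "(seq_dx N \<kappa> y ^^ Suc r) d p x = airy_mult N \<kappa> y p x * (seq_dx N \<kappa> y ^^ r) d (p + 1) x"
      using vderiv_const[of 1 0] by (simp add: seq_dx_def[of _ _ _ "(seq_dx N \<kappa> y ^^ r) d"])
    also have "(seq_dx N \<kappa> y ^^ r) d (p + 1) x = (if int r \<le> airy_j N (p + 1) then 1 else ?\<mu> x) * d q0 x"
      using Suc.prems by (intro Suc.IH) auto
    finally show ?case
      using Suc.prems(3) airy_index(2)[OF N, of p]
      by (auto simp: airy_mult_def airy_index_Suc[OF N])
  qed
  have D: "(d q0 has_vector_derivative vderiv (d q0) x) (at x)" if "x \<in> A" for x
    by (rule smooth1D0[OF d that])
  have h1: "((\<lambda>x. of_real (x - y) :: complex) has_vector_derivative 1) (at x)" for x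
    using has_vector_derivative_shift_powi[of x y 1]
    by (auto intro!: derivative_eq_intros has_vector_derivative_of_real[where D=1, simplified]
       simp flip: has_real_derivative_iff_has_vector_derivative)
  have D\<mu>: "vderiv (\<lambda>x. ?\<mu> x * d q0 x) x =
    - of_real (\<kappa> / real N) * (of_real (x - y) * vderiv (d q0) x + d q0 x)" if "x \<in> A" for x
  proof -
    have "((\<lambda>x. - of_real (\<kappa> / real N) * (of_real (x - y) * d q0 x)) has_vector_derivative
      - of_real (\<kappa> / real N) * (of_real (x - y) * vderiv (d q0) x + 1 * d q0 x)) (at x)"
      by (intro has_vector_derivative_mult_right has_vector_derivative_mult h1 D[OF that])
    then show ?thesis
      unfolding vderiv_def by (intro vector_derivative_at) (simp add: mult.assoc)
  qed
  show "(seq_dx N \<kappa> y ^^ Suc r) d p x =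
        (if int r \<le> airy_j N p then of_nat (Suc r) * vderiv (d q0) x
         else - of_real (\<kappa> / real N) *
           (of_nat (Suc r) * of_real (x - y) * vderiv (d q0) x + (of_int (airy_j N p) + 1) * d q0 x)) +
        airy_mult N \<kappa> y p x *
          (if int r \<le> airy_j N (p + 1) then 1 else - of_real (\<kappa> / real N * (x - y))) * d (q0 + 1) x"
    if N: "N \<ge> 2" and "x \<in> A" "p + int r = q0" "r \<le> N - 1" for x p r
    using that(2-)
  proof (induction r arbitrary: p x)
    case 0
    then show ?case
      using airy_index(2)[OF N, of p] airy_index(2)[OF N, of "p + 1"] by (simp add: seq_dx_def)
  next
    case (Suc r)
    let ?f = "(seq_dx N \<kappa> y ^^ Suc r) d"
    have j: "0 \<le> airy_j N p" "airy_j N p \<le> int N - 2" using airy_index[OF N] by auto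
    have 1: "vderiv (?f p) x = (if int (Suc r) \<le> airy_j N p then vderiv (d q0) x
      else - of_real (\<kappa> / real N) * (of_real (x - y) * vderiv (d q0) x + d q0 x))"
    proof -
      have "vderiv (?f p) x = vderiv (\<lambda>x. (if int (Suc r) \<le> airy_j N p then 1 else ?\<mu> x) * d q0 x) x"
        by (rule vderiv_cong[OF A Suc.prems(1)]) (use Suc.prems lead[OF N] in blast)
      then show ?thesis using D\<mu>[OF Suc.prems(1)] by (simp split: if_splits)
    qed
    have 2: "?f (p + 1) x = (if int r \<le> airy_j N (p + 1) then of_nat (Suc r) * vderiv (d q0) x
         else - of_real (\<kappa> / real N) *
           (of_nat (Suc r) * of_real (x - y) * vderiv (d q0) x + (of_int (airy_j N (p + 1)) + 1) * d q0 x)) +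
        airy_mult N \<kappa> y (p + 1) x *
          (if int r \<le> airy_j N (p + 2) then 1 else ?\<mu> x) * d (q0 + 1) x"
      using Suc.IH[of x "p + 1"] Suc.prems by (simp add: add.assoc)
    have 3: "airy_mult N \<kappa> y (p + 1) x * (if int r \<le> airy_j N (p + 2) then 1 else ?\<mu> x) =
      (if int (Suc r) \<le> airy_j N (p + 1) then 1 else ?\<mu> x)"
      using Suc.prems(3) airy_index(2,3)[OF N, of "p + 1"] airy_index_Suc(1)[OF N, of "p + 1"]
      by (auto simp: airy_mult_def add.assoc)
    have 4: "(if int (Suc r) \<le> airy_j N p then vderiv (d q0) x
      else - of_real (\<kappa> / real N) * (of_real (x - y) * vderiv (d q0) x + d q0 x)) +
      airy_mult N \<kappa> y p x * (if int r \<le> airy_j N (p + 1) then of_nat (Suc r) * vderiv (d q0) x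
         else - of_real (\<kappa> / real N) *
           (of_nat (Suc r) * of_real (x - y) * vderiv (d q0) x + (of_int (airy_j N (p + 1)) + 1) * d q0 x)) =
      (if int (Suc r) \<le> airy_j N p then of_nat (Suc (Suc r)) * vderiv (d q0) x
         else - of_real (\<kappa> / real N) *
           (of_nat (Suc (Suc r)) * of_real (x - y) * vderiv (d q0) x + (of_int (airy_j N p) + 1) * d q0 x))"
    proof -
      define c h where "c = (of_real (\<kappa> / real N) :: complex)" and "h = (of_real (x - y) :: complex)"
      have m: "airy_mult N \<kappa> y p x = (if airy_j N p = 0 then - c * h else 1)"
        by (simp add: airy_mult_def c_def h_def)
      have r: "int r \<le> airy_j N (p + 1)" "\<not> int (Suc r) \<le> airy_j N p" if "airy_j N p = 0"
        using Suc.prems(3) N that by (auto simp: airy_index_Suc[OF N])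
      have r': "int r \<le> airy_j N (p + 1) \<longleftrightarrow> int (Suc r) \<le> airy_j N p"
        "of_int (airy_j N (p + 1)) = (of_int (airy_j N p) - 1 :: complex)" if "airy_j N p \<noteq> 0"
        using j that by (auto simp: airy_index_Suc[OF N])
      show ?thesis
      proof (cases "airy_j N p = 0")
        case True
        with r[OF True] show ?thesis
          unfolding m c_def[symmetric] h_def[symmetric] by (simp add: algebra_simps)
      next
        case False
        show ?thesis
          unfolding m c_def[symmetric] h_def[symmetric] r'[OF False] using False
          by (cases "int (Suc r) \<le> airy_j N p") (simp_all add: algebra_simps)
      qed
    qed
    have "(seq_dx N \<kappa> y ^^ Suc (Suc r)) d p x = vderiv (?f p) x + airy_mult N \<kappa> y p x * ?f (p + 1) x"
      by (simp add: seq_dx_def[of _ _ _ "seq_dx N \<kappa> y ((seq_dx N \<kappa> y ^^ r) d)"])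
    moreover have lin: "X + m * (Y + Z * e) = (X + m * Y) + m * Z * e" for X m Y Z e :: complex
      by (simp add: algebra_simps)
    ultimately show ?case unfolding 1 2 3 lin 4 by (simp only:)
  qed
qed

text \<open>The equation for the first nonzero coefficient of a difference of two solutions.\<close>

lemma transport_equation:
  assumes N: "N \<ge> 2" and \<kappa>: "\<kappa>\<^sup>2 = 1" and A: "open A" and d: "\<And>p. smooth1 A (d p)"
    and d0: "\<And>q x. q < q0 \<Longrightarrow> x \<in> A \<Longrightarrow> d q x = 0" and x: "x \<in> A"
    and eq: "seq_dt N \<kappa> y d p x =
      of_real \<kappa> * (\<Sum>i\<le>N. lax_op N u (int i) x * (seq_dx N \<kappa> y ^^ i) d p x)"
    and p: "q0 = p + int N - 1"
  shows "of_int (airy_k N q0) * d q0 x + of_real (x - y) * vderiv (d q0) x = 0"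
proof -
  let ?j = "airy_j N p" and ?h = "of_real (x - y) :: complex"
  have j: "0 \<le> ?j" "?j \<le> int N - 2" using airy_index[OF N] by auto
  have k: "airy_k N q0 = airy_k N p + 1" using airy_index_period[OF N] by (simp add: p)
  obtain M where M: "N = Suc (Suc M)" using N by (metis add_2_eq_Suc le_Suc_ex)
  have "(\<Sum>i\<le>N. lax_op N u (int i) x * (seq_dx N \<kappa> y ^^ i) d p x) = (seq_dx N \<kappa> y ^^ N) d p x"
  proof -
    \<comment> \<open>Terms with \<open>i < N - 1\<close> see only indices below \<open>q0\<close>.
      The one with \<open>i = N - 1\<close> would reach \<open>q0\<close> itself; it is absent
      because the operator has no coefficient at
      \<open>\<partial>\<^sup>N\<^sup>-\<^sup>1\<close>.\<close>
    have z: "lax_op N u (int i) x * (seq_dx N \<kappa> y ^^ i) d p x = 0" if "i < N" for i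
    proof (cases "i = N - 1")
      case True
      then show ?thesis using N by (simp add: lax_op_def)
    next
      case False
      then have "p + int i < q0" using that p by simp
      from seq_dx_funpow_below[where A = A and d = d and x = x, OF A d d0 x this] show ?thesis by simp
    qed
    then have "(\<Sum>i<N. lax_op N u (int i) x * (seq_dx N \<kappa> y ^^ i) d p x) = 0"
      by (intro sum.neutral ballI z) simp
    moreover have "{..N} = insert N {..<N}" by auto
    ultimately show ?thesis by (simp add: lax_op_def)
  qed
  also have "\<dots> = - of_real (\<kappa> / real N) *
           (of_nat N * ?h * vderiv (d q0) x + (of_int ?j + 1) * d q0 x) +
        airy_mult N \<kappa> y p x * (- of_real (\<kappa> / real N * (x - y))) * d (q0 + 1) x"
  proof -
    have "\<not> int (N - 1) \<le> ?j" "\<not> int (N - 1) \<le> airy_j N (p + 1)" "Suc (N - 1) = N"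
      "p + int (N - 1) = q0"
      using j N airy_index(3)[OF N, of "p + 1"] p by auto
    then show ?thesis
      using seq_dx_funpow_sublead[where A = A and d = d and p = p and r = "N - 1"
        and \<kappa> = \<kappa> and y = y and N = N and x = x, OF A d d0 N x] by simp
  qed
  finally have L: "(\<Sum>i\<le>N. lax_op N u (int i) x * (seq_dx N \<kappa> y ^^ i) d p x) = \<dots>" .
  have \<kappa>': "of_real \<kappa> * of_real \<kappa> = (1 :: complex)"
    using \<kappa> by (simp add: power2_eq_square flip: of_real_mult)
  have e: "q0 + 1 = p + int N" using p by simp
  have "seq_dt N \<kappa> y d p x = (of_int (airy_k N p) + 1 - (of_int ?j + 1) / of_nat N) * d q0 x -
     ?h / of_nat N * (airy_mult N \<kappa> y p x * d (q0 + 1) x)"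
    unfolding seq_dt_def e p by simp
  also have "of_real \<kappa> * (- of_real (\<kappa> / real N) *
           (of_nat N * ?h * vderiv (d q0) x + (of_int ?j + 1) * d q0 x) +
        airy_mult N \<kappa> y p x * (- of_real (\<kappa> / real N * (x - y))) * d (q0 + 1) x) =
     - (of_real \<kappa> * of_real \<kappa>) / of_nat N * (of_nat N * ?h * vderiv (d q0) x + (of_int ?j + 1) * d q0 x)
     - (of_real \<kappa> * of_real \<kappa>) * ?h / of_nat N * (airy_mult N \<kappa> y p x * d (q0 + 1) x)"
  proof -
    have \<mu>: "of_real (\<kappa> / real N * (x - y)) = of_real \<kappa> / of_nat N * ?h"
      by (simp del: of_real_diff)
    show ?thesis unfolding \<mu> by (simp add: algebra_simps del: of_real_diff)
  qed
  \<comment> \<open>With \<open>\<kappa>\<^sup>2 = 1\<close> the terms in \<open>d (q0 + 1)\<close>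
    are equal on both sides; the fractions (j + 1)/N cancel at the end.\<close>
  ultimately have "(of_int (airy_k N p) + 1 - (of_int ?j + 1) / of_nat N) * d q0 x =
     - (1 / of_nat N) * (of_nat N * ?h * vderiv (d q0) x + (of_int ?j + 1) * d q0 x)"
    using eq unfolding L \<kappa>' by simp
  also have "- (1 / of_nat N) * (of_nat N * ?h * vderiv (d q0) x + (of_int ?j + 1) * d q0 x) =
    - (?h * vderiv (d q0) x + (of_int ?j + 1) / of_nat N * d q0 x)"
    using N by (simp add: distrib_left del: of_real_diff)
  finally have e: "(of_int (airy_k N p) + 1 - (of_int ?j + 1) / of_nat N) * d q0 x =
    - (?h * vderiv (d q0) x + (of_int ?j + 1) / of_nat N * d q0 x)" .
  have "(K + 1) * D + w = 0" if "(K + 1 - J) * D = - (w + J * D)" for K J D w :: complex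
  proof -
    have "(K + 1) * D + w = (K + 1 - J) * D + (w + J * D)" by (simp add: algebra_simps)
    then show ?thesis using that by simp
  qed
  from this[OF e] show ?thesis unfolding k by simp
qed

text \<open>Coefficient of \<open>z\<^sup>m\<close> in \<open>\<Psi>(x, z) \<Psi>\<^sup>*(y, z) exp (- (x - y) z)\<close>, as a function of \<open>x\<close>.\<close>

definition wave_pdo :: "pdo \<Rightarrow> (nat \<Rightarrow> complex) \<Rightarrow> pdo" where
  "wave_pdo S c m x = (\<Sum>\<beta>\<le>nat (- m). S (m + int \<beta>) x * c \<beta>)"

lemma omega_wave_pdo:
  "omega S T n x y = wave_pdo S (\<lambda>\<beta>. (-1) ^ \<beta> * T (- int \<beta>) y) (- int n) x"
proof -
  have "omega S T n x y = (\<Sum>i=0..n. S (- int i) x * ((-1) ^ (n - i) * T (- int (n - i)) y))"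
    by (simp add: omega_def fps_mult_nth wave_fps_def adjoint_wave_fps_def)
  also have "\<dots> = (\<Sum>\<beta>\<le>n. S (- int n + int \<beta>) x * ((-1) ^ \<beta> * T (- int \<beta>) y))"
    by (rule sum.reindex_bij_witness[of _ "\<lambda>\<beta>. n - \<beta>" "\<lambda>i. n - i"]) (auto simp: of_nat_diff)
  finally show ?thesis by (simp add: wave_pdo_def)
qed

text \<open>\<open>wave_pdo S c\<close> is \<open>S\<close> composed with the operator
  \<open>\<Sum>\<beta>. c \<beta> \<partial>\<^sup>-\<^sup>\<beta>\<close> of constant coefficients,
  so left multiplication by \<partial> meets only \<open>S\<close>.\<close>

lemma
  assumes A: "open A" and S: "smooth_pdo A 0 S"
  shows smooth_pdo_wave: "smooth_pdo A 0 (wave_pdo S c)"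
    and wave_pdo_Dleft_funpow: "x \<in> A \<Longrightarrow> int i - m \<le> int K \<Longrightarrow>
      (pdo_Dleft ^^ i) (wave_pdo S c) m x = (\<Sum>\<beta>\<le>K. (pdo_Dleft ^^ i) S (m + int \<beta>) x * c \<beta>)"
proof -
  have s: "smooth1 A (\<lambda>x. S m x * c \<beta>)" for m \<beta>
    using S by (intro smooth1_mult A smooth1_const) (auto simp: smooth_pdo_def)
  show "smooth_pdo A 0 (wave_pdo S c)"
    unfolding smooth_pdo_def
  proof (intro conjI allI impI)
    fix m :: int assume "0 < m"
    then show "wave_pdo S c m = (\<lambda>_. 0)"
      using S by (auto simp: wave_pdo_def smooth_pdo_def)
  next
    show "smooth1 A (wave_pdo S c m)" for m
      unfolding wave_pdo_def[abs_def] by (intro smooth1_sum A s)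
  qed
  show "(pdo_Dleft ^^ i) (wave_pdo S c) m x = (\<Sum>\<beta>\<le>K. (pdo_Dleft ^^ i) S (m + int \<beta>) x * c \<beta>)"
    if "x \<in> A" "int i - m \<le> int K" for i m K x
    using that
  proof (induction i arbitrary: m x K)
    case 0
    have "(\<Sum>\<beta>\<le>nat (- m). S (m + int \<beta>) x * c \<beta>) = (\<Sum>\<beta>\<le>K. S (m + int \<beta>) x * c \<beta>)"
      using 0 S by (intro sum.mono_neutral_left) (auto simp: smooth_pdo_def)
    then show ?case by (simp add: wave_pdo_def)
  next
    case (Suc i)
    let ?S = "(pdo_Dleft ^^ i) S" and ?W = "(pdo_Dleft ^^ i) (wave_pdo S c)"
    have s: "smooth1 A (?S n)" for n
      using smooth_pdo_Dleft_funpow[OF A S, of i] by (auto simp: smooth_pdo_def)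
    have "((\<lambda>x. \<Sum>\<beta>\<le>K. ?S (m + int \<beta>) x * c \<beta>) has_vector_derivative
      (\<Sum>\<beta>\<le>K. vderiv (?S (m + int \<beta>)) x * c \<beta>)) (at x)"
      by (intro has_vector_derivative_sum has_vector_derivative_mult_left smooth1D0[OF s Suc.prems(1)])
    moreover have "vderiv (?W m) x = vderiv (\<lambda>x. \<Sum>\<beta>\<le>K. ?S (m + int \<beta>) x * c \<beta>) x"
      by (rule vderiv_cong[OF A Suc.prems(1)]) (use Suc in auto)
    ultimately have 1: "vderiv (?W m) x = (\<Sum>\<beta>\<le>K. vderiv (?S (m + int \<beta>)) x * c \<beta>)"
      by (simp add: vderiv_def vector_derivative_at)
    have 2: "?W (m - 1) x = (\<Sum>\<beta>\<le>K. ?S (m - 1 + int \<beta>) x * c \<beta>)"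
      using Suc.prems by (intro Suc.IH) auto
    show ?case
      by (simp add: pdo_Dleft_def[of ?S] pdo_Dleft_def[of ?W] 1 2 sum.distrib[symmetric] algebra_simps)
  qed
qed

text \<open>Up to a constant, \<open>(x - y)\<^sup>k\<close> times the expansion with the coefficients \<open>W\<close> is
  \<open>(x - y)\<^sup>-\<^sup>p \<Sum>n. res_coeff N k (- n) j W\<^sub>-\<^sub>n(x) (x - y)\<^sup>n\<close>; the coefficient of
  \<open>(x - y)\<^sup>0\<close> in its asymptotic expansion vanishes.\<close>

lemma wave_jet_relation:
  assumes N: "N \<ge> 2" and A: "open A" "y \<in> A" and W: "smooth_pdo A 0 W"
    and res: "\<And>q r. (pdo_Dleft ^^ q) W (- 1 - int (N * r)) y = 0"
    and j: "0 \<le> j" "j \<le> int N - 2" and p: "int p = (int k + 1) * (int N - 1) - j"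
  shows "(\<Sum>n\<le>p. res_coeff N (int k + 1) (- int n) j * jet y (W (- int n)) $ (p - n)) = 0"
proof -
  obtain a where a: "\<And>n. int n \<le> (int k + 1) * (int N - 1) - j - 1 \<Longrightarrow>
    res_coeff N (int k + 1) (- int n - 1) j * fact n = (\<Sum>i\<le>k. a i * ffall n (N * i))"
    using res_coeff_ffall[OF j] by blast
  have "int p > 0"
  proof -
    have "1 * (int N - 1) \<le> (int k + 1) * (int N - 1)" using N by (intro mult_right_mono) auto
    then have "j < (int k + 1) * (int N - 1)" using j(2) unfolding mult_1 by (elim order.strict_trans2[rotated]) simp
    then show ?thesis using p by simp
  qed
  then obtain P where P: "p = Suc P" using gr0_implies_Suc by auto
  have inner: "(\<Sum>n\<le>P. ffall n (N * i) / fact n * jet y (W (- int n - 1)) $ (P - n)) = 0" for i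
  proof (cases "N * i \<le> P")
    case False
    then show ?thesis by (auto simp: ffall_def)
  next
    case True
    \<comment> \<open>With this \<open>q\<close> and \<open>r = i\<close> the bilinear identity sums
      \<open>q choose l\<close> times the \<open>l\<close>-th derivative of
      \<open>W (- P - 1 + l)\<close> at \<open>y\<close>. For \<open>n = P - l\<close> one has
      \<open>n - N i = q - l\<close>, so \<open>(q choose l) * fact l\<close> equals
      \<open>fact q * ffall n (N * i) / fact n\<close>.\<close>
    define q where "q = P - N * i"
    have Pq: "P = q + N * i" using True by (simp add: q_def)
    let ?w = "pdo_jet y W"
    have "0 = (Dleft ^^ q) ?w (- 1 - int (N * i)) $ 0"
      using res[of q i] by (simp add: pdo_jet_Dleft_funpow[OF A(1) W A(2), symmetric] pdo_jet_nth_0)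
    also have "(Dleft ^^ q) ?w = Dpow (int q) ?w"
      by (rule Dpow_int_funpow[symmetric]) (rule ord_le_pdo_jet[OF W])
    also have "Dpow (int q) ?w (- 1 - int (N * i)) =
      (\<Sum>l\<le>q + N * i + 1. bin (int q) l * (fps_deriv ^^ l) (?w (- 1 - int (N * i) - int q + int l)))"
      by (rule Dpow_eq[OF ord_le_pdo_jet[OF W]]) simp
    also have "\<dots> $ 0 = (\<Sum>l\<le>q + N * i + 1. of_nat (q choose l) * (fact l * jet y (W (- int P - 1 + int l)) $ l))"
    proof -
      have "- 1 - int (N * i) - int q + int l = - int P - 1 + int l" for l
        by (simp add: Pq)
      then show ?thesis
        by (simp only: fps_sum_nth) (simp add: pdo_jet_def binomial_gbinomial fps_0th_higher_deriv)
    qed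
    also have "\<dots> = (\<Sum>l\<le>q. of_nat (q choose l) * (fact l * jet y (W (- int P - 1 + int l)) $ l))"
      by (rule sum.mono_neutral_right) (auto simp: binomial_eq_0)
    also have "\<dots> = (\<Sum>n\<in>{N * i..P}. fact q * (ffall n (N * i) / fact n * jet y (W (- int n - 1)) $ (P - n)))"
    proof (rule sum.reindex_bij_witness[of _ "\<lambda>n. P - n" "\<lambda>l. P - l"])
      fix l assume "l \<in> {..q}"
      then have l: "l \<le> q" "l \<le> P" "N * i \<le> P - l" "P - l - N * i = q - l" "P - (P - l) = l"
        by (auto simp: Pq)
      have e: "- int (P - l) - 1 = - int P - 1 + int l" using l by (simp add: of_nat_diff)
      have "of_nat (q choose l) * fact l = (fact q / fact (q - l) :: complex)"
        using binomial_fact[OF l(1), where 'a = complex] by simp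
      then show "fact q * (ffall (P - l) (N * i) / fact (P - l) * jet y (W (- int (P - l) - 1)) $ (P - (P - l))) =
        of_nat (q choose l) * (fact l * jet y (W (- int P - 1 + int l)) $ l)"
        unfolding l(5) e using l by (simp add: ffall_def mult.assoc[symmetric])
    qed (auto simp: Pq)
    also have "\<dots> = fact q * (\<Sum>n\<in>{N * i..P}. ffall n (N * i) / fact n * jet y (W (- int n - 1)) $ (P - n))"
      by (simp add: sum_distrib_left)
    also have "(\<Sum>n\<in>{N * i..P}. ffall n (N * i) / fact n * jet y (W (- int n - 1)) $ (P - n)) =
      (\<Sum>n\<le>P. ffall n (N * i) / fact n * jet y (W (- int n - 1)) $ (P - n))"
      by (rule sum.mono_neutral_left) (auto simp: ffall_def)
    finally show ?thesis by simp
  qed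
  have "(\<Sum>n\<le>p. res_coeff N (int k + 1) (- int n) j * jet y (W (- int n)) $ (p - n)) =
    (\<Sum>n\<le>P. res_coeff N (int k + 1) (- int n - 1) j * jet y (W (- int n - 1)) $ (P - n))"
  proof -
    have e: "- int (Suc n) = - int n - 1" for n by simp
    \<comment> \<open>The term \<open>n = 0\<close> drops out; after the shift the numbers have the
      form treated by \<open>res_coeff_ffall\<close>.\<close>
    have "res_coeff N (int k + 1) 0 j = 0"
      using res_coeff_nonneg_eq_0[of j N k 0] j N by (simp add: add.commute)
    then show ?thesis
      unfolding P by (subst sum.atMost_Suc_shift) (simp add: e del: of_nat_Suc)
  qed
  also have "\<dots> = (\<Sum>n\<le>P. \<Sum>i\<le>k. a i * (ffall n (N * i) / fact n * jet y (W (- int n - 1)) $ (P - n)))"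
  proof (intro sum.cong refl)
    fix n assume "n \<in> {..P}"
    then have "res_coeff N (int k + 1) (- int n - 1) j = (\<Sum>i\<le>k. a i * ffall n (N * i)) / fact n"
      using a[of n] p P by (simp add: field_simps)
    then show "res_coeff N (int k + 1) (- int n - 1) j * jet y (W (- int n - 1)) $ (P - n) =
      (\<Sum>i\<le>k. a i * (ffall n (N * i) / fact n * jet y (W (- int n - 1)) $ (P - n)))"
      by (simp add: sum_divide_distrib sum_distrib_right mult.assoc)
  qed
  also have "\<dots> = (\<Sum>i\<le>k. a i * (\<Sum>n\<le>P. ffall n (N * i) / fact n * jet y (W (- int n - 1)) $ (P - n)))"
    unfolding sum_distrib_left by (rule sum.swap)
  finally show ?thesis unfolding inner by simp
qed

section \<open>Comparison of two solutions on one side of the diagonal\<close>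

lemma smooth1_imp_continuous: "smooth1 A f \<Longrightarrow> x \<in> A \<Longrightarrow> isCont f x"
  using smooth1D0 has_vector_derivative_continuous by blast

text \<open>The \<open>k\<close>-th power of x - y is an integrating factor. Convexity keeps
  \<open>B\<close> on one side of \<open>y\<close>, so a single constant results.\<close>

lemma transport_constant:
  fixes d :: "real \<Rightarrow> complex"
  assumes B: "open B" "convex B" "y \<notin> B" and d: "smooth1 B d"
    and eq: "\<And>x. x \<in> B \<Longrightarrow> of_nat (Suc k) * d x + of_real (x - y) * vderiv d x = 0"
  shows "\<exists>c. \<forall>x\<in>B. of_real (x - y) ^ Suc k * d x = c"
proof -
  let ?h = "\<lambda>x. of_real (x - y) :: complex"
  have "((\<lambda>x. ?h x ^ Suc k * d x) has_vector_derivative 0) (at x within B)" if x: "x \<in> B" for x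
  proof -
    have xy: "x \<noteq> y" using x B by auto
    have "((\<lambda>x. ?h x powi (int (Suc k)) * d x) has_vector_derivative
      ?h x powi (int (Suc k)) * vderiv d x + of_int (int (Suc k)) * ?h x powi (int (Suc k) - 1) * d x) (at x)"
      by (intro has_vector_derivative_mult has_vector_derivative_shift_powi xy smooth1D0[OF d x])
    moreover have "?h x powi (int (Suc k)) * vderiv d x + of_int (int (Suc k)) * ?h x powi (int (Suc k) - 1) * d x =
      ?h x ^ k * (of_nat (Suc k) * d x + ?h x * vderiv d x)"
      unfolding power_int_of_nat by (simp add: algebra_simps del: of_real_diff)
    ultimately show ?thesis
      using eq[OF x] unfolding power_int_of_nat by (auto intro: has_vector_derivative_at_within)
  qed
  from has_vector_derivative_zero_constant[OF B(2) this] show ?thesis by (metis (no_types, lifting))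
qed

text \<open>Once all lower coefficients agree, the difference \<open>d\<close> obeys the transport
  equation, and \<open>(x - y) ^ Suc k * d\<close> is a constant \<open>c\<close>. Smoothness of
  \<open>f\<close> at \<open>y\<close>, which lies in \<open>V\<close> but not in \<open>B\<close>,
  ties \<open>c\<close> to a Taylor coefficient at the diagonal.\<close>

lemma heat_expansion_unique:
  assumes N: "N \<ge> 2" and \<kappa>: "\<kappa>\<^sup>2 = 1" and V: "open V" "y \<in> V"
    and B: "open B" "convex B" "B \<subseteq> V" "y \<notin> B" "at y within B \<noteq> bot"
    and f: "\<And>p. smooth1 V (f p)" and W: "smooth_pdo V 0 W"
    and f0: "\<And>p x. p \<le> 0 \<Longrightarrow> x \<in> B \<Longrightarrow> f p x = airy_expand N \<kappa> y 0 W p x"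
    and feq: "\<And>p x. x \<in> B \<Longrightarrow> seq_dt N \<kappa> y f p x =
      of_real \<kappa> * (\<Sum>i\<le>N. lax_op N u (int i) x * (seq_dx N \<kappa> y ^^ i) f p x)"
    and LW: "\<And>m x. x \<in> B \<Longrightarrow> (\<Sum>i\<le>N. lax_op N u (int i) x * (pdo_Dleft ^^ i) W m x) = W (m - int N) x"
    and res: "\<And>q r. (pdo_Dleft ^^ q) W (- 1 - int (N * r)) y = 0"
  shows "x \<in> B \<Longrightarrow> f p x = airy_expand N \<kappa> y 0 W p x"
proof -
  define g where "g = airy_expand N \<kappa> y 0 W"
  define d where "d = (\<lambda>p x. f p x - g p x)"
  have WB: "smooth_pdo B 0 W" using W smooth1_mono[OF _ B(3)] by (auto simp: smooth_pdo_def)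
  have fB: "smooth1 B (f p)" for p by (rule smooth1_mono[OF f B(3)])
  have gB: "smooth1 B (g p)" for p
    unfolding g_def by (rule smooth1_airy_expand[OF B(1,4) WB])
  have dB: "smooth1 B (d p)" for p
    unfolding d_def by (intro smooth1_diff B fB gB)
  have deq: "seq_dt N \<kappa> y d p x =
      of_real \<kappa> * (\<Sum>i\<le>N. lax_op N u (int i) x * (seq_dx N \<kappa> y ^^ i) d p x)" if x: "x \<in> B" for p x
  proof -
    have "seq_dt N \<kappa> y d p x = seq_dt N \<kappa> y f p x - seq_dt N \<kappa> y g p x"
      by (simp add: seq_dt_def d_def algebra_simps)
    also have "seq_dt N \<kappa> y g p x = of_real \<kappa> * (\<Sum>i\<le>N. lax_op N u (int i) x * (seq_dx N \<kappa> y ^^ i) g p x)"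
      unfolding g_def by (rule heat_equation_airy_expand[OF N \<kappa> B(1,4) WB x LW[OF x]])
    finally show ?thesis
      unfolding feq[OF x] d_def seq_dx_funpow_diff[OF B(1) fB gB x]
      by (simp add: sum_subtractf right_diff_distrib)
  qed
  have "\<forall>q\<le>int n. \<forall>x\<in>B. d q x = 0" for n
  proof (induction n)
    case 0
    then show ?case using f0 by (simp add: d_def g_def)
  next
    case (Suc n)
    define q where "q = int (Suc n)"
    define j where "j = airy_j N q"
    have q: "q = (int N - 1) * airy_k N q - j" "0 \<le> j" "j \<le> int N - 2"
      using airy_index[OF N, of q] by (auto simp: j_def)
    \<comment> \<open>A positive power of x - y is what makes the contribution of \<open>f\<close>
      vanish at the diagonal.\<close>
    have "airy_k N q > 0"
    proof (rule ccontr)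
      assume "\<not> airy_k N q > 0"
      then have "(int N - 1) * airy_k N q \<le> 0" using N by (simp add: mult_le_0_iff)
      then show False using q by (simp add: q_def)
    qed
    then obtain k where k: "airy_k N q = int (Suc k)"
      by (metis gr0_implies_Suc zero_less_imp_eq_int)
    have low: "\<And>q' x. q' < q \<Longrightarrow> x \<in> B \<Longrightarrow> d q' x = 0"
      using Suc by (simp add: q_def)
    have "of_nat (Suc k) * d q x + of_real (x - y) * vderiv (d q) x = 0" if "x \<in> B" for x
      using transport_equation[OF N \<kappa> B(1) dB low that deq[OF that, of "q - int N + 1"]] k by simp
    from transport_constant[OF B(1,2,4) dB this]
    obtain c where c: "\<And>x. x \<in> B \<Longrightarrow> of_real (x - y) ^ Suc k * d q x = c" by blast
    let ?F = "at y within B" and ?h = "\<lambda>x. of_real (x - y) :: complex"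
    let ?C = "\<lambda>n. res_coeff N (int k + 1) (- int n) j"
    define b where "b = (of_real (- \<kappa> * real N) :: complex) ^ Suc k"
    \<comment> \<open>\<open>g\<close> may have a pole at \<open>y\<close>; \<Phi> clears the
      denominator and is smooth across \<open>y\<close>, so that it has a jet there.\<close>
    define \<Phi> where "\<Phi> = (\<lambda>x. b * (\<Sum>n\<le>Suc n. ?C n * (W (- int n) x * ?h x ^ n)))"
    have sW: "smooth1 V (W m)" for m using W by (auto simp: smooth_pdo_def)
    note sh = smooth1_power[OF V(1) smooth1_shift[OF V(1)]]
    have s\<Phi>: "smooth1 V \<Phi>"
      unfolding \<Phi>_def by (intro smooth1_cmult smooth1_sum smooth1_mult V sW sh)
    have j\<Phi>: "jet y \<Phi> $ Suc n = 0"
    proof -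
      have "jet y \<Phi> = fps_const b * (\<Sum>n\<le>Suc n. fps_const (?C n) * (jet y (W (- int n)) * fps_X ^ n))"
        unfolding \<Phi>_def
        by (subst jet_cmult[OF V(1) _ V(2)], intro smooth1_cmult smooth1_sum smooth1_mult V sW sh,
            subst jet_sum[OF V(1) _ V(2)], intro smooth1_cmult smooth1_mult V sW sh,
            intro arg_cong2[where f = "(*)"] refl sum.cong,
            subst jet_cmult[OF V(1) smooth1_mult[OF V(1) sW sh] V(2)],
            subst jet_mult[OF V(1) sW sh V(2)], subst jet_power[OF V(1) smooth1_shift[OF V(1)] V(2)],
            simp add: jet_shift del: of_real_diff)
      also have "\<dots> $ Suc n = b * (\<Sum>m\<le>Suc n. ?C m * jet y (W (- int m)) $ (Suc n - m))"
        by (auto simp: fps_sum_nth fps_X_power_mult_right_nth sum_distrib_left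
          simp del: sum.atMost_Suc power_Suc intro!: sum.cong)
      also have "(\<Sum>m\<le>Suc n. ?C m * jet y (W (- int m)) $ (Suc n - m)) = 0"
        using q k by (intro wave_jet_relation[OF N V W res q(2,3)]) (simp add: q_def algebra_simps)
      finally show ?thesis by simp
    qed
    have \<Phi>g: "\<Phi> x / ?h x ^ Suc n = ?h x ^ Suc k * g q x" if x: "x \<in> B" for x
    proof -
      have h: "?h x \<noteq> 0" using x B(4) by auto
      have "g q x = (\<Sum>m=- q..0. W m x * airy_seq N \<kappa> y m q x)"
        by (simp add: g_def airy_expand_def)
      also have "\<dots> = (\<Sum>m\<le>Suc n. W (- int m) x * airy_seq N \<kappa> y (- int m) q x)"
        by (rule sum.reindex_bij_witness[of _ "\<lambda>m. - int m" "\<lambda>m. nat (- m)"]) (auto simp: q_def)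
      also have "\<dots> = (\<Sum>m\<le>Suc n. b * (?C m * (W (- int m) x * ?h x ^ m)) / (?h x ^ Suc k * ?h x ^ Suc n))"
      proof (intro sum.cong refl)
        fix m
        have n: "int (Suc n) = (int N - 1) * int (Suc k) - j"
          using q(1) unfolding k by (simp only: q_def)
        have "?h x powi (j + int m - int (Suc k) * int N) = ?h x powi (int m - (int (Suc k) + int (Suc n)))"
          unfolding n by (simp add: algebra_simps)
        also have "\<dots> = ?h x ^ m / (?h x ^ Suc k * ?h x ^ Suc n)"
          using h by (simp only: power_int_diff power_int_add power_int_of_nat simp_thms)
        finally show "W (- int m) x * airy_seq N \<kappa> y (- int m) q x =
          b * (?C m * (W (- int m) x * ?h x ^ m)) / (?h x ^ Suc k * ?h x ^ Suc n)"
          unfolding airy_seq_def k j_def[symmetric] power_int_of_nat b_def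
          by (simp add: add.commute mult_ac)
      qed
      finally have "g q x = \<Phi> x / (?h x ^ Suc k * ?h x ^ Suc n)"
        by (simp only: \<Phi>_def sum_divide_distrib sum_distrib_left)
      then show ?thesis using h by (simp del: of_real_diff power_Suc)
    qed
    \<comment> \<open>As \<open>x\<close> tends to \<open>y\<close> within \<open>B\<close> the term
      with \<open>f\<close> vanishes, so \<Phi> divided by \<open>(x - y) ^ Suc n\<close> tends to
      \<open>- c\<close>. That limit is the Taylor coefficient found to be 0 in
      \<open>j\<Phi>\<close>.\<close>
    have "((\<lambda>x. ?h x ^ Suc k * f q x - c) \<longlongrightarrow> 0 ^ Suc k * f q y - c) ?F"
    proof (intro tendsto_diff tendsto_mult tendsto_power tendsto_const)
      show "(?h \<longlongrightarrow> 0) ?F" by (auto intro!: tendsto_eq_intros)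
      show "(f q \<longlongrightarrow> f q y) ?F"
        using smooth1_imp_continuous[OF f V(2)] unfolding isCont_def
        by (rule tendsto_mono[rotated]) (simp add: at_le)
    qed
    moreover have "\<forall>\<^sub>F x in ?F. ?h x ^ Suc k * f q x - c = \<Phi> x / ?h x ^ Suc n"
      unfolding eventually_at
    proof (intro exI[of _ 1] conjI ballI impI)
      fix x assume x: "x \<in> B"
      show "?h x ^ Suc k * f q x - c = \<Phi> x / ?h x ^ Suc n"
        unfolding \<Phi>g[OF x] c[OF x, symmetric] by (simp only: d_def right_diff_distrib) simp
    qed simp
    ultimately have "((\<lambda>x. \<Phi> x / ?h x ^ Suc n) \<longlongrightarrow> - c) ?F"
      using Lim_transform_eventually by fastforce
    from taylor_quotient_limit[OF V s\<Phi> B(5) this] have "c = 0" by (simp add: j\<Phi>)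
    have "d q x = 0" if x: "x \<in> B" for x
    proof -
      have "?h x \<noteq> 0" using x B(4) by auto
      then show ?thesis using c[OF x] \<open>c = 0\<close> by (simp del: of_real_diff)
    qed
    moreover have "q' = q \<or> q' \<le> int n" if "q' \<le> int (Suc n)" for q'
      using that by (auto simp: q_def)
    ultimately show ?case using Suc by blast
  qed
  then have "d p x = 0" if "x \<in> B" for p x
    using that by (metis nat_0_le linear of_nat_0 order_refl)
  then show "x \<in> B \<Longrightarrow> f p x = airy_expand N \<kappa> y 0 W p x"
    by (simp add: d_def g_def)
qed

section \<open>The Hadamard coefficients\<close>

theorem theorem4p4:
  fixes N :: nat and \<kappa> :: real and u :: "nat \<Rightarrow> real \<Rightarrow> complex"
    and X :: "real set" and U :: "(real \<times> real) set"
    and H :: "nat \<Rightarrow> nat \<Rightarrow> real \<Rightarrow> real \<Rightarrow> complex"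
    and S T :: pdo and k j :: nat and x y :: real
  assumes "N \<ge> 2"
    and "open X" and "is_interval X"
    and "\<forall>i\<le>N - 2. smooth_on X (u i)"
    and "even N \<Longrightarrow> \<kappa> = (-1) ^ (N div 2 + 1)"
    and "odd N \<Longrightarrow> \<kappa> \<in> {1, -1}"
    and "diagonal_nbhd X U"
    and "hadamard_coefficients N \<kappa> u U H"
    and "dressing_operator N u X S"
    and "pdo_inverse_on X (pdo_adjoint S) T"
    and "k \<ge> 1" and "j \<le> N - 2"
    and "(x, y) \<in> U" and "x \<noteq> y"
  shows "H k j x y =
    of_real (- \<kappa> * real N) ^ k *
    (\<Sum>n = 1..k * (N - 1) - j.
       omega S T n x y *
       pdo_res
         (pdo_mult (pdo_D (- int n))
           (pdo_mult
             (pdo_power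
               (pdo_mult (pdo_fun (\<lambda>s. 1 / of_real (s - y))) (pdo_D (int N - 1))) k)
             (pdo_D (- int j - 1)))) x)"
proof -
  note N = \<open>N \<ge> 2\<close> and X = \<open>open X\<close> and u = \<open>\<forall>i\<le>N - 2. smooth_on X (u i)\<close>
    and S = \<open>dressing_operator N u X S\<close> and T = \<open>pdo_inverse_on X (pdo_adjoint S) T\<close>
  have \<kappa>: "\<kappa>\<^sup>2 = 1"
    using assms(5,6) by (cases "even N") (auto simp flip: power_mult)
  define V where "V = {x. (x, y) \<in> U}"
  have U: "open U" "\<And>x. x \<in> X \<Longrightarrow> (x, x) \<in> U" "U \<subseteq> X \<times> X" "is_interval V"
    using \<open>diagonal_nbhd X U\<close> by (auto simp: diagonal_nbhd_def V_def)
  have y: "y \<in> X" using \<open>(x, y) \<in> U\<close> U(3) by auto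
  have VX: "V \<subseteq> X" using U(3) by (auto simp: V_def)
  have yV: "y \<in> V" using U(2)[OF y] by (simp add: V_def)
  have V: "open V"
  proof -
    have "V = (\<lambda>x. (x, y)) -` U" by (auto simp: V_def)
    then show ?thesis by (simp add: U(1) open_vimage continuous_intros)
  qed
  \<comment> \<open>The half of the section on which \<open>x\<close> lies is convex, omits
    \<open>y\<close> and has \<open>y\<close> as a limit point; one argument serves both
    sides.\<close>
  define B where "B = V \<inter> (if x < y then {..<y} else {y<..})"
  have at_B: "at y within B = (if x < y then at_left y else at_right y)"
    using yV V by (auto simp: B_def intro!: at_within_nhd[of y V])
  have B': "at y within B \<noteq> bot"
    unfolding at_B by simp
  have B: "open B" "convex B" "B \<subseteq> V" "y \<notin> B"
    using V U(4) by (auto simp: B_def is_interval_convex_1 convex_Int)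
  have xB: "x \<in> B" using \<open>(x, y) \<in> U\<close> \<open>x \<noteq> y\<close> by (auto simp: B_def V_def)
  define c where "c = (\<lambda>\<beta>. (-1) ^ \<beta> * T (- int \<beta>) y)"
  define W where "W = wave_pdo S c"
  define f where "f = heat_seq N (heat_kernel H) y"
  note S0 = dressing_smooth_pdo[OF X u S y]
  note WX = smooth_pdo_wave[OF X S0, of c, folded W_def]
  have W0: "smooth_pdo V 0 W" using WX smooth1_mono[OF _ VX] by (auto simp: smooth_pdo_def)
  have \<omega>: "omega S T n x y = W (- int n) x" for n x
    by (simp add: omega_wave_pdo W_def c_def)
  have LW: "(\<Sum>i\<le>N. lax_op N u (int i) x * (pdo_Dleft ^^ i) W m x) = W (m - int N) x"
    if x: "x \<in> X" for m x
  proof -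
    define K where "K = nat (int N - m)"
    have "(\<Sum>i\<le>N. lax_op N u (int i) x * (pdo_Dleft ^^ i) W m x) =
      (\<Sum>i\<le>N. lax_op N u (int i) x * (\<Sum>\<beta>\<le>K. (pdo_Dleft ^^ i) S (m + int \<beta>) x * c \<beta>))"
      unfolding W_def by (intro sum.cong refl arg_cong2[where f = "(*)"] wave_pdo_Dleft_funpow[OF X S0 x])
        (auto simp: K_def)
    also have "\<dots> = (\<Sum>\<beta>\<le>K. (\<Sum>i\<le>N. lax_op N u (int i) x * (pdo_Dleft ^^ i) S (m + int \<beta>) x) * c \<beta>)"
      by (simp add: sum_distrib_left sum_distrib_right mult.assoc) (rule sum.swap)
    also have "\<dots> = (\<Sum>\<beta>\<le>K. S (m - int N + int \<beta>) x * c \<beta>)"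
      by (simp add: lax_dressing[OF X u S x] algebra_simps)
    also have "\<dots> = W (m - int N) x"
      using wave_pdo_Dleft_funpow[OF X S0 x, of 0 "m - int N" K] by (simp add: W_def K_def)
    finally show ?thesis .
  qed
  have res: "(pdo_Dleft ^^ q) W (- 1 - int (N * r)) y = 0" for q r
  proof -
    have "(pdo_Dleft ^^ q) W (- 1 - int (N * r)) y =
      (\<Sum>\<beta>\<le>q + N * r + 1. (pdo_Dleft ^^ q) S (- 1 - int (N * r) + int \<beta>) y * c \<beta>)"
      unfolding W_def by (rule wave_pdo_Dleft_funpow[OF X S0 y]) simp
    also have "\<dots> = 0"
      using dressing_residue[OF X u S T y, of q r "q + N * r + 1"] by (simp add: c_def algebra_simps)
    finally show ?thesis .
  qed
  have f_smooth: "smooth1 V (f p)" for p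
  proof -
    have "smooth1 V (\<lambda>x. H (nat (airy_k N p)) (nat (airy_j N p)) x y)" if "airy_k N p \<ge> 1"
      unfolding V_def
      using \<open>hadamard_coefficients N \<kappa> u U H\<close> that airy_index(3)[OF N, of p]
      by (intro smooth1_section[OF U(1)]) (auto simp: hadamard_coefficients_def)
    then show ?thesis
      using smooth1_const[OF V]
      by (cases "airy_k N p \<ge> 1") (auto simp: f_def heat_seq_def[abs_def] heat_kernel_def)
  qed
  have feq: "seq_dt N \<kappa> y f p x =
      of_real \<kappa> * (\<Sum>i\<le>N. lax_op N u (int i) x * (seq_dx N \<kappa> y ^^ i) f p x)" if x: "x \<in> B" for p x
  proof -
    have "(x, y) \<in> U" using x B(3) by (auto simp: V_def)
    moreover have "nat (airy_j N p) \<le> N - 2" using airy_index(3)[OF N, of p] by simp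
    ultimately have "heat_seq N (hexp_dt N \<kappa> (heat_kernel H)) y p x =
      of_real \<kappa> * heat_seq N (hexp_lax N \<kappa> u (heat_kernel H)) y p x"
      using \<open>hadamard_coefficients N \<kappa> u U H\<close> unfolding hadamard_coefficients_def heat_seq_def
      by fast
    also have "heat_seq N (hexp_lax N \<kappa> u (heat_kernel H)) y p x =
      (\<Sum>i\<le>N. lax_op N u (int i) x * heat_seq N ((hexp_dx N \<kappa> ^^ i) (heat_kernel H)) y p x)"
      by (simp add: heat_seq_def hexp_lax_def)
    finally show ?thesis
      by (simp add: heat_seq_dt[OF N] heat_seq_dx_funpow[OF N] f_def)
  qed
  have W00: "W 0 x = 1" if "x \<in> X" for x
    using S that adjoint_inverse_0[OF X u S T y]
    by (simp add: W_def wave_pdo_def c_def dressing_operator_def)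
  \<comment> \<open>For negative \<open>p\<close> the sum in \<open>airy_expand\<close> is empty and
    the heat kernel has no term. At \<open>p = 0\<close> only \<open>W 0\<close> remains, the
    product of two leading coefficients 1.\<close>
  have f0: "f p x = airy_expand N \<kappa> y 0 W p x" if "p \<le> 0" "x \<in> B" for p x
  proof (cases "p = 0")
    case True
    have "airy_j N 0 = 0" "airy_k N 0 = 0" by (simp_all add: airy_j_def airy_k_def)
    then show ?thesis
      using True that B(3) VX W00[of x]
      by (auto simp: f_def heat_seq_def heat_kernel_def airy_expand_def airy_seq_def res_coeff_0)
  next
    case False
    have "airy_k N p \<le> 0" "\<not> (airy_k N p = 0 \<and> airy_j N p = 0)"
    proof -
      show "\<not> (airy_k N p = 0 \<and> airy_j N p = 0)" using False airy_index(1)[OF N, of p] by auto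
      show "airy_k N p \<le> 0"
      proof (rule ccontr)
        assume "\<not> airy_k N p \<le> 0"
        then have "(int N - 1) * 1 \<le> (int N - 1) * airy_k N p" using N by (intro mult_left_mono) auto
        also have "(int N - 1) * airy_k N p \<le> int N - 2"
          using airy_index[OF N, of p] that(1) by linarith
        finally show False by simp
      qed
    qed
    then show ?thesis
      using False that airy_index(2)[OF N, of p]
      by (auto simp: f_def heat_seq_def heat_kernel_def airy_expand_def)
  qed
  have j: "0 \<le> int j" "int j \<le> int N - 2" using \<open>j \<le> N - 2\<close> N by auto
  define p where "p = k * (N - 1) - j"
  have "1 * (N - 1) \<le> k * (N - 1)" using \<open>k \<ge> 1\<close> by (rule mult_le_mono1)
  \<comment> \<open>Hence the subtraction in the upper limit of the sum is not truncated.\<close>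
  then have jk: "j \<le> k * (N - 1)" using j by linarith
  have p: "int p = (int N - 1) * int k - int j"
    unfolding p_def of_nat_diff[OF jk] using N by (simp add: of_nat_diff mult.commute)
  have "H k j x y = f (int p) x"
    unfolding f_def p heat_seq_index[OF N \<open>j \<le> N - 2\<close>] using \<open>k \<ge> 1\<close> by (simp add: heat_kernel_def)
  also have "\<dots> = airy_expand N \<kappa> y 0 W (int p) x"
    by (rule heat_expansion_unique[OF N \<kappa> V yV B B' f_smooth W0 f0 feq LW res xB]) (use B(3) VX in auto)
  also have "\<dots> = (\<Sum>n\<le>p. W (- int n) x * airy_seq N \<kappa> y (- int n) (int p) x)"
    unfolding airy_expand_def
    by (rule sum.reindex_bij_witness[of _ "\<lambda>n. - int n" "\<lambda>m. nat (- m)"]) auto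
  also have "\<dots> = (\<Sum>n = 1..p. W (- int n) x * airy_seq N \<kappa> y (- int n) (int p) x)"
  proof (rule sum.mono_neutral_right)
    have "res_coeff N (int k) 0 (int j) = 0"
      using res_coeff_nonneg_eq_0[of "int j" N "k - 1" 0] N j \<open>k \<ge> 1\<close> by simp
    then have "airy_seq N \<kappa> y 0 (int p) x = 0"
      by (simp add: airy_seq_def p airy_j_index[OF N j] airy_k_index[OF N j])
    then show "\<forall>n\<in>{..p} - {1..p}. W (- int n) x * airy_seq N \<kappa> y (- int n) (int p) x = 0"
      by (auto simp: not_le)
  qed auto
  also have "\<dots> = of_real (- \<kappa> * real N) ^ k * (\<Sum>n = 1..p. omega S T n x y *
      (res_coeff N (int k) (- int n) (int j) * of_real (x - y) powi (int j - - int n - int k * int N)))"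
    unfolding sum_distrib_left airy_seq_def p airy_j_index[OF N j] airy_k_index[OF N j] \<omega> power_int_of_nat
    by (intro sum.cong refl) (simp only: mult_ac)
  finally show ?thesis
    unfolding p_def using N \<open>x \<noteq> y\<close> by (subst airy_residue) auto
qed

end
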